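(* Let $g\in\mathsf{G}_0$ be a pseudo-hyperbolic element and let $g_t\in\mathsf{G}=\mathsf{SO}_0(n,n)$ ($t$ in an open interval around $0$) be an analytic one parameter family with $g_0=g$, whose tangent direction at $g$ is $G=\left.\frac{d}{dt}\right|_{t=0}g_tg^{-1}$, and let $Ge_{2n}=v$ (which lies in $\mathbb{R}^{2n-1}$). Then $$\alpha(g,v)=\left.\frac{d}{dt}\right|_{t=0}\lambda(g_t).$$
   Context: Let $n\ge1$. On $\mathbb{R}^{2n}$ with standard basis $e_1,\dots,e_{2n}$ put $\langle v\mid w\rangle=v^tI_{n,n}w$, $I_{n,n}=\mathrm{diag}(I_n,-I_n)$. $\mathsf{G}=\mathsf{SO}_0(n,n)$ is the identity component of $\mathsf{SO}(n,n)$, $\mathsf{G}_0=\{g\in\mathsf{G}:ge_{2n}=e_{2n}\}\cong\mathsf{SO}_0(n,n-1)$, and $\mathbb{R}^{n,n-1}=\mathbb{R}^{2n-1}=\mathrm{span}(e_1,\dots,e_{2n-1})$. Let $W_\pm=\mathrm{span}\{e_j\pm e_{n+j}:1\le j\le n-1\}$ and $V_+=\mathrm{span}\{e_j+e_{n+j}:1\le j\le n\}$. An element $h\in\mathsf{G}_0$ is pseudo-hyperbolic if, acting on $\mathbb{R}^{2n-1}$, the sum of its generalized eigenspaces for eigenvalues of modulus $1$ is one-dimensional and $-1$ is not an eigenvalue (so $1$ is a simple eigenvalue). Put $W^h_\pm=\{v\in\mathbb{R}^{2n-1}:\lim_{k\to\infty}h^{\mp k}v=0\}$; these are transverse $(n-1)$-dimensional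 (maximal) isotropic subspaces of $\mathbb{R}^{n,n-1}$. There is $k\in\mathsf{G}_0$ with $kW_+=W_+^h$ and $kW_-=W_-^h$, and $v^h_0:=ke_n$ is independent of the choice of $k$; it is the eigenvector of $h$ of eigenvalue $1$ with $\langle v^h_0\mid v^h_0\rangle=1$ and a definite choice of direction. The Margulis invariant of $(h,u)\in\mathsf{G}_0\ltimes\mathbb{R}^{2n-1}$ with $h$ pseudo-hyperbolic is $\alpha(h,u)=\langle u\mid v_0^h\rangle$. For $t$ small, let $W_+^{g_t}$ (resp. $W_-^{g_t}$) $\subset\mathbb{R}^{2n}$ be the $(n-1)$-dimensional $g_t$-invariant isotropic subspace which is the sum of generalized eigenspaces for the $n-1$ eigenvalues of largest (resp. smallest) modulus, so that $W_\pm^{g_0}=W_\pm^g$. Let $V_+^{g_t}$ be the unique maximal isotropic subspace of $\mathbb{R}^{2n}$ contained in $(W_+^{g_t})^\perp$ that lies in the $\mathsf{G}$-orbit of $V_+$ (so $V_+^{g_0}=W_+^g\oplus\mathbb{R}(v_0^g+e_{2n})$). Then $g_t$ preserves the line $(W_-^{g_t})^\perp\cap V_+^{g_t}$, and $\lambda(g_t)$ denotes the eigenvalue of $g_t$ on this line. *)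

theory Defs
  imports "HOL-Analysis.Analysis"
begin

(* The basis e_1, ..., e_{2n} of R^{2n} is indexed by 'n + 'n with n = CARD('n): for j in 'n,
   Inl j stands for the index j and Inr j for n + j.  The linear order on 'n only serves to name
   the index n, which is Max UNIV. *)

type_synonym 'n vec2n = "(real, 'n + 'n) vec"
type_synonym 'n mat2n = "((real, 'n + 'n) vec, 'n + 'n) vec"

abbreviation last_ix :: "'n::{finite,linorder}" where
  "last_ix \<equiv> Max UNIV"

definition e_pos :: "'n::finite \<Rightarrow> 'n vec2n" where
  "e_pos j = axis (Inl j) 1"

definition e_neg :: "'n::finite \<Rightarrow> 'n vec2n" where
  "e_neg j = axis (Inr j) 1"

definition I_nn :: "'n::finite mat2n" where
  "I_nn = (\<chi> i j. if i = j then (case i of Inl _ \<Rightarrow> 1 | Inr _ \<Rightarrow> - 1) else 0)"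

definition form :: "'n::finite vec2n \<Rightarrow> 'n vec2n \<Rightarrow> real" where
  "form v w = v \<bullet> (I_nn *v w)"

definition perp :: "'n::finite vec2n set \<Rightarrow> 'n vec2n set" where
  "perp W = {v. \<forall>w\<in>W. form v w = 0}"

definition isotropic :: "'n::finite vec2n set \<Rightarrow> bool" where
  "isotropic W \<longleftrightarrow> subspace W \<and> (\<forall>v\<in>W. \<forall>w\<in>W. form v w = 0)"

definition maximal_isotropic :: "'n::finite vec2n set \<Rightarrow> bool" where
  "maximal_isotropic W \<longleftrightarrow> isotropic W \<and> (\<forall>W'. isotropic W' \<and> W \<subseteq> W' \<longrightarrow> W' = W)"

definition SO_nn :: "'n::finite mat2n set" where
  "SO_nn = {A. transpose A ** I_nn ** A = I_nn \<and> det A = 1}"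

definition SO0_nn :: "'n::finite mat2n set" where
  "SO0_nn = connected_component_set SO_nn (mat 1)"

definition G0 :: "'n::{finite,linorder} mat2n set" where
  "G0 = {A \<in> SO0_nn. A *v e_neg last_ix = e_neg last_ix}"

text \<open>The subspace \<open>\<real>\<^sup>2\<^sup>n\<^sup>-\<^sup>1\<close> spanned by the first \<open>2n - 1\<close> basis vectors.\<close>

definition R_odd :: "'n::{finite,linorder} vec2n set" where
  "R_odd = span {axis i 1 |i. i \<noteq> Inr last_ix}"

definition std_Wplus :: "'n::{finite,linorder} vec2n set" where
  "std_Wplus = span {e_pos j + e_neg j |j. j < last_ix}"

definition std_Wminus :: "'n::{finite,linorder} vec2n set" where
  "std_Wminus = span {e_pos j - e_neg j |j. j < last_ix}"

definition std_Vplus :: "'n::finite vec2n set" where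
  "std_Vplus = span {e_pos j + e_neg j |j. True}"

definition cvec :: "(real, 'i::finite) vec \<Rightarrow> (complex, 'i) vec" where
  "cvec v = (\<chi> i. complex_of_real (v $ i))"

definition complexification :: "(real, 'i::finite) vec set \<Rightarrow> (complex, 'i) vec set" where
  "complexification U = {cvec x + \<i> *s cvec y |x y. x \<in> U \<and> y \<in> U}"

definition eigvals :: "((real, 'i::finite) vec, 'i) vec \<Rightarrow> complex set" where
  "eigvals A = {\<mu>. \<exists>z. z \<noteq> 0 \<and> map_matrix complex_of_real A *v z = \<mu> *s z}"

definition gen_eigenspace ::
  "((real, 'i::finite) vec, 'i) vec \<Rightarrow> (real, 'i) vec set \<Rightarrow> complex \<Rightarrow> (complex, 'i) vec set" where
  "gen_eigenspace A U \<mu> = {z \<in> complexification U.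
     \<exists>k. ((\<lambda>w. map_matrix complex_of_real A *v w - \<mu> *s w) ^^ k) z = 0}"

(* Real points of the sum of the generalized eigenspaces for the eigenvalues in S of A acting on
   the A-invariant subspace U.  If S is stable under conjugation, as in all uses below, then the
   complex sum is the complexification of this real subspace. *)

definition spectral_sum ::
  "((real, 'i::finite) vec, 'i) vec \<Rightarrow> (real, 'i) vec set \<Rightarrow> complex set \<Rightarrow> (real, 'i) vec set" where
  "spectral_sum A U S = {v \<in> U. cvec v \<in> vec.span (\<Union>\<mu>\<in>S. gen_eigenspace A U \<mu>)}"

definition pseudo_hyperbolic :: "'n::{finite,linorder} mat2n \<Rightarrow> bool" where
  "pseudo_hyperbolic h \<longleftrightarrow> h \<in> G0
     \<and> dim (spectral_sum h R_odd {\<mu>. cmod \<mu> = 1}) = 1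
     \<and> \<not> (\<exists>v\<in>R_odd. v \<noteq> 0 \<and> h *v v = - v)"

(* Powers are iterates of the linear map, because the power operation on vec is componentwise. *)

definition hyp_Wplus :: "'n::{finite,linorder} mat2n \<Rightarrow> 'n vec2n set" where
  "hyp_Wplus h = {v \<in> R_odd. (\<lambda>k. (((*v) (matrix_inv h)) ^^ k) v) \<longlonglongrightarrow> 0}"

definition hyp_Wminus :: "'n::{finite,linorder} mat2n \<Rightarrow> 'n vec2n set" where
  "hyp_Wminus h = {v \<in> R_odd. (\<lambda>k. (((*v) h) ^^ k) v) \<longlonglongrightarrow> 0}"

definition neutral_vec :: "'n::{finite,linorder} mat2n \<Rightarrow> 'n vec2n" where
  "neutral_vec h = (THE v. \<exists>k\<in>G0. (*v) k ` std_Wplus = hyp_Wplus h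
     \<and> (*v) k ` std_Wminus = hyp_Wminus h \<and> v = k *v e_pos last_ix)"

definition margulis :: "'n::{finite,linorder} mat2n \<Rightarrow> 'n vec2n \<Rightarrow> real" where
  "margulis h u = form u (neutral_vec h)"

(* In the next two definitions S is the set of the n - 1 eigenvalues of largest (smallest) modulus;
   "n - 1 eigenvalues, counted with multiplicity" is the condition on the dimension of W. *)

definition top_W :: "'n::finite mat2n \<Rightarrow> 'n vec2n set" where
  "top_W A = (THE W. isotropic W \<and> dim W = CARD('n) - 1 \<and> (*v) A ` W \<subseteq> W
     \<and> (\<exists>S\<subseteq>eigvals A. (\<forall>\<mu>\<in>S. \<forall>\<nu>\<in>eigvals A - S. cmod \<nu> < cmod \<mu>)
            \<and> W = spectral_sum A UNIV S))"

definition bottom_W :: "'n::finite mat2n \<Rightarrow> 'n vec2n set" where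
  "bottom_W A = (THE W. isotropic W \<and> dim W = CARD('n) - 1 \<and> (*v) A ` W \<subseteq> W
     \<and> (\<exists>S\<subseteq>eigvals A. (\<forall>\<mu>\<in>S. \<forall>\<nu>\<in>eigvals A - S. cmod \<mu> < cmod \<nu>)
            \<and> W = spectral_sum A UNIV S))"

definition top_V :: "'n::finite mat2n \<Rightarrow> 'n vec2n set" where
  "top_V A = (THE V. maximal_isotropic V \<and> V \<subseteq> perp (top_W A)
     \<and> (\<exists>k\<in>SO0_nn. V = (*v) k ` std_Vplus))"

definition line_eigenvalue :: "'n::finite mat2n \<Rightarrow> real" where
  "line_eigenvalue A = (THE c. \<forall>x\<in>perp (bottom_W A) \<inter> top_V A. A *v x = c *\<^sub>R x)"

(* Only used for open S, so it is harmless that the ball of convergence need not lie in S. *)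

definition real_analytic_on ::
  "(real \<Rightarrow> 'a::real_normed_vector) \<Rightarrow> real set \<Rightarrow> bool" where
  "real_analytic_on f S \<longleftrightarrow> (\<forall>t0\<in>S. \<exists>a. \<exists>r>0. \<forall>t\<in>S. \<bar>t - t0\<bar> < r \<longrightarrow>
     (\<lambda>k. (t - t0) ^ k *\<^sub>R a k) sums f t)"

end

theory Submission
  imports Defs "HOL-Computational_Algebra.Fundamental_Theorem_Algebra"
begin

text \<open>Near \<open>g\<close> the spectrum splits into a part outside, a part near and a part inside the unit circle.
  The real root spaces of the three parts have upper semicontinuous dimensions adding up to \<open>2n\<close>, so
  the dimensions are locally constant, and all limits of these spaces are root spaces of \<open>g\<close>. A maximal
  isotropic subspace is the graph of an orthogonal matrix \<open>Q\<close>, and it lies in the orbit of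
  \<open>std_Vplus\<close> iff \<open>det Q = 1\<close>, a closed condition. Hence unit eigenvectors \<open>x\<^sub>t\<close> on the lines defining
  \<open>\<lambda>(g\<^sub>t)\<close> converge, along subsequences, to multiples of \<open>v\<^sub>0 + e\<^sub>2\<^sub>n\<close>, where \<open>v\<^sub>0\<close> is the neutral vector.
  Pairing \<open>g\<^sub>t x\<^sub>t = \<lambda>(g\<^sub>t) x\<^sub>t\<close> with the \<open>g\<close>-fixed vector \<open>y = v\<^sub>0 - e\<^sub>2\<^sub>n\<close> gives
  \<open>(\<lambda>(g\<^sub>t) - 1) \<langle>x\<^sub>t | y\<rangle> = \<langle>(g\<^sub>t - g) x\<^sub>t | y\<rangle>\<close>, so only the continuity of \<open>x\<^sub>t\<close> is needed, and the
  skewness of \<open>G\<close> turns the limit into \<open>\<langle>G e\<^sub>2\<^sub>n | v\<^sub>0\<rangle>\<close>.\<close>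

subsection \<open>Root spaces\<close>

text \<open>On R^{2n} the eigenvalue 1 of g is double, with eigenvectors v_0 and e_{2n}, so the
  perturbation theory of simple eigenvalues says nothing about lambda. What separates the two
  eigenvalues of g_t near 1 is the orbit condition: for W isotropic of dimension n - 1 the quotient
  of W^perp by W is a plane of signature (1,1), and its two isotropic lines give two maximal
  isotropic subspaces through W, one for each sign of det Q. At g they are the lines of v_0 + e_{2n}
  and v_0 - e_{2n}, and taking the wrong one would reverse the sign of the derivative. This is why
  the graphs have to be followed to the limit together with the eigenvectors. The test vector y is
  the other isotropic fixed vector: v_0 + e_{2n} pairs to 0 with itself but to 2 with y, so division
  by the pairing is legitimate near t = 0. The unknown multiple a in the limit of the eigenvectors
  occurs in numerator and denominator and cancels. Hence every subsequence leads to the same limit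
  of difference quotients.\<close>

definition shift :: "'a::field^'i^'i \<Rightarrow> 'a \<Rightarrow> 'a^'i \<Rightarrow> 'a^'i" where
  "shift M \<mu> z = M *v z - \<mu> *s z"

lemma shift_0 [simp]: "shift M \<mu> 0 = 0"
  by (simp add: shift_def)

lemma shift_add: "shift M \<mu> (x + y) = shift M \<mu> x + shift M \<mu> y"
  by (simp add: shift_def matrix_vector_right_distrib vector_add_ldistrib)

lemma shift_diff: "shift M \<mu> (x - y) = shift M \<mu> x - shift M \<mu> y"
  by (simp add: shift_def algebra_simps)

lemma shift_scale: "shift M \<mu> (c *s x) = c *s shift M \<mu> x"
  by (simp add: shift_def vector_scalar_commute algebra_simps vector_smult_assoc)

lemma shift_commute: "shift M \<mu> (shift M \<nu> z) = shift M \<nu> (shift M \<mu> z)"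
  by (simp add: shift_def vector_scalar_commute algebra_simps vector_smult_assoc)

lemma shift_shift: "shift M \<nu> z = shift M \<mu> z + (\<mu> - \<nu>) *s z"
  by (simp add: shift_def algebra_simps)

abbreviation shifts :: "'a::field^'i^'i \<Rightarrow> 'a list \<Rightarrow> 'a^'i \<Rightarrow> 'a^'i" where
  "shifts M \<equiv> fold (shift M)"

lemma shifts_0 [simp]: "shifts M ms 0 = 0"
  by (induction ms) auto

lemma shifts_add: "shifts M ms (x + y) = shifts M ms x + shifts M ms y"
  by (induction ms arbitrary: x y) (auto simp: shift_add)

lemma shifts_scale: "shifts M ms (c *s x) = c *s shifts M ms x"
  by (induction ms arbitrary: x) (auto simp: shift_scale)

lemma shifts_shift: "shifts M ms (shift M \<mu> z) = shift M \<mu> (shifts M ms z)"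
proof (induction ms arbitrary: z)
  case (Cons a ms)
  then show ?case
    by (simp add: shift_commute[of M a \<mu>])
qed simp

lemma shifts_commute: "shifts M ms (shifts M ns z) = shifts M ns (shifts M ms z)"
  by (induction ns arbitrary: z) (auto simp: shifts_shift)

lemma shifts_eigenvector:
  assumes "M *v z = \<mu> *s z"
  shows "shifts M ms z = prod_list (map (\<lambda>\<nu>. \<mu> - \<nu>) ms) *s z"
proof (induction ms)
  case (Cons a ms)
  have "shift M a z = (\<mu> - a) *s z"
    using assms by (simp add: shift_def vector_sub_rdistrib)
  then have "shifts M (a # ms) z = (\<mu> - a) *s shifts M ms z"
    by (simp only: fold_simps shifts_scale)
  then show ?case
    using Cons by (simp only: vector_smult_assoc list.map prod_list.Cons)
qed simp

text \<open>The sum of the generalized eigenspaces for the eigenvalues in \<open>S\<close>, encoded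
  by annihilating products of linear factors. A product of bounded length passes to limits of
  matrices even when distinct roots collide, which separate generalized eigenspaces do not.\<close>

definition root_space :: "'a::field^'i^'i \<Rightarrow> 'a set \<Rightarrow> ('a^'i) set" where
  "root_space M S = {z. \<exists>ms. set ms \<subseteq> S \<and> shifts M ms z = 0}"

lemma root_spaceI: "set ms \<subseteq> S \<Longrightarrow> shifts M ms z = 0 \<Longrightarrow> z \<in> root_space M S"
  by (auto simp: root_space_def)

lemma root_space_mono: "S \<subseteq> S' \<Longrightarrow> root_space M S \<subseteq> root_space M S'"
  by (auto simp: root_space_def)

lemma root_space_0 [simp]: "0 \<in> root_space M S"
  by (rule root_spaceI[of "[]"]) auto

lemma root_space_add:
  assumes "x \<in> root_space M S" "y \<in> root_space M S"
  shows "x + y \<in> root_space M S"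
proof -
  obtain ms ns where "set ms \<subseteq> S" "shifts M ms x = 0" "set ns \<subseteq> S" "shifts M ns y = 0"
    using assms by (auto simp: root_space_def)
  then show ?thesis
    by (intro root_spaceI[of "ms @ ns"]) (auto simp: shifts_add shifts_commute[of M ns ms y])
qed

lemma root_space_scale: "x \<in> root_space M S \<Longrightarrow> c *s x \<in> root_space M S"
  by (auto simp: root_space_def shifts_scale)

lemma subspace_root_space: "vec.subspace (root_space M S)"
  by (simp add: vec.subspace_def root_space_add root_space_scale)

lemma root_space_shift: "z \<in> root_space M S \<Longrightarrow> shift M \<mu> z \<in> root_space M S"
  by (auto simp: root_space_def shifts_shift)

lemma root_space_mult: "z \<in> root_space M S \<Longrightarrow> M *v z \<in> root_space M S"
  using root_space_shift[of z M S 0] by (simp add: shift_def)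

lemma root_space_eigenvalue:
  assumes "z \<in> root_space M S" "M *v z = \<mu> *s z" "z \<noteq> 0"
  shows "\<mu> \<in> S"
proof -
  obtain ms where "set ms \<subseteq> S" "shifts M ms z = 0"
    using assms by (auto simp: root_space_def)
  then have "prod_list (map (\<lambda>\<nu>. \<mu> - \<nu>) ms) = 0"
    using assms by (simp add: shifts_eigenvector)
  then show ?thesis
    using \<open>set ms \<subseteq> S\<close> by (auto simp: prod_list_zero_iff)
qed

lemma root_space_shift_eq_0:
  assumes "z \<in> root_space M S" "shift M \<mu> z = 0" "\<mu> \<notin> S"
  shows "z = 0"
  using root_space_eigenvalue[of z M S \<mu>] assms by (auto simp: shift_def)

text \<open>A factor whose root is outside \<open>S\<close> is injective on the root space of
  \<open>S\<close> and maps it to itself, so it can be cancelled.\<close>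

lemma shifts_filter:
  assumes "z \<in> root_space M S" "shifts M ms z = 0"
  shows "shifts M (filter (\<lambda>\<mu>. \<mu> \<in> S) ms) z = 0"
  using assms
proof (induction ms arbitrary: z)
  case (Cons a ms)
  show ?case
  proof (cases "a \<in> S")
    case True
    then show ?thesis
      using Cons.IH[of "shift M a z"] Cons.prems by (simp add: root_space_shift)
  next
    case False
    have "shift M a (shifts M ms z) = 0"
      using Cons.prems by (simp add: shifts_shift)
    moreover have "shifts M ms z \<in> root_space M S"
      using Cons.prems(1) by (induction ms arbitrary: z) (auto simp: root_space_shift)
    ultimately have "shifts M ms z = 0"
      using False root_space_shift_eq_0 by blast
    then show ?thesis
      using Cons False by simp
  qed
qed simp

lemma root_space_Int: "root_space M S \<inter> root_space M S' = root_space M (S \<inter> S')"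
proof
  show "root_space M S \<inter> root_space M S' \<subseteq> root_space M (S \<inter> S')"
  proof
    fix z assume z: "z \<in> root_space M S \<inter> root_space M S'"
    then obtain ms where ms: "set ms \<subseteq> S'" "shifts M ms z = 0"
      by (auto simp: root_space_def)
    show "z \<in> root_space M (S \<inter> S')"
      by (rule root_spaceI[of "filter (\<lambda>\<mu>. \<mu> \<in> S) ms"])
        (use ms z in \<open>auto intro: shifts_filter\<close>)
  qed
qed (auto intro: root_space_mono[THEN subsetD])

lemma root_space_empty: "root_space M {} = {0}"
  by (auto simp: root_space_def)

definition eigenvalues :: "'a::field^'i^'i \<Rightarrow> 'a set" where
  "eigenvalues M = {\<mu>. \<exists>z. z \<noteq> 0 \<and> M *v z = \<mu> *s z}"

text \<open>For \<open>a\<close> not an eigenvalue \<open>shift M a\<close> is injective and can be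
  cancelled. Thus sets may be compared on the spectrum alone, which is how spectral gaps are
  exploited later.\<close>

lemma root_space_Int_eigenvalues: "root_space M (S \<inter> eigenvalues M) = root_space M S"
proof
  show "root_space M S \<subseteq> root_space M (S \<inter> eigenvalues M)"
  proof
    fix z assume "z \<in> root_space M S"
    then obtain ms where ms: "set ms \<subseteq> S" "shifts M ms z = 0"
      by (auto simp: root_space_def)
    then show "z \<in> root_space M (S \<inter> eigenvalues M)"
    proof (induction ms arbitrary: z)
      case (Cons a ms)
      show ?case
      proof (cases "a \<in> eigenvalues M")
        case True
        obtain ns where "set ns \<subseteq> S \<inter> eigenvalues M" "shifts M ns (shift M a z) = 0"
          using Cons.IH[of "shift M a z"] Cons.prems by (auto simp: root_space_def)
        then show ?thesis
          using True Cons.prems by (intro root_spaceI[of "a # ns"]) auto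
      next
        case False
        have "shift M a (shifts M ms z) = 0"
          using Cons.prems by (simp add: shifts_shift)
        then have "shifts M ms z = 0"
          using False by (auto simp: eigenvalues_def shift_def)
        then show ?thesis
          using Cons by auto
      qed
    qed auto
  qed
qed (auto intro: root_space_mono[THEN subsetD])

subsection \<open>Annihilating polynomials\<close>

text \<open>This is p(M) z. It serves only to find, for each vector, an annihilating list of roots
  no longer than the dimension.\<close>

definition poly_act :: "'a::field poly \<Rightarrow> 'a^'i^'i \<Rightarrow> 'a^'i \<Rightarrow> 'a^'i" where
  "poly_act p M z = (\<Sum>i\<le>degree p. coeff p i *s (((*v) M) ^^ i) z)"

lemma poly_act_bound:
  assumes "degree p \<le> n"
  shows "poly_act p M z = (\<Sum>i\<le>n. coeff p i *s (((*v) M) ^^ i) z)"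
  unfolding poly_act_def
  by (rule sum.mono_neutral_left) (use assms in \<open>auto simp: coeff_eq_0\<close>)

lemma matrix_power_shift: "(((*v) M) ^^ i) (shift M \<mu> z) = (((*v) M) ^^ Suc i) z - \<mu> *s (((*v) M) ^^ i) z"
proof (induction i)
  case (Suc i)
  then show ?case
    by (simp add: matrix_vector_mult_diff_distrib vector_scalar_commute)
qed (simp add: shift_def)

lemma poly_act_linear_factor: "poly_act ([:- \<mu>, 1:] * q) M z = poly_act q M (shift M \<mu> z)"
proof -
  let ?n = "degree q" and ?T = "\<lambda>i. (((*v) M) ^^ i) z"
  have deg: "degree ([:- \<mu>, 1:] * q) \<le> Suc ?n"
    using degree_mult_le[of "[:- \<mu>, 1:]" q] by simp
  have co: "coeff ([:- \<mu>, 1:] * q) i = coeff (pCons 0 q) i - \<mu> * coeff q i" for i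
    by simp
  have "poly_act ([:- \<mu>, 1:] * q) M z = (\<Sum>i\<le>Suc ?n. (coeff (pCons 0 q) i - \<mu> * coeff q i) *s ?T i)"
    unfolding poly_act_bound[OF deg] co ..
  also have "\<dots> = (\<Sum>i\<le>Suc ?n. coeff (pCons 0 q) i *s ?T i) - (\<Sum>i\<le>Suc ?n. (\<mu> * coeff q i) *s ?T i)"
    by (simp add: sum_subtractf vector_sub_rdistrib)
  also have "(\<Sum>i\<le>Suc ?n. coeff (pCons 0 q) i *s ?T i) = (\<Sum>i\<le>?n. coeff q i *s ?T (Suc i))"
    by (subst sum.atMost_Suc_shift) simp
  also have "(\<Sum>i\<le>Suc ?n. (\<mu> * coeff q i) *s ?T i) = (\<Sum>i\<le>?n. (\<mu> * coeff q i) *s ?T i)"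
    by (simp add: coeff_eq_0)
  finally show ?thesis
    unfolding poly_act_def matrix_power_shift
    by (simp add: sum_subtractf[symmetric] algebra_simps vector_smult_assoc)
qed

text \<open>Over an algebraically closed field \<open>p\<close> splits, and each root peeled off
  becomes one entry of the list.\<close>

lemma poly_act_eq_0_imp_shifts:
  fixes M :: "'a::alg_closed_field^'i^'i"
  assumes "p \<noteq> 0" "poly_act p M z = 0"
  shows "\<exists>ms. length ms \<le> degree p \<and> shifts M ms z = 0"
  using assms
proof (induction "degree p" arbitrary: p z)
  case 0
  then have "z = 0"
    using leading_coeff_neq_0[of p] by (simp add: poly_act_def)
  then show ?case
    by (intro exI[of _ "[]"]) auto
next
  case (Suc n)
  obtain \<mu> where "poly p \<mu> = 0"
    using alg_closed_imp_poly_has_root[of p] Suc by auto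
  then obtain q where q: "p = [:- \<mu>, 1:] * q"
    by (metis dvdE poly_eq_0_iff_dvd)
  with Suc have "q \<noteq> 0"
    by auto
  then have "degree p = Suc (degree q)"
    unfolding q by (subst degree_mult_eq) auto
  then obtain ms where "length ms \<le> degree q" "shifts M ms (shift M \<mu> z) = 0"
    using Suc q \<open>q \<noteq> 0\<close> by (metis poly_act_linear_factor nat.inject)
  then show ?case
    using \<open>degree p = _\<close> by (intro exI[of _ "\<mu> # ms"]) auto
qed

text \<open>One more iterate of \<open>z\<close> than the dimension forces a linear relation. If two
  iterates coincide, the set of iterates may be too small for the dimension count, but the
  coincidence itself is a relation x^i - x^j.\<close>

lemma annihilating_polynomial:
  fixes M :: "'a::field^'i^'i"
  shows "\<exists>p. p \<noteq> 0 \<and> degree p \<le> CARD('i) \<and> poly_act p M z = 0"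
proof (cases "inj_on (\<lambda>i. (((*v) M) ^^ i) z) {..CARD('i)}")
  case False
  let ?T = "\<lambda>i. (((*v) M) ^^ i) z" and ?N = "CARD('i)"
  from False obtain i j where ij: "i \<le> ?N" "j \<le> ?N" "i \<noteq> j" "?T i = ?T j"
    by (auto simp: inj_on_def)
  define p :: "'a poly" where "p = monom 1 i - monom 1 j"
  have co: "coeff p k = (if k = i then 1 else 0) - (if k = j then 1 else 0)" for k
    by (auto simp: p_def)
  have deg: "degree p \<le> ?N"
    using ij by (auto simp: co intro!: degree_le)
  have "poly_act p M z = (\<Sum>k\<le>?N. (if k = i then ?T k else 0)) - (\<Sum>k\<le>?N. (if k = j then ?T k else 0))"
    unfolding poly_act_bound[OF deg] sum_subtractf[symmetric] co
    by (intro sum.cong) auto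
  also have "\<dots> = 0"
    using ij by simp
  moreover have "coeff p i \<noteq> 0"
    using ij by (simp add: co)
  ultimately show ?thesis
    using deg by (intro exI[of _ p]) (auto)
next
  case True
  let ?T = "\<lambda>i. (((*v) M) ^^ i) z" and ?N = "CARD('i)"
  have "vec.dependent (?T ` {..?N})"
    by (rule vec.dependent_biggerset_general) (use True in \<open>simp add: card_image le_imp_less_Suc dim_subset_UNIV_cart_gen\<close>)
  then obtain u where u: "\<exists>v\<in>?T ` {..?N}. u v \<noteq> 0" "(\<Sum>v\<in>?T ` {..?N}. u v *s v) = 0"
    by (subst (asm) vec.dependent_finite) auto
  define p where "p = (\<Sum>i\<le>?N. monom (u (?T i)) i)"
  have co: "coeff p k = (if k \<le> ?N then u (?T k) else 0)" for k
    by (simp add: p_def coeff_sum)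
  have deg: "degree p \<le> ?N"
    by (auto simp: co intro!: degree_le)
  have "poly_act p M z = (\<Sum>i\<le>?N. u (?T i) *s ?T i)"
    unfolding poly_act_bound[OF deg] co by (intro sum.cong) auto
  also have "\<dots> = 0"
    using u(2) by (subst (asm) sum.reindex[OF True]) (simp add: o_def)
  moreover have "p \<noteq> 0"
    using u(1) co by (metis (no_types, lifting) atMost_iff coeff_0 imageE)
  ultimately show ?thesis
    using deg by auto
qed

lemma annihilating_shifts:
  fixes M :: "'a::alg_closed_field^'i^'i"
  shows "\<exists>ms. length ms \<le> CARD('i) \<and> shifts M ms z = 0"
  using annihilating_polynomial[of M z] poly_act_eq_0_imp_shifts by (metis order_trans)

lemma root_space_UNIV:
  fixes M :: "'a::alg_closed_field^'i^'i"
  shows "root_space M UNIV = UNIV"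
  using annihilating_shifts[of M] by (auto simp: root_space_def)

text \<open>The uniform bound on the length is what lets limits be taken entry by entry in
  \<open>shifts_limit\<close>.\<close>

lemma root_space_short_list:
  fixes M :: "'a::alg_closed_field^'i^'i"
  assumes "z \<in> root_space M S"
  shows "\<exists>ms. length ms \<le> CARD('i) \<and> set ms \<subseteq> S \<inter> eigenvalues M \<and> shifts M ms z = 0"
proof -
  obtain ms where ms: "length ms \<le> CARD('i)" "shifts M ms z = 0"
    using annihilating_shifts by blast
  have "z \<in> root_space M (S \<inter> eigenvalues M)"
    using assms by (simp add: root_space_Int_eigenvalues)
  then have "shifts M (filter (\<lambda>\<mu>. \<mu> \<in> S \<inter> eigenvalues M) ms) z = 0"
    using ms by (intro shifts_filter) auto
  then show ?thesis
    using ms by (intro exI[of _ "filter (\<lambda>\<mu>. \<mu> \<in> S \<inter> eigenvalues M) ms"])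
      (auto intro: le_trans[OF length_filter_le])
qed

text \<open>The lists annihilating the basis vectors together contain the roots needed for every
  vector; an eigenvector can only be annihilated by a list that contains its eigenvalue.\<close>

lemma finite_eigenvalues:
  fixes M :: "'a::alg_closed_field^'i^'i"
  shows "finite (eigenvalues M)"
proof -
  have "\<forall>i. \<exists>ms. shifts M ms (axis i 1) = 0"
    using annihilating_shifts by blast
  then obtain f where f: "\<And>i. shifts M (f i) (axis i 1) = 0"
    by metis
  have "\<mu> \<in> (\<Union>i. set (f i))" if \<mu>: "\<mu> \<in> eigenvalues M" for \<mu>
  proof -
    obtain z where z: "z \<noteq> 0" "M *v z = \<mu> *s z"
      using \<mu> unfolding eigenvalues_def by blast
    have "axis i 1 \<in> root_space M (\<Union>i. set (f i))" for i
      by (rule root_spaceI[of "f i"]) (use f in auto)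
    then have "(\<Sum>i\<in>UNIV. z $ i *s axis i 1) \<in> root_space M (\<Union>i. set (f i))"
      by (intro vec.subspace_sum subspace_root_space root_space_scale) auto
    then have "z \<in> root_space M (\<Union>i. set (f i))"
      by (simp add: basis_expansion)
    then show ?thesis
      using z root_space_eigenvalue by blast
  qed
  then have "eigenvalues M \<subseteq> (\<Union>i. set (f i))"
    by blast
  then show ?thesis
    by (rule finite_subset) auto
qed

subsection \<open>Decomposition into generalized eigenspaces\<close>

lemma shift_funpow_commute: "(shift M \<mu> ^^ k) (shift M \<nu> z) = shift M \<nu> ((shift M \<mu> ^^ k) z)"
  by (induction k arbitrary: z) (auto simp: shift_commute)

lemma shift_funpow_diff: "(shift M \<mu> ^^ k) (x - y) = (shift M \<mu> ^^ k) x - (shift M \<mu> ^^ k) y"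
  by (induction k arbitrary: x y) (auto simp: shift_diff)

lemma shift_funpow_scale: "(shift M \<mu> ^^ k) (c *s x) = c *s (shift M \<mu> ^^ k) x"
  by (induction k arbitrary: x) (auto simp: shift_scale)

lemma shifts_replicate: "shifts M (replicate k \<mu>) z = (shift M \<mu> ^^ k) z"
  by (induction k arbitrary: z) (auto simp: funpow_swap1)

text \<open>On the generalized eigenspace of \<nu> the operator M - \<mu> is nilpotent plus the
  nonzero scalar \<nu> - \<mu>, hence invertible there. The induction on \<open>k\<close> unrolls
  the finite geometric series of the inverse.\<close>

lemma shift_solve:
  assumes "vec.subspace U" "\<And>z. z \<in> U \<Longrightarrow> M *v z \<in> U" "\<mu> \<noteq> \<nu>"
    and "y \<in> U" "(shift M \<nu> ^^ k) y = 0"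
  shows "\<exists>x\<in>U. (shift M \<nu> ^^ k) x = 0 \<and> shift M \<mu> x = y"
  using assms(4,5)
proof (induction k arbitrary: y)
  case 0
  then show ?case by (intro bexI[of _ 0]) auto
next
  case (Suc k)
  have inU: "shift M \<nu> z \<in> U" if "z \<in> U" for z
    unfolding shift_def using assms(1,2) that by (simp add: vec.subspace_diff vec.subspace_scale)
  have "(shift M \<nu> ^^ k) (shift M \<nu> y) = 0"
    using Suc.prems by (simp add: shift_funpow_commute)
  then obtain x where x: "x \<in> U" "(shift M \<nu> ^^ k) x = 0" "shift M \<mu> x = shift M \<nu> y"
    using Suc.IH inU Suc.prems by blast
  \<comment> \<open>Since M - \<mu> sends \<open>x\<close> to (M - \<nu>) y, it sends y - x to
    (\<nu> - \<mu>) y.\<close>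
  define w where "w = inverse (\<nu> - \<mu>) *s (y - x)"
  have "shift M \<mu> w = inverse (\<nu> - \<mu>) *s (shift M \<mu> y - shift M \<nu> y)"
    by (simp add: w_def shift_scale shift_diff x)
  also have "\<dots> = y"
    using assms(3) by (simp add: shift_shift[of M \<mu> y \<nu>] vector_smult_assoc del: vector_sub_rdistrib)
  finally have "shift M \<mu> w = y" .
  moreover have "w \<in> U"
    using assms(1) Suc.prems x by (simp add: w_def vec.subspace_diff vec.subspace_scale)
  moreover have "(shift M \<nu> ^^ Suc k) w = 0"
    using Suc.prems x by (simp add: w_def shift_funpow_diff shift_funpow_scale shift_diff shift_scale)
  ultimately show ?case by blast
qed

text \<open>Primary decomposition inside an invariant \<open>U\<close>. A general \<open>U\<close>
  is required because pseudo-hyperbolicity speaks of the action on \<open>R_odd\<close>, while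
  \<open>top_W\<close> and \<open>bottom_W\<close> use the whole space.\<close>

lemma root_space_subset_span:
  assumes U: "vec.subspace U" "\<And>z. z \<in> U \<Longrightarrow> M *v z \<in> U"
    and "z \<in> U" "z \<in> root_space M S"
  shows "z \<in> vec.span (\<Union>\<mu>\<in>S. {w \<in> U. \<exists>k. (shift M \<mu> ^^ k) w = 0})"
proof -
  let ?GE = "\<lambda>\<mu>. {w \<in> U. \<exists>k. (shift M \<mu> ^^ k) w = 0}"
  have inU: "shift M \<mu> z \<in> U" if "z \<in> U" for z \<mu>
    unfolding shift_def using U that by (simp add: vec.subspace_diff vec.subspace_scale)
  \<comment> \<open>Concatenating root lists absorbs the different exponents of \<open>x\<close> and
    \<open>y\<close>.\<close>
  have GE_add: "x + y \<in> ?GE \<mu>" if xy: "x \<in> ?GE \<mu>" "y \<in> ?GE \<mu>" for x y \<mu>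
  proof -
    obtain k l where kl: "(shift M \<mu> ^^ k) x = 0" "(shift M \<mu> ^^ l) y = 0"
      using xy by blast
    have "x \<in> root_space M {\<mu>}" "y \<in> root_space M {\<mu>}"
      by (auto intro: root_spaceI[of "replicate k \<mu>"] root_spaceI[of "replicate l \<mu>"]
          simp: shifts_replicate kl)
    then have "x + y \<in> root_space M {\<mu>}"
      by (rule root_space_add)
    then obtain ms where ms: "set ms \<subseteq> {\<mu>}" "shifts M ms (x + y) = 0"
      by (auto simp: root_space_def)
    then have "ms = replicate (length ms) \<mu>"
      by (metis replicate_length_same singletonD subsetD)
    then have "(shift M \<mu> ^^ length ms) (x + y) = 0"
      using ms(2) by (metis shifts_replicate)
    then show ?thesis
      using xy U by (auto simp: vec.subspace_add)
  qed
  \<comment> \<open>Modulo the generalized eigenspace of \<mu>, the map M - \<mu> is onto the span: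
    summands for \<nu> different from \<mu> are solved by \<open>shift_solve\<close>, and the
    summand for \<mu> is left over as the error.\<close>
  have key: "\<exists>x\<in>vec.span (\<Union>\<mu>\<in>S. ?GE \<mu>). x \<in> U \<and> y - shift M \<mu> x \<in> ?GE \<mu>"
    if "y \<in> vec.span (\<Union>\<mu>\<in>S. ?GE \<mu>)" "y \<in> U" for y \<mu>
    using that(1)
  proof (induction rule: vec.span_induct_alt)
    case base
    have "\<exists>k. (shift M \<mu> ^^ k) 0 = 0"
      by (rule exI[of _ 0]) simp
    then show ?case
      using U vec.subspace_0[OF U(1)] by (intro bexI[of _ 0]) (auto simp: vec.span_zero)
  next
    case (step c u y)
    then obtain x where x: "x \<in> vec.span (\<Union>\<mu>\<in>S. ?GE \<mu>)" "x \<in> U" "y - shift M \<mu> x \<in> ?GE \<mu>"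
      by blast
    obtain \<nu> k where \<nu>: "\<nu> \<in> S" "u \<in> U" "(shift M \<nu> ^^ k) u = 0"
      using step by blast
    show ?case
    proof (cases "\<nu> = \<mu>")
      case True
      have "c *s u \<in> ?GE \<mu>"
        using \<nu> True U by (auto simp: vec.subspace_scale shift_funpow_scale)
      then have "c *s u + (y - shift M \<mu> x) \<in> ?GE \<mu>"
        by (rule GE_add[OF _ x(3)])
      then have "c *s u + y - shift M \<mu> x \<in> ?GE \<mu>"
        by (simp only: add_diff_eq)
      then show ?thesis
        using x by blast
    next
      case False
      then obtain x' where x': "x' \<in> U" "(shift M \<nu> ^^ k) x' = 0" "shift M \<mu> x' = u"
        using shift_solve[OF U, of \<mu> \<nu> u k] \<nu> by auto
      have "x' \<in> vec.span (\<Union>\<mu>\<in>S. ?GE \<mu>)"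
        using x' \<nu> by (intro vec.span_base) auto
      then have "c *s x' + x \<in> vec.span (\<Union>\<mu>\<in>S. ?GE \<mu>)"
        using x by (simp add: vec.span_add vec.span_scale)
      moreover have "c *s u + y - shift M \<mu> (c *s x' + x) \<in> ?GE \<mu>"
        using x(3) by (simp add: shift_add shift_scale x')
      moreover have "c *s x' + x \<in> U"
        using x x' U by (simp add: vec.subspace_add vec.subspace_scale)
      ultimately show ?thesis
        by (intro bexI[of _ "c *s x' + x"] conjI)
    qed
  qed
  obtain ms where "set ms \<subseteq> S" "shifts M ms z = 0"
    using assms by (auto simp: root_space_def)
  with \<open>z \<in> U\<close> show ?thesis
  proof (induction ms arbitrary: z)
    case Nil
    then show ?case by (simp add: vec.span_zero)
  next
    case (Cons \<mu> ms)
    then have "shift M \<mu> z \<in> vec.span (\<Union>\<mu>\<in>S. ?GE \<mu>)"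
      by (simp add: inU)
    then obtain x where x: "x \<in> vec.span (\<Union>\<mu>\<in>S. ?GE \<mu>)" "x \<in> U" "shift M \<mu> z - shift M \<mu> x \<in> ?GE \<mu>"
      using key inU Cons by blast
    \<comment> \<open>If M - \<mu> maps z - x into the generalized eigenspace of \<mu>, then z - x
      already lies in it, one exponent higher.\<close>
    then obtain k where "(shift M \<mu> ^^ k) (shift M \<mu> (z - x)) = 0"
      by (auto simp: shift_diff)
    then have "(shift M \<mu> ^^ Suc k) (z - x) = 0"
      by (simp add: shift_funpow_commute)
    then have "z - x \<in> ?GE \<mu>"
      using x Cons.prems U vec.subspace_diff by blast
    then have "z - x \<in> vec.span (\<Union>\<mu>\<in>S. ?GE \<mu>)"
      using Cons.prems by (intro vec.span_base) auto
    then have "z - x + x \<in> vec.span (\<Union>\<mu>\<in>S. ?GE \<mu>)"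
      using x(1) by (rule vec.span_add)
    then show ?case
      by simp
  qed
qed

lemma span_subset_root_space:
  "vec.span (\<Union>\<mu>\<in>S. {w \<in> U. \<exists>k. (shift M \<mu> ^^ k) w = 0}) \<subseteq> root_space M S"
proof (rule vec.span_minimal[OF _ subspace_root_space], safe)
  fix \<mu> w k assume "\<mu> \<in> S" "(shift M \<mu> ^^ k) w = 0"
  then show "w \<in> root_space M S"
    by (intro root_spaceI[of "replicate k \<mu>"]) (auto simp: shifts_replicate)
qed

lemma root_space_Un:
  assumes "z \<in> root_space M (S \<union> S')"
  obtains x y where "x \<in> root_space M S" "y \<in> root_space M S'" "z = x + y"
proof -
  have "z \<in> vec.span (\<Union>\<mu>\<in>S \<union> S'. {w \<in> UNIV. \<exists>k. (shift M \<mu> ^^ k) w = 0})"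
    by (rule root_space_subset_span) (use assms vec.subspace_UNIV in auto)
  moreover have "vec.span (\<Union>\<mu>\<in>S \<union> S'. {w \<in> UNIV. \<exists>k. (shift M \<mu> ^^ k) w = 0})
      \<subseteq> {x + y |x y. x \<in> root_space M S \<and> y \<in> root_space M S'}"
  proof (rule vec.span_minimal)
    have GE: "w \<in> root_space M {\<mu>}" if "(shift M \<mu> ^^ k) w = 0" for w \<mu> k
      using that by (intro root_spaceI[of "replicate k \<mu>"]) (auto simp: shifts_replicate)
    show "(\<Union>\<mu>\<in>S \<union> S'. {w \<in> UNIV. \<exists>k. (shift M \<mu> ^^ k) w = 0})
      \<subseteq> {x + y |x y. x \<in> root_space M S \<and> y \<in> root_space M S'}"
    proof safe
      fix \<mu> w k assume "\<mu> \<in> S" "(shift M \<mu> ^^ k) w = 0"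
      then have "w \<in> root_space M S"
        using GE root_space_mono[of "{\<mu>}" S M] by auto
      then show "\<exists>x y. w = x + y \<and> x \<in> root_space M S \<and> y \<in> root_space M S'"
        by (intro exI[of _ w] exI[of _ 0]) auto
    next
      fix \<mu> w k assume "\<mu> \<in> S'" "(shift M \<mu> ^^ k) w = 0"
      then have "w \<in> root_space M S'"
        using GE root_space_mono[of "{\<mu>}" S' M] by auto
      then show "\<exists>x y. w = x + y \<and> x \<in> root_space M S \<and> y \<in> root_space M S'"
        by (intro exI[of _ 0] exI[of _ w]) auto
    qed
    show "vec.subspace {x + y |x y. x \<in> root_space M S \<and> y \<in> root_space M S'}"
      by (rule vec.subspace_sums) (rule subspace_root_space)+
  qed
  ultimately show ?thesis
    using that by blast
qed

subsection \<open>Real root spaces\<close>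

abbreviation cmat :: "real^'i^'j \<Rightarrow> complex^'i^'j" where
  "cmat \<equiv> map_matrix complex_of_real"

definition cnj_vec :: "complex^'i \<Rightarrow> complex^'i" where
  "cnj_vec z = (\<chi> i. cnj (z $ i))"

lemma cvec_nth [simp]: "cvec v $ i = of_real (v $ i)"
  by (simp add: cvec_def)

lemma cvec_add: "cvec (v + w) = cvec v + cvec w"
  by (simp add: vec_eq_iff)

lemma cvec_scaleR: "cvec (c *\<^sub>R v) = of_real c *s cvec v"
  by (simp add: vec_eq_iff)

lemma cvec_0 [simp]: "cvec 0 = 0"
  by (simp add: vec_eq_iff)

lemma cvec_eq_iff [simp]: "cvec v = cvec w \<longleftrightarrow> v = w"
  by (simp add: vec_eq_iff)

lemma cvec_mult: "cvec (A *v v) = cmat A *v cvec v"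
  by (simp add: vec_eq_iff matrix_vector_mult_def map_matrix_def)

lemma cvec_Re_Im: "z = cvec (\<chi> i. Re (z $ i)) + \<i> *s cvec (\<chi> i. Im (z $ i))"
  by (simp add: vec_eq_iff complex_eq_iff)

lemma cvec_Re: "cvec (\<chi> i. Re (z $ i)) = (1/2) *s (z + cnj_vec z)"
  by (simp add: vec_eq_iff complex_eq_iff cnj_vec_def)

lemma cnj_vec_0 [simp]: "cnj_vec 0 = 0"
  by (simp add: cnj_vec_def vec_eq_iff)

lemma cnj_vec_shift: "cnj_vec (shift (cmat A) \<mu> z) = shift (cmat A) (cnj \<mu>) (cnj_vec z)"
  by (simp add: vec_eq_iff shift_def cnj_vec_def matrix_vector_mult_def map_matrix_def)

lemma cnj_vec_shifts: "cnj_vec (shifts (cmat A) ms z) = shifts (cmat A) (map cnj ms) (cnj_vec z)"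
  by (induction ms arbitrary: z) (auto simp: cnj_vec_shift)

lemma cnj_vec_root_space:
  assumes "cnj ` S \<subseteq> S" "z \<in> root_space (cmat A) S"
  shows "cnj_vec z \<in> root_space (cmat A) S"
proof -
  obtain ms where ms: "set ms \<subseteq> S" "shifts (cmat A) ms z = 0"
    using assms by (auto simp: root_space_def)
  then have "shifts (cmat A) (map cnj ms) (cnj_vec z) = 0"
    by (metis cnj_vec_0 cnj_vec_shifts)
  then show ?thesis
    using ms assms by (intro root_spaceI[of "map cnj ms"]) auto
qed

definition real_root_space :: "real^'i^'i \<Rightarrow> complex set \<Rightarrow> (real^'i) set" where
  "real_root_space A S = {v. cvec v \<in> root_space (cmat A) S}"

lemma subspace_real_root_space: "subspace (real_root_space A S)"
  by (auto simp: subspace_def real_root_space_def cvec_add cvec_scaleR root_space_add root_space_scale)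

lemma real_root_space_mult: "v \<in> real_root_space A S \<Longrightarrow> A *v v \<in> real_root_space A S"
  by (simp add: real_root_space_def cvec_mult root_space_mult)

lemma real_root_space_mono: "S \<subseteq> S' \<Longrightarrow> real_root_space A S \<subseteq> real_root_space A S'"
  using root_space_mono[of S S' "cmat A"] by (auto simp: real_root_space_def)

lemma real_root_space_Int: "real_root_space A S \<inter> real_root_space A S' = real_root_space A (S \<inter> S')"
  by (simp add: real_root_space_def root_space_Int[symmetric] Collect_conj_eq)

lemma real_root_space_empty: "real_root_space A {} = {0}"
  using cvec_eq_iff[of _ 0] by (auto simp: real_root_space_def root_space_empty)

lemma real_root_space_UNIV: "real_root_space A UNIV = UNIV"
  by (auto simp: real_root_space_def root_space_UNIV)

lemma real_root_space_Int_eigvals: "real_root_space A (S \<inter> eigvals A) = real_root_space A S"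
  using root_space_Int_eigenvalues[of "cmat A" S]
  by (simp add: real_root_space_def eigvals_def eigenvalues_def)

lemma real_root_space_eigenvector:
  assumes "A *v v = c *\<^sub>R v" "of_real c \<in> S"
  shows "v \<in> real_root_space A S"
proof -
  have "shift (cmat A) (of_real c) (cvec v) = 0"
    by (simp add: shift_def assms cvec_scaleR flip: cvec_mult)
  then show ?thesis
    using assms by (auto simp: real_root_space_def intro!: root_spaceI[of "[of_real c]"])
qed

text \<open>The complex summands of a real vector need not be real. For sets stable under
  conjugation their real parts, being averages of a vector and its conjugate, stay in the root
  spaces and still add up to \<open>v\<close>.\<close>

lemma real_root_space_Un:
  assumes "v \<in> real_root_space A (S \<union> S')" "cnj ` S \<subseteq> S" "cnj ` S' \<subseteq> S'"
  obtains x y where "x \<in> real_root_space A S" "y \<in> real_root_space A S'" "v = x + y"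
proof -
  obtain z w where zw: "z \<in> root_space (cmat A) S" "w \<in> root_space (cmat A) S'" "cvec v = z + w"
    using assms by (auto simp: real_root_space_def elim: root_space_Un)
  define x y where "x = (\<chi> i. Re (z $ i))" and "y = (\<chi> i. Re (w $ i))"
  have "v = x + y"
    using arg_cong[OF zw(3), of "\<lambda>u. \<chi> i. Re (u $ i)"] by (simp add: x_def y_def vec_eq_iff)
  moreover have "x \<in> real_root_space A S" "y \<in> real_root_space A S'"
    using zw assms unfolding x_def y_def real_root_space_def mem_Collect_eq cvec_Re
    by (blast intro: root_space_scale root_space_add cnj_vec_root_space)+
  ultimately show ?thesis
    using that by blast
qed

lemma dim_real_root_space_Un:
  assumes "S \<inter> S' = {}" "cnj ` S \<subseteq> S" "cnj ` S' \<subseteq> S'"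
  shows "dim (real_root_space A (S \<union> S')) = dim (real_root_space A S) + dim (real_root_space A S')"
proof -
  let ?E = "real_root_space A"
  have "?E (S \<union> S') = {x + y |x y. x \<in> ?E S \<and> y \<in> ?E S'}"
  proof
    show "?E (S \<union> S') \<subseteq> {x + y |x y. x \<in> ?E S \<and> y \<in> ?E S'}"
      using real_root_space_Un[OF _ assms(2,3), of _ A] by blast
    have "?E S \<subseteq> ?E (S \<union> S')" "?E S' \<subseteq> ?E (S \<union> S')"
      by (auto intro: real_root_space_mono[THEN subsetD])
    then show "{x + y |x y. x \<in> ?E S \<and> y \<in> ?E S'} \<subseteq> ?E (S \<union> S')"
      using subspace_real_root_space[of A "S \<union> S'"] by (auto intro!: subspace_add)
  qed
  moreover have "?E S \<inter> ?E S' = {0}"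
    by (simp add: real_root_space_Int assms real_root_space_empty)
  ultimately show ?thesis
    using dim_sums_Int[OF subspace_real_root_space[of A S] subspace_real_root_space[of A S']] by simp
qed

section \<open>Spectral sums as real root spaces\<close>

lemma complexification_subspace:
  assumes "subspace U"
  shows "vec.subspace (complexification U)"
proof (unfold vec.subspace_def, intro conjI ballI allI)
  show "0 \<in> complexification U"
    using subspace_0[OF assms] by (auto simp: complexification_def intro!: exI[of _ 0])
  fix z w assume z: "z \<in> complexification U" and w: "w \<in> complexification U"
  then obtain x y x' y' where xy: "z = cvec x + \<i> *s cvec y" "w = cvec x' + \<i> *s cvec y'"
    "x \<in> U" "y \<in> U" "x' \<in> U" "y' \<in> U"
    by (auto simp: complexification_def)
  have "z + w = cvec (x + x') + \<i> *s cvec (y + y')"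
    by (simp add: xy cvec_add vector_add_ldistrib)
  then show "z + w \<in> complexification U"
    using xy assms unfolding complexification_def by (blast intro: subspace_add)
next
  fix c z assume z: "z \<in> complexification U"
  then obtain x y where xy: "z = cvec x + \<i> *s cvec y" "x \<in> U" "y \<in> U"
    by (auto simp: complexification_def)
  have "c *s z = cvec (Re c *\<^sub>R x - Im c *\<^sub>R y) + \<i> *s cvec (Re c *\<^sub>R y + Im c *\<^sub>R x)"
    by (simp add: xy vec_eq_iff complex_eq_iff)
  then show "c *s z \<in> complexification U"
    using xy assms unfolding complexification_def
    by (blast intro: subspace_add subspace_diff subspace_scale)
qed

lemma complexification_mult:
  assumes "\<And>x. x \<in> U \<Longrightarrow> A *v x \<in> U" "z \<in> complexification U"
  shows "cmat A *v z \<in> complexification U"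
proof -
  obtain x y where xy: "z = cvec x + \<i> *s cvec y" "x \<in> U" "y \<in> U"
    using assms by (auto simp: complexification_def)
  have "cmat A *v z = cvec (A *v x) + \<i> *s cvec (A *v y)"
    by (simp add: xy matrix_vector_right_distrib vector_scalar_commute cvec_mult)
  then show ?thesis
    using xy assms unfolding complexification_def by blast
qed

text \<open>The bridge from the spectral sums of the definitions to root spaces: primary
  decomposition is applied inside the complexification of \<open>U\<close>.\<close>

lemma spectral_sum_eq:
  assumes "subspace U" "\<And>x. x \<in> U \<Longrightarrow> A *v x \<in> U"
  shows "spectral_sum A U S = U \<inter> real_root_space A S"
proof -
  let ?U = "complexification U"
  have sh: "(\<lambda>w. cmat A *v w - \<mu> *s w) = shift (cmat A) \<mu>" for \<mu>
    by (auto simp: shift_def)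
  have "cvec v \<in> vec.span (\<Union>\<mu>\<in>S. gen_eigenspace A U \<mu>) \<longleftrightarrow> cvec v \<in> root_space (cmat A) S"
    if "v \<in> U" for v
  proof -
    have "cvec v \<in> ?U"
      using that subspace_0[OF assms(1)] unfolding complexification_def
      by (intro CollectI exI[of _ v] exI[of _ 0]) auto
    then show ?thesis
      unfolding gen_eigenspace_def sh
      using root_space_subset_span[OF complexification_subspace[OF assms(1)] complexification_mult]
        span_subset_root_space[where S = S and U = ?U and M = "cmat A"] assms(2) by blast
  qed
  then show ?thesis
    by (auto simp: spectral_sum_def real_root_space_def)
qed

lemma spectral_sum_UNIV: "spectral_sum A UNIV S = real_root_space A S"
  using spectral_sum_eq[of UNIV A S] by simp

subsection \<open>Asymptotic characterization\<close>

lemma tendsto_perturbed_recurrence: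
  fixes a w :: "nat \<Rightarrow> 'a::real_normed_field"
  assumes "\<And>k. a (Suc k) = \<mu> * a k + w k" "w \<longlonglongrightarrow> 0" "norm \<mu> < 1"
  shows "a \<longlonglongrightarrow> 0"
proof (rule LIMSEQ_I)
  fix e :: real assume "0 < e"
  define q where "q = norm \<mu>"
  have q: "0 \<le> q" "q < 1"
    using assms by (auto simp: q_def)
  \<comment> \<open>The threshold makes e/2 the fixed point of x \<mapsto> q x + (e/2) (1 - q), so
    only the geometric term q^j remains to be controlled.\<close>
  obtain N where N: "\<And>k. k \<ge> N \<Longrightarrow> norm (w k) < (e / 2) * (1 - q)"
    using LIMSEQ_D[OF assms(2), of "(e / 2) * (1 - q)"] \<open>0 < e\<close> q by auto
  have bound: "norm (a (N + j)) \<le> e / 2 + q ^ j * norm (a N)" for j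
  proof (induction j)
    case (Suc j)
    have "norm (a (N + Suc j)) \<le> q * norm (a (N + j)) + norm (w (N + j))"
      using norm_triangle_ineq[of "\<mu> * a (N + j)" "w (N + j)"] by (simp add: assms(1) q_def norm_mult)
    also have "\<dots> \<le> q * (e / 2 + q ^ j * norm (a N)) + (e / 2) * (1 - q)"
      using Suc N[of "N + j"] q by (intro add_mono mult_left_mono) auto
    also have "\<dots> = e / 2 + q ^ Suc j * norm (a N)"
      by (simp add: field_simps)
    finally show ?case .
  qed (use \<open>0 < e\<close> in auto)
  have "(\<lambda>j. q ^ j * norm (a N)) \<longlonglongrightarrow> 0 * norm (a N)"
    using q by (intro tendsto_mult LIMSEQ_realpow_zero tendsto_const) auto
  then obtain J where J: "\<And>j. j \<ge> J \<Longrightarrow> norm (q ^ j * norm (a N)) < e / 2"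
    using LIMSEQ_D[of "\<lambda>j. q ^ j * norm (a N)" 0 "e / 2"] \<open>0 < e\<close> by auto
  have "norm (a k) < e" if k: "k \<ge> N + J" for k
  proof -
    obtain j where "k = N + j" "j \<ge> J"
      using that[of "k - N"] k by auto
    then show ?thesis
      using bound[of j] J[of j] by auto
  qed
  then show "\<exists>n. \<forall>k\<ge>n. norm (a k - 0) < e"
    by auto
qed

lemma funpow_mult_shift:
  "(((*v) M) ^^ Suc k) z = \<mu> *s (((*v) M) ^^ k) z + (((*v) M) ^^ k) (shift M \<mu> z)"
  by (simp only: matrix_power_shift) simp

lemma tendsto_vec_iff: "f \<longlonglongrightarrow> (l :: 'a::topological_space^'i) \<longleftrightarrow> (\<forall>i. (\<lambda>k. f k $ i) \<longlonglongrightarrow> l $ i)"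
proof
  assume "f \<longlonglongrightarrow> l"
  then show "\<forall>i. (\<lambda>k. f k $ i) \<longlonglongrightarrow> l $ i"
    by (intro allI tendsto_vec_nth)
next
  assume "\<forall>i. (\<lambda>k. f k $ i) \<longlonglongrightarrow> l $ i"
  then show "f \<longlonglongrightarrow> l"
    by (intro vec_tendstoI) simp
qed

text \<open>Peeling off a root \<mu> gives a recurrence with multiplier \<mu> whose error term tends
  to 0 by induction. No formula for powers of Jordan blocks is involved.\<close>

lemma root_space_tendsto_0:
  fixes M :: "complex^'i^'i"
  assumes "z \<in> root_space M {\<mu>. cmod \<mu> < 1}"
  shows "(\<lambda>k. (((*v) M) ^^ k) z) \<longlonglongrightarrow> 0"
proof -
  obtain ms where "set ms \<subseteq> {\<mu>. cmod \<mu> < 1}" "shifts M ms z = 0"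
    using assms by (auto simp: root_space_def)
  then show ?thesis
  proof (induction ms arbitrary: z)
    case Nil
    have "(((*v) M) ^^ k) 0 = 0" for k
      by (induction k) auto
    then show ?case
      using Nil by simp
  next
    case (Cons \<mu> ms)
    then have "(\<lambda>k. (((*v) M) ^^ k) (shift M \<mu> z)) \<longlonglongrightarrow> 0"
      by simp
    then have w: "(\<lambda>k. (((*v) M) ^^ k) (shift M \<mu> z) $ i) \<longlonglongrightarrow> 0" for i
      unfolding tendsto_vec_iff by simp
    have "(\<lambda>k. (((*v) M) ^^ k) z $ i) \<longlonglongrightarrow> 0" for i
    proof (rule tendsto_perturbed_recurrence[OF _ w])
      show "(((*v) M) ^^ Suc k) z $ i = \<mu> * (((*v) M) ^^ k) z $ i + (((*v) M) ^^ k) (shift M \<mu> z) $ i" for k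
        by (simp only: funpow_mult_shift[of k M z \<mu>] vector_add_component vector_smult_component)
      show "norm \<mu> < 1"
        using Cons.prems by simp
    qed
    then show ?case
      unfolding tendsto_vec_iff by simp
  qed
qed

text \<open>The component \<open>y\<close> of \<open>z\<close> with roots of modulus at least 1 also
  has iterates tending to 0. By induction its shift by the first root vanishes, so it is an
  eigenvector or 0, and iterates of such an eigenvector do not shrink.\<close>

lemma tendsto_0_root_space:
  fixes M :: "complex^'i^'i"
  assumes "(\<lambda>k. (((*v) M) ^^ k) z) \<longlonglongrightarrow> 0"
  shows "z \<in> root_space M {\<mu>. cmod \<mu> < 1}"
proof -
  have zero: "y = 0"
    if "set ms \<subseteq> {\<mu>. 1 \<le> cmod \<mu>}" "shifts M ms y = 0" "(\<lambda>k. (((*v) M) ^^ k) y) \<longlonglongrightarrow> 0" for ms y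
    using that
  proof (induction ms arbitrary: y)
    case (Cons \<mu> ms)
    have "(\<lambda>k. (((*v) M) ^^ k) (shift M \<mu> y) $ i) \<longlonglongrightarrow> 0" for i
    proof -
      have "(\<lambda>k. (((*v) M) ^^ k) y $ i) \<longlonglongrightarrow> 0"
        using Cons.prems(3) by (auto simp: tendsto_vec_iff)
      then have "(\<lambda>k. (((*v) M) ^^ Suc k) y $ i - \<mu> * (((*v) M) ^^ k) y $ i) \<longlonglongrightarrow> 0 - \<mu> * 0"
        by (intro tendsto_diff tendsto_mult tendsto_const) (rule LIMSEQ_Suc)
      then show ?thesis
        by (simp only: matrix_power_shift vector_minus_component vector_smult_component) simp
    qed
    then have "shift M \<mu> y = 0"
      using Cons by (auto simp: tendsto_vec_iff)
    then have pow: "(((*v) M) ^^ k) y = \<mu> ^ k *s y" for k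
      by (induction k) (auto simp: shift_def vector_scalar_commute vector_smult_assoc mult.commute)
    have "y $ i = 0" for i
    proof -
      have "(\<lambda>k. norm (\<mu> ^ k * y $ i)) \<longlonglongrightarrow> 0"
        using Cons.prems(3) by (auto simp: tendsto_vec_iff pow intro: tendsto_norm_zero)
      moreover have "norm (y $ i) \<le> norm (\<mu> ^ k * y $ i)" for k
        using Cons.prems(1) by (simp add: norm_mult norm_power mult_right_le_one_le mult_le_cancel_right1)
      ultimately show ?thesis
        using LIMSEQ_le_const[of _ 0 "norm (y $ i)"] by auto
    qed
    then show ?case
      by (simp add: vec_eq_iff)
  qed auto
  have "z \<in> root_space M ({\<mu>. cmod \<mu> < 1} \<union> {\<mu>. 1 \<le> cmod \<mu>})"
  proof -
    have "{\<mu>. cmod \<mu> < 1} \<union> {\<mu>. 1 \<le> cmod \<mu>} = UNIV"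
      by auto
    then show ?thesis
      by (simp add: root_space_UNIV)
  qed
  then obtain x y where xy: "x \<in> root_space M {\<mu>. cmod \<mu> < 1}" "y \<in> root_space M {\<mu>. 1 \<le> cmod \<mu>}" "z = x + y"
    by (rule root_space_Un)
  have "(((*v) M) ^^ k) y = (((*v) M) ^^ k) z - (((*v) M) ^^ k) x" for k
  proof (induction k)
    case (Suc k)
    then show ?case
      by (simp add: matrix_vector_mult_diff_distrib)
  qed (simp add: xy)
  then have "(\<lambda>k. (((*v) M) ^^ k) y) \<longlonglongrightarrow> 0"
    using tendsto_diff[OF assms root_space_tendsto_0[OF xy(1)]] by simp
  then have "y = 0"
    using xy(2) zero by (auto simp: root_space_def)
  then show ?thesis
    using xy by simp
qed

lemma real_root_space_lt_1_iff:
  "v \<in> real_root_space A {\<mu>. cmod \<mu> < 1} \<longleftrightarrow> (\<lambda>k. (((*v) A) ^^ k) v) \<longlonglongrightarrow> 0"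
proof -
  have "cvec ((((*v) A) ^^ k) v) = (((*v) (cmat A)) ^^ k) (cvec v)" for k
    by (induction k) (auto simp: cvec_mult)
  then have nth: "(((*v) (cmat A)) ^^ k) (cvec v) $ i = of_real ((((*v) A) ^^ k) v $ i)" for k i
    by (metis cvec_nth)
  have "(\<lambda>k. (((*v) (cmat A)) ^^ k) (cvec v)) \<longlonglongrightarrow> 0 \<longleftrightarrow> (\<lambda>k. (((*v) A) ^^ k) v) \<longlonglongrightarrow> 0"
    unfolding tendsto_vec_iff nth zero_index
    using tendsto_of_real_iff[where 'a = complex and c = 0 and F = sequentially, unfolded of_real_0]
    by (simp only: zero_index)
  then show ?thesis
    using root_space_tendsto_0 tendsto_0_root_space by (auto simp: real_root_space_def)
qed

section \<open>Root spaces of the inverse matrix\<close>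

lemma root_space_shift_imp: "shift M \<mu> z \<in> root_space M S \<Longrightarrow> \<mu> \<in> S \<Longrightarrow> z \<in> root_space M S"
proof -
  assume "shift M \<mu> z \<in> root_space M S" "\<mu> \<in> S"
  then obtain ms where "set ms \<subseteq> S" "shifts M ms (shift M \<mu> z) = 0"
    by (auto simp: root_space_def)
  with \<open>\<mu> \<in> S\<close> show "z \<in> root_space M S"
    by (intro root_spaceI[of "\<mu> # ms"]) auto
qed

text \<open>Multiplying M - \<mu> by -N/\<mu> gives N - 1/\<mu>, so each linear factor for
  \<open>M\<close> turns into one for \<open>N\<close> with the inverse root.\<close>

lemma root_space_inverse:
  fixes M N :: "'a::field^'i^'i"
  assumes "N ** M = mat 1" "z \<in> root_space M S" "0 \<notin> S"
  shows "z \<in> root_space N (inverse ` S)"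
proof -
  obtain ms where "set ms \<subseteq> S" "shifts M ms z = 0"
    using assms by (auto simp: root_space_def)
  then show ?thesis
  proof (induction ms arbitrary: z)
    case (Cons \<mu> ms)
    then have "\<mu> \<noteq> 0"
      using assms by auto
    have "shift M \<mu> z \<in> root_space N (inverse ` S)"
      using Cons by simp
    then have "(- inverse \<mu>) *s (N *v shift M \<mu> z) \<in> root_space N (inverse ` S)"
      by (intro root_space_scale root_space_mult)
    also have "N *v shift M \<mu> z = z - \<mu> *s (N *v z)"
      by (simp add: shift_def matrix_vector_mult_diff_distrib matrix_vector_mul_assoc assms vector_scalar_commute)
    also have "(- inverse \<mu>) *s (z - \<mu> *s (N *v z)) = shift N (inverse \<mu>) z"
      using \<open>\<mu> \<noteq> 0\<close> by (simp add: vec_eq_iff shift_def field_simps)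
    finally show ?case
      using Cons.prems by (intro root_space_shift_imp[of N "inverse \<mu>" z]) auto
  qed auto
qed

lemma cmat_mult: "cmat (A ** B) = cmat A ** cmat B"
  by (simp add: vec_eq_iff map_matrix_def matrix_matrix_mult_def)

lemma cmat_1: "cmat (mat 1) = mat 1"
  by (simp add: vec_eq_iff map_matrix_def mat_def)

text \<open>Translates the description of \<open>hyp_Wplus\<close> by iterates of the inverse into
  one by eigenvalues outside the unit circle.\<close>

lemma real_root_space_inverse:
  assumes "A ** B = mat 1" "B ** A = mat 1"
  shows "real_root_space B {\<mu>. cmod \<mu> < 1} = real_root_space A {\<mu>. 1 < cmod \<mu>}"
proof -
  have AB: "cmat A ** cmat B = mat 1" "cmat B ** cmat A = mat 1"
    using assms by (simp_all add: cmat_1 flip: cmat_mult)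
  have "inverse ` {\<mu>. 1 < cmod \<mu>} \<subseteq> {\<mu>. cmod \<mu> < 1}"
    by (auto simp: norm_inverse inverse_less_1_iff)
  then have 1: "root_space (cmat A) {\<mu>. 1 < cmod \<mu>} \<subseteq> root_space (cmat B) {\<mu>. cmod \<mu> < 1}"
    using root_space_inverse[OF AB(2), of _ "{\<mu>. 1 < cmod \<mu>}"]
      root_space_mono[of "inverse ` {\<mu>. 1 < cmod \<mu>}" "{\<mu>. cmod \<mu> < 1}" "cmat B"] by auto
  \<comment> \<open>The unit disc contains 0, where inversion does not lead outside the disc, so
    this eigenvalue must be excluded first.\<close>
  have "0 \<notin> eigenvalues (cmat B)"
  proof
    assume "0 \<in> eigenvalues (cmat B)"
    then obtain z where z: "z \<noteq> 0" "cmat B *v z = 0"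
      by (auto simp: eigenvalues_def)
    then have "(cmat A ** cmat B) *v z = 0"
      by (simp add: flip: matrix_vector_mul_assoc)
    then show False
      using z by (simp add: AB)
  qed
  moreover from this have "inverse ` ({\<mu>. cmod \<mu> < 1} \<inter> eigenvalues (cmat B)) \<subseteq> {\<mu>. 1 < cmod \<mu>}"
    by (auto simp: norm_inverse one_less_inverse_iff)
  ultimately have 2: "root_space (cmat B) {\<mu>. cmod \<mu> < 1} \<subseteq> root_space (cmat A) {\<mu>. 1 < cmod \<mu>}"
    using root_space_inverse[OF AB(1), of _ "{\<mu>. cmod \<mu> < 1} \<inter> eigenvalues (cmat B)"]
      root_space_Int_eigenvalues[of "cmat B" "{\<mu>. cmod \<mu> < 1}"]
      root_space_mono[of "inverse ` ({\<mu>. cmod \<mu> < 1} \<inter> eigenvalues (cmat B))" "{\<mu>. 1 < cmod \<mu>}" "cmat A"]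
    by auto
  show ?thesis
    using 1 2 by (auto simp: real_root_space_def)
qed

subsection \<open>Semicontinuity\<close>

lemma tendsto_matrix_vector_mult:
  fixes M :: "nat \<Rightarrow> 'a::real_normed_field^'i^'j"
  assumes "M \<longlonglongrightarrow> M0" "z \<longlonglongrightarrow> z0"
  shows "(\<lambda>k. M k *v z k) \<longlonglongrightarrow> M0 *v z0"
  unfolding tendsto_vec_iff matrix_vector_mult_def vec_lambda_beta
  using assms by (auto intro!: tendsto_sum tendsto_mult tendsto_vec_nth)

lemma tendsto_shift:
  fixes M :: "nat \<Rightarrow> 'a::real_normed_field^'i^'i"
  assumes "M \<longlonglongrightarrow> M0" "z \<longlonglongrightarrow> z0" "\<mu> \<longlonglongrightarrow> \<mu>0"
  shows "(\<lambda>k. shift (M k) (\<mu> k) (z k)) \<longlonglongrightarrow> shift M0 \<mu>0 z0"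
proof -
  have "(\<lambda>k. \<mu> k *s z k) \<longlonglongrightarrow> \<mu>0 *s z0"
    unfolding tendsto_vec_iff vector_smult_component
    using assms by (auto intro!: tendsto_mult tendsto_vec_nth)
  then show ?thesis
    unfolding shift_def by (intro tendsto_diff tendsto_matrix_vector_mult assms)
qed

text \<open>The eigenvalue equation at a coordinate where \<open>z\<close> is largest bounds \<mu>
  by one row sum. The sum over all entries no longer depends on that coordinate and is continuous in
  \<open>M\<close>.\<close>

lemma eigenvalue_norm_le:
  fixes M :: "'a::real_normed_field^'i^'i"
  assumes "\<mu> \<in> eigenvalues M"
  shows "norm \<mu> \<le> (\<Sum>i\<in>UNIV. \<Sum>j\<in>UNIV. norm (M $ i $ j))"
proof -
  obtain z where z: "z \<noteq> 0" "M *v z = \<mu> *s z"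
    using assms by (auto simp: eigenvalues_def)
  obtain i where i: "\<And>j. norm (z $ j) \<le> norm (z $ i)"
  proof -
    have "Max (range (\<lambda>j. norm (z $ j))) \<in> range (\<lambda>j. norm (z $ j))"
      by (intro Max_in) auto
    then obtain i where "Max (range (\<lambda>j. norm (z $ j))) = norm (z $ i)"
      by (rule imageE)
    then show thesis
      using that by (metis Max_ge finite finite_imageI rangeI)
  qed
  have "z $ i \<noteq> 0"
    using i z by (metis norm_le_zero_iff norm_zero vec_eq_iff zero_index)
  have "norm \<mu> * norm (z $ i) = norm (\<Sum>j\<in>UNIV. M $ i $ j * z $ j)"
    using arg_cong[OF z(2), of "\<lambda>v. norm (v $ i)"] by (simp add: matrix_vector_mult_def norm_mult)
  also have "\<dots> \<le> (\<Sum>j\<in>UNIV. norm (M $ i $ j) * norm (z $ i))"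
    by (rule sum_norm_le) (simp add: norm_mult i mult_left_mono)
  also have "\<dots> = (\<Sum>j\<in>UNIV. norm (M $ i $ j)) * norm (z $ i)"
    by (simp add: sum_distrib_right)
  finally have "norm \<mu> \<le> (\<Sum>j\<in>UNIV. norm (M $ i $ j))"
    using \<open>z $ i \<noteq> 0\<close> by simp
  also have "\<dots> \<le> (\<Sum>i\<in>UNIV. \<Sum>j\<in>UNIV. norm (M $ i $ j))"
    by (rule member_le_sum[of i UNIV]) (auto intro: sum_nonneg)
  finally show ?thesis .
qed

text \<open>By compactness the first roots converge along a subsequence, to a point of the closure
  of \<open>S\<close>. Applying the first factor leaves lists shorter by one, and the limit root is
  put back by \<open>root_space_shift_imp\<close>.\<close>

lemma shifts_limit:
  fixes M :: "nat \<Rightarrow> complex^'i^'i"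
  assumes "M \<longlonglongrightarrow> M0" "z \<longlonglongrightarrow> z0"
    and "\<And>k. length (ms k) = n" "\<And>k. set (ms k) \<subseteq> S \<inter> cball 0 R" "\<And>k. shifts (M k) (ms k) (z k) = 0"
  shows "z0 \<in> root_space M0 (closure S)"
  using assms
proof (induction n arbitrary: M z z0 ms)
  case 0
  then have "z = (\<lambda>k. 0)"
    by auto
  then show ?case
    using 0 LIMSEQ_unique[of z z0 0] by auto
next
  case (Suc n)
  have ne: "ms k \<noteq> []" for k
    using Suc.prems(3)[of k] by auto
  have hd: "hd (ms k) \<in> S \<inter> cball 0 R" for k
    using ne Suc.prems(4)[of k] hd_in_set by blast
  have "compact (cball (0::complex) R)"
    by simp
  then obtain \<mu> r where r: "strict_mono r" "((\<lambda>k. hd (ms k)) \<circ> r) \<longlonglongrightarrow> \<mu>"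
    unfolding compact_def using hd by (metis IntE)
  have "\<mu> \<in> closure S"
    unfolding closure_sequential using r(2) hd by (intro exI[of _ "(\<lambda>k. hd (ms k)) \<circ> r"]) auto
  define y where "y = (\<lambda>k. shift (M (r k)) (hd (ms (r k))) (z (r k)))"
  have "y \<longlonglongrightarrow> shift M0 \<mu> z0"
    unfolding y_def using r(2) LIMSEQ_subseq_LIMSEQ[OF Suc.prems(1) r(1)]
      LIMSEQ_subseq_LIMSEQ[OF Suc.prems(2) r(1)]
    by (intro tendsto_shift) (simp_all add: o_def)
  moreover have "(\<lambda>k. M (r k)) \<longlonglongrightarrow> M0"
    using LIMSEQ_subseq_LIMSEQ[OF Suc.prems(1) r(1)] by (simp add: o_def)
  moreover have "shifts (M (r k)) (tl (ms (r k))) (y k) = 0" for k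
    using Suc.prems(5)[of "r k"] ne[of "r k"] unfolding y_def by (metis fold_simps(2) list.collapse)
  moreover have "set (tl (ms (r k))) \<subseteq> S \<inter> cball 0 R" for k
    using Suc.prems(4)[of "r k"] ne[of "r k"] by (meson list.set_sel(2) subset_iff)
  ultimately have "shift M0 \<mu> z0 \<in> root_space M0 (closure S)"
    by (intro Suc.IH[of "\<lambda>k. M (r k)" y _ "\<lambda>k. tl (ms (r k))"]) (auto simp: Suc.prems(3))
  then show ?case
    using \<open>\<mu> \<in> closure S\<close> by (rule root_space_shift_imp)
qed

lemma root_space_limit:
  fixes M :: "nat \<Rightarrow> complex^'i^'i"
  assumes "M \<longlonglongrightarrow> M0" "z \<longlonglongrightarrow> z0" "\<And>k. z k \<in> root_space (M k) S"
  shows "z0 \<in> root_space M0 (closure S)"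
proof -
  define b where "b = (\<lambda>k. \<Sum>i\<in>UNIV. \<Sum>j\<in>UNIV. norm (M k $ i $ j))"
  have "b \<longlonglongrightarrow> (\<Sum>i\<in>UNIV. \<Sum>j\<in>UNIV. norm (M0 $ i $ j))"
    unfolding b_def using assms(1) by (intro tendsto_sum tendsto_norm tendsto_vec_nth)
  then obtain R where R: "\<And>k. norm (b k) \<le> R"
    using convergent_imp_Bseq[of b] by (auto simp: convergent_def Bseq_def)
  have eig: "S \<inter> eigenvalues (M k) \<subseteq> S \<inter> cball 0 R" for k
    using eigenvalue_norm_le[of _ "M k"] R[of k] by (fastforce simp: b_def)
  obtain ms where ms: "\<And>k. length (ms k) \<le> CARD('i)" "\<And>k. set (ms k) \<subseteq> S \<inter> eigenvalues (M k)"
    "\<And>k. shifts (M k) (ms k) (z k) = 0"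
    using root_space_short_list[OF assms(3)] by metis
  show ?thesis
  \<comment> \<open>The lists are padded to a common length with an element \<open>s\<close> of
    \<open>S\<close> in the ball; the extra factors act on 0. If there is no such element, all lists
    are empty and \<open>z\<close> is 0.\<close>
  proof (cases "S \<inter> cball 0 R = {}")
    case True
    then have "ms k = []" for k
      using ms(2)[of k] eig[of k] by (metis subset_empty order_trans set_empty)
    then have "z = (\<lambda>k. 0)"
      using ms(3) by auto
    then show ?thesis
      using assms(2) LIMSEQ_unique[of z z0 0] by auto
  next
    case False
    then obtain s where s: "s \<in> S \<inter> cball 0 R"
      by blast
    show ?thesis
    proof (rule shifts_limit[OF assms(1,2)])
      fix k
      let ?ms = "\<lambda>k. ms k @ replicate (CARD('i) - length (ms k)) s"
      show "length (?ms k) = CARD('i)"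
        using ms(1)[of k] by simp
      show "set (?ms k) \<subseteq> S \<inter> cball 0 R"
        using ms(2)[of k] eig[of k] s by auto
      show "shifts (M k) (?ms k) (z k) = 0"
        by (simp only: fold_append o_apply ms(3) shifts_0)
    qed
  qed
qed

lemma real_root_space_limit:
  assumes "A \<longlonglongrightarrow> A0" "x \<longlonglongrightarrow> x0" "\<And>k. x k \<in> real_root_space (A k) S"
  shows "x0 \<in> real_root_space A0 (closure S)"
proof -
  have "(\<lambda>k. cmat (A k)) \<longlonglongrightarrow> cmat A0"
    using assms(1) by (auto simp: tendsto_vec_iff map_matrix_def intro!: tendsto_of_real tendsto_vec_nth)
  moreover have "(\<lambda>k. cvec (x k)) \<longlonglongrightarrow> cvec x0"
    using assms(2) by (auto simp: tendsto_vec_iff intro!: tendsto_of_real)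
  ultimately show ?thesis
    using assms(3) root_space_limit unfolding real_root_space_def by blast
qed

text \<open>If the dimension jumped up along matrices tending to \<open>A0\<close>, each of their
  root spaces would contain a unit vector orthogonal to the limit root space \<open>?F\<close>. A
  limit of these unit vectors lies in \<open>?F\<close> and in its complement.\<close>

lemma dim_real_root_space_upper_semicontinuous:
  fixes A0 :: "real^'i^'i"
  shows "\<exists>\<delta>>0. \<forall>A. dist A A0 < \<delta> \<longrightarrow> dim (real_root_space A S) \<le> dim (real_root_space A0 (closure S))"
proof (rule ccontr)
  let ?F = "real_root_space A0 (closure S)"
  let ?C = "{y \<in> UNIV. \<forall>x\<in>?F. orthogonal x y}"
  assume "\<not> ?thesis"
  then have "\<exists>A. dist A A0 < inverse (real (Suc k)) \<and> dim ?F < dim (real_root_space A S)" for k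
    using not_less by (metis inverse_positive_iff_positive of_nat_0_less_iff zero_less_Suc)
  then obtain A where A: "\<And>k. dist (A k) A0 < inverse (real (Suc k))"
    "\<And>k. dim ?F < dim (real_root_space (A k) S)"
    by metis
  have "A \<longlonglongrightarrow> A0"
    by (rule metric_tendsto_imp_tendsto[OF LIMSEQ_inverse_real_of_nat])
      (use A in \<open>auto simp: less_imp_le intro!: always_eventually\<close>)
  have C: "subspace ?C"
    by (auto simp: subspace_def orthogonal_clauses)
  have "dim ?C + dim ?F = CARD('i)"
    using dim_subspace_orthogonal_to_vectors[of ?F UNIV] by (simp add: subspace_real_root_space)
  have "\<exists>x. x \<in> real_root_space (A k) S \<and> x \<in> ?C \<and> norm x = 1" for k
  proof -
    let ?E = "real_root_space (A k) S"
    have "dim {x + y |x y. x \<in> ?E \<and> y \<in> ?C} \<le> CARD('i)"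
      using dim_subset_UNIV[of "{x + y |x y. x \<in> ?E \<and> y \<in> ?C}"] by simp
    then have "dim (?E \<inter> ?C) \<noteq> 0"
      using dim_sums_Int[OF subspace_real_root_space[of "A k" S] C] A(2)[of k] \<open>dim ?C + dim ?F = CARD('i)\<close>
      by linarith
    then obtain x where x: "x \<in> ?E" "x \<in> ?C" "x \<noteq> 0"
      unfolding dim_eq_0 by blast
    then have "x /\<^sub>R norm x \<in> ?E" "x /\<^sub>R norm x \<in> ?C" "norm (x /\<^sub>R norm x) = 1"
      using subspace_scale[OF subspace_real_root_space x(1)] subspace_scale[OF C x(2)] by simp_all
    then show ?thesis by blast
  qed
  then have "\<exists>x. \<forall>k. x k \<in> real_root_space (A k) S \<and> x k \<in> ?C \<and> norm (x k) = 1"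
    by (intro choice allI)
  then obtain x where x: "\<And>k. x k \<in> real_root_space (A k) S" "\<And>k. x k \<in> ?C" "\<And>k. norm (x k) = 1"
    by blast
  have "compact (sphere (0::real^'i) 1)"
    by simp
  then obtain x0 r where r: "strict_mono r" "(x \<circ> r) \<longlonglongrightarrow> x0" "x0 \<in> sphere 0 1"
    unfolding compact_def using x(3) by (metis mem_sphere_0)
  have "(A \<circ> r) \<longlonglongrightarrow> A0"
    using \<open>A \<longlonglongrightarrow> A0\<close> r(1) by (rule LIMSEQ_subseq_LIMSEQ)
  then have "x0 \<in> ?F"
    using real_root_space_limit[OF _ r(2), of "A \<circ> r" A0 S] x(1) by simp
  moreover have "x0 \<in> ?C"
    using closed_sequentially[OF closed_subspace[OF C] _ r(2)] x(2) by simp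
  ultimately have "x0 = 0"
    by (auto simp: orthogonal_self)
  then show False
    using r(3) by simp
qed

subsection \<open>The split form\<close>

definition pos :: "'n::finite vec2n \<Rightarrow> real^'n" where
  "pos v = (\<chi> j. v $ Inl j)"

definition neg :: "'n::finite vec2n \<Rightarrow> real^'n" where
  "neg v = (\<chi> j. v $ Inr j)"

definition join :: "real^'n \<Rightarrow> real^'n \<Rightarrow> 'n::finite vec2n" where
  "join x y = (\<chi> i. case i of Inl j \<Rightarrow> x $ j | Inr j \<Rightarrow> y $ j)"

lemma pos_nth [simp]: "pos v $ j = v $ Inl j"
  and neg_nth [simp]: "neg v $ j = v $ Inr j"
  and join_Inl [simp]: "join x y $ Inl j = x $ j"
  and join_Inr [simp]: "join x y $ Inr j = y $ j"
  by (auto simp: pos_def neg_def join_def)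

lemma vec2n_eq_iff: "v = w \<longleftrightarrow> (\<forall>j. v $ Inl j = w $ Inl j) \<and> (\<forall>j. v $ Inr j = w $ Inr j)"
proof
  assume *: "(\<forall>j. v $ Inl j = w $ Inl j) \<and> (\<forall>j. v $ Inr j = w $ Inr j)"
  have "v $ i = w $ i" for i
    using * by (cases i) auto
  then show "v = w"
    by (simp add: vec_eq_iff)
qed auto

lemma pos_join [simp]: "pos (join x y) = x"
  and neg_join [simp]: "neg (join x y) = y"
  by (auto simp: vec_eq_iff)

lemma join_pos_neg [simp]: "join (pos v) (neg v) = v"
  by (simp add: vec2n_eq_iff)

lemma linear_pos: "linear pos"
  by (auto simp: linear_iff vec_eq_iff)

lemma linear_neg: "linear neg"
  by (auto simp: linear_iff vec_eq_iff)

lemmas pos_add = linear_add[OF linear_pos] and neg_add = linear_add[OF linear_neg]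
  and pos_diff = linear_diff[OF linear_pos] and neg_diff = linear_diff[OF linear_neg]
  and pos_scaleR = linear_scale[OF linear_pos] and neg_scaleR = linear_scale[OF linear_neg]
  and pos_0 = linear_0[OF linear_pos] and neg_0 = linear_0[OF linear_neg]

lemma join_add: "join x y + join x' y' = join (x + x') (y + y')"
  and join_scaleR: "c *\<^sub>R join x y = join (c *\<^sub>R x) (c *\<^sub>R y)"
  and join_0 [simp]: "join 0 0 = 0"
  by (auto simp: vec2n_eq_iff)

lemma join_eq_iff [simp]: "join x y = join x' y' \<longleftrightarrow> x = x' \<and> y = y'"
  by (metis pos_join neg_join)

lemma sum_vec2n: "(\<Sum>i\<in>UNIV. f i) = (\<Sum>j\<in>UNIV. f (Inl j)) + (\<Sum>j\<in>UNIV. f (Inr j))"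
  for f :: "'n::finite + 'n \<Rightarrow> 'b::comm_monoid_add"
  using sum.Plus[of "UNIV :: 'n set" "UNIV :: 'n set" f] by (simp add: UNIV_Plus_UNIV)

lemma I_nn_mult: "I_nn *v w = join (pos w) (- neg w)"
proof -
  have "(I_nn *v w) $ i = join (pos w) (- neg w) $ i" for i
  proof (cases i)
    case (Inl j)
    have "(I_nn *v w) $ i = (\<Sum>k\<in>UNIV. if i = k then w $ k else 0)"
      unfolding matrix_vector_mult_def vec_lambda_beta by (rule sum.cong) (auto simp: I_nn_def Inl)
    then show ?thesis
      by (simp add: Inl)
  next
    case (Inr j)
    have "(I_nn *v w) $ i = (\<Sum>k\<in>UNIV. if i = k then - w $ k else 0)"
      unfolding matrix_vector_mult_def vec_lambda_beta by (rule sum.cong) (auto simp: I_nn_def Inr)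
    then show ?thesis
      by (simp add: Inr)
  qed
  then show ?thesis
    by (simp add: vec_eq_iff)
qed

lemma inner_vec2n: "v \<bullet> w = pos v \<bullet> pos w + neg v \<bullet> neg w" for v w :: "'n::finite vec2n"
  by (simp add: inner_vec_def sum_vec2n)

lemma form_eq: "form v w = pos v \<bullet> pos w - neg v \<bullet> neg w"
  by (simp add: form_def I_nn_mult inner_vec2n)

lemma form_commute: "form v w = form w v"
  by (simp add: form_eq inner_commute)

lemma form_add_left: "form (u + v) w = form u w + form v w"
  and form_add_right: "form w (u + v) = form w u + form w v"
  and form_diff_left: "form (u - v) w = form u w - form v w"
  and form_diff_right: "form w (u - v) = form w u - form w v"
  and form_scaleR_left: "form (c *\<^sub>R u) w = c * form u w"
  and form_scaleR_right: "form w (c *\<^sub>R u) = c * form w u"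
  by (simp_all add: form_eq pos_add neg_add pos_diff neg_diff pos_scaleR neg_scaleR
      inner_simps algebra_simps)

lemma form_0_left [simp]: "form 0 w = 0" and form_0_right [simp]: "form w 0 = 0"
  by (simp_all add: form_eq pos_0 neg_0)

lemma form_nondegenerate: "(\<And>w. form v w = 0) \<Longrightarrow> v = 0"
proof -
  assume *: "\<And>w. form v w = 0"
  have "form v (I_nn *v v) = v \<bullet> v"
    by (simp add: form_eq I_nn_mult inner_vec2n[of v v])
  then show "v = 0"
    using * by simp
qed

lemma tendsto_form:
  assumes "(f \<longlongrightarrow> a) F" "(g \<longlongrightarrow> b) F"
  shows "((\<lambda>x. form (f x) (g x)) \<longlongrightarrow> form a b) F"
  unfolding form_eq pos_def neg_def
  by (intro tendsto_diff tendsto_inner vec_tendstoI) (simp_all add: tendsto_vec_nth assms)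

section \<open>Isometries and the identity component\<close>

definition form_isometry :: "'n::finite mat2n \<Rightarrow> bool" where
  "form_isometry A \<longleftrightarrow> transpose A ** I_nn ** A = I_nn"

lemma form_isometry_iff: "form_isometry A \<longleftrightarrow> (\<forall>v w. form (A *v v) (A *v w) = form v w)"
proof -
  have eq: "form (A *v v) (A *v w) = v \<bullet> ((transpose A ** I_nn ** A) *v w)" for v w
  proof -
    have "v \<bullet> (transpose A *v (I_nn *v (A *v w))) = (A *v v) \<bullet> (I_nn *v (A *v w))"
      by (metis dot_lmul_matrix vector_transpose_matrix)
    then show ?thesis
      by (simp add: form_def flip: matrix_vector_mul_assoc)
  qed
  show ?thesis
  proof
    assume "form_isometry A"
    then show "\<forall>v w. form (A *v v) (A *v w) = form v w"
      by (simp add: eq form_isometry_def) (simp add: form_def)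
  next
    assume "\<forall>v w. form (A *v v) (A *v w) = form v w"
    then have "\<forall>v w. v \<bullet> ((transpose A ** I_nn ** A) *v w) = v \<bullet> (I_nn *v w)"
      by (metis eq form_def)
    then have "(transpose A ** I_nn ** A) *v w = I_nn *v w" for w
      using vector_eq_ldot by blast
    then show "form_isometry A"
      by (simp add: form_isometry_def matrix_eq)
  qed
qed

lemma form_isometryD: "form_isometry A \<Longrightarrow> form (A *v v) (A *v w) = form v w"
  by (simp add: form_isometry_iff)

lemma form_isometry_mult: "form_isometry A \<Longrightarrow> form_isometry B \<Longrightarrow> form_isometry (A ** B)"
  by (simp add: form_isometry_iff flip: matrix_vector_mul_assoc)

lemma form_isometry_1: "form_isometry (mat 1)"
  by (simp add: form_isometry_iff)

lemma form_isometry_inj: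
  assumes "form_isometry A" "A *v v = 0"
  shows "v = 0"
  by (rule form_nondegenerate) (metis assms form_0_left form_isometryD)

lemma form_isometry_invertible:
  assumes "form_isometry A"
  shows "invertible A"
proof -
  have "inj ((*v) A)"
    using form_isometry_inj[OF assms] by (simp add: matrix_vector_mul_linear linear_injective_0)
  then show ?thesis
    using invertible_left_inverse matrix_left_invertible_injective by blast
qed

lemma form_isometry_matrix_inv:
  assumes "form_isometry A"
  shows "A ** matrix_inv A = mat 1" "matrix_inv A ** A = mat 1"
  using form_isometry_invertible[OF assms] someI_ex[of "\<lambda>A'. A ** A' = mat 1 \<and> A' ** A = mat 1"]
  unfolding invertible_def matrix_inv_def by blast+

lemma SO_nn_iff: "A \<in> SO_nn \<longleftrightarrow> form_isometry A \<and> det A = 1"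
  by (simp add: SO_nn_def form_isometry_def)

lemma SO0_nn_subset: "SO0_nn \<subseteq> SO_nn"
  by (simp add: SO0_nn_def connected_component_subset)

lemma SO0_nn_isometry: "A \<in> SO0_nn \<Longrightarrow> form_isometry A"
  using SO0_nn_subset by (auto simp: SO_nn_iff)

lemma det_I_nn: "det (I_nn :: 'n::finite mat2n) \<noteq> 0"
proof -
  have "det (I_nn :: 'n mat2n) = (\<Prod>i\<in>UNIV. (I_nn :: 'n mat2n) $ i $ i)"
    by (rule det_diagonal) (simp add: I_nn_def)
  then show ?thesis
    by (auto simp: I_nn_def split: sum.splits)
qed

lemma det_form_isometry:
  assumes "form_isometry A"
  shows "det A = 1 \<or> det A = -1"
proof -
  have "det A * det A * det (I_nn :: 'a mat2n) = det (I_nn :: 'a mat2n)"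
    using arg_cong[OF assms[unfolded form_isometry_def], of det] by (simp add: det_mul ac_simps)
  then have "det A * det A = 1"
    using det_I_nn by (metis mult_cancel_right1)
  then show ?thesis
    by (simp add: square_eq_1_iff)
qed

lemma continuous_on_det:
  fixes f :: "'a::topological_space \<Rightarrow> real^'i^'i"
  assumes "continuous_on S f"
  shows "continuous_on S (\<lambda>x. det (f x))"
  unfolding det_def using assms by (intro continuous_intros)

lemma tendsto_det:
  fixes f :: "'a \<Rightarrow> real^'i^'i"
  assumes "(f \<longlongrightarrow> A) F"
  shows "((\<lambda>x. det (f x)) \<longlongrightarrow> det A) F"
  unfolding det_def using assms by (intro tendsto_intros)

lemma connected_nonzero_pos:
  fixes f :: "'a::topological_space \<Rightarrow> real"
  assumes "connected C" "continuous_on C f" "\<And>x. x \<in> C \<Longrightarrow> f x \<noteq> 0" "a \<in> C" "0 < f a" "x \<in> C"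
  shows "0 < f x"
proof (rule ccontr)
  assume "\<not> 0 < f x"
  moreover have "connected (f ` C)"
    using assms connected_continuous_image by blast
  ultimately have "0 \<in> f ` C"
    using assms connectedD_interval[of "f ` C" "f x" "f a" 0] by force
  then show False
    using assms by auto
qed

text \<open>On isometries the determinant is 1 or -1, so it is constant on \<open>C\<close>.
  Membership in \<open>SO0_nn\<close> is then obtained from connected sets of isometries, mostly
  explicit paths.\<close>

lemma connected_isometries_subset_SO0:
  assumes "connected C" "\<And>A. A \<in> C \<Longrightarrow> form_isometry A" "mat 1 \<in> C"
  shows "C \<subseteq> SO0_nn"
proof -
  have "det A = 1" if "A \<in> C" for A
  proof -
    have "0 < det A"
      by (rule connected_nonzero_pos[OF assms(1) continuous_on_det[OF continuous_on_id] _ assms(3) _ that])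
        (use det_form_isometry[OF assms(2)] in fastforce)+
    then show ?thesis
      using det_form_isometry[OF assms(2)[OF that]] by auto
  qed
  then have "C \<subseteq> SO_nn"
    using assms by (auto simp: SO_nn_iff)
  then show ?thesis
    unfolding SO0_nn_def using assms by (intro connected_component_maximal)
qed

lemma SO0_nn_1: "mat 1 \<in> SO0_nn"
  using connected_isometries_subset_SO0[of "{mat 1}"] by (simp add: form_isometry_1)

lemma connected_SO0_nn: "connected SO0_nn"
  by (simp add: SO0_nn_def)

text \<open>The right translate of \<open>SO0_nn\<close> by \<open>B\<close> is connected and
  contains \<open>B\<close>, hence its union with \<open>SO0_nn\<close> is connected and contains
  the identity.\<close>

lemma SO0_nn_mult:
  assumes "A \<in> SO0_nn" "B \<in> SO0_nn"
  shows "A ** B \<in> SO0_nn"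
proof -
  have "continuous_on SO0_nn (\<lambda>X. X ** B)"
    unfolding matrix_matrix_mult_def by (intro continuous_on_vec_lambda continuous_intros)
  then have "connected ((\<lambda>X. X ** B) ` SO0_nn)"
    using connected_SO0_nn connected_continuous_image by blast
  moreover have "B \<in> (\<lambda>X. X ** B) ` SO0_nn"
    using SO0_nn_1 by (intro image_eqI[of _ _ "mat 1"]) auto
  ultimately have "connected (SO0_nn \<union> (\<lambda>X. X ** B) ` SO0_nn)"
    using connected_SO0_nn assms by (intro connected_Un) auto
  then have "SO0_nn \<union> (\<lambda>X. X ** B) ` SO0_nn \<subseteq> SO0_nn"
    using SO0_nn_1 SO0_nn_isometry form_isometry_mult assms
    by (intro connected_isometries_subset_SO0) auto
  then show ?thesis
    using assms by auto
qed

subsection \<open>Pairing of root spaces\<close>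

text \<open>The bilinear, not the Hermitian, extension of \<open>form\<close>: eigenvalues \<mu> and
  \<nu> then interact through the product \<mu> \<nu> without conjugation.\<close>

definition cform :: "complex^('n::finite + 'n) \<Rightarrow> complex^('n + 'n) \<Rightarrow> complex" where
  "cform z w = (\<Sum>j\<in>UNIV. z $ Inl j * w $ Inl j) - (\<Sum>j\<in>UNIV. z $ Inr j * w $ Inr j)"

lemma cform_cvec: "cform (cvec v) (cvec w) = of_real (form v w)"
  by (simp add: cform_def form_eq inner_vec_def)

lemma cform_add_left: "cform (x + y) z = cform x z + cform y z"
  and cform_add_right: "cform z (x + y) = cform z x + cform z y"
  and cform_scale_left: "cform (c *s x) z = c * cform x z"
  and cform_scale_right: "cform z (c *s x) = c * cform z x"
  by (simp_all add: cform_def algebra_simps sum.distrib sum_distrib_left)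

lemma cform_cmat:
  assumes "form_isometry A"
  shows "cform (cmat A *v z) (cmat A *v w) = cform z w"
proof -
  obtain x y where z: "z = cvec x + \<i> *s cvec y"
    using cvec_Re_Im by blast
  obtain x' y' where w: "w = cvec x' + \<i> *s cvec y'"
    using cvec_Re_Im by blast
  show ?thesis
    by (simp only: z w matrix_vector_right_distrib vector_scalar_commute cvec_mult[symmetric]
        cform_add_left cform_add_right cform_scale_left cform_scale_right cform_cvec form_isometryD[OF assms])
qed

text \<open>Writing M z as (M - \<mu>) z + \<mu> z in the invariance of the form leaves (1 - \<mu>
  \<nu>) times the pairing, because the terms with a shifted argument vanish by the two nested
  inductions.\<close>

lemma cform_shifts_eq_0:
  assumes iso: "\<And>z w. cform (M *v z) (M *v w) = cform z w"
    and "shifts M ms z = 0" "shifts M ns w = 0" "\<And>\<mu> \<nu>. \<mu> \<in> set ms \<Longrightarrow> \<nu> \<in> set ns \<Longrightarrow> \<mu> * \<nu> \<noteq> 1"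
  shows "cform z w = 0"
  using assms(2-)
proof (induction ms arbitrary: z w ns)
  case Nil
  then show ?case
    by (simp add: cform_def)
next
  case (Cons \<mu> ms)
  note outer_IH = Cons.IH
  show ?case
    using Cons.prems
  proof (induction ns arbitrary: w)
    case Nil
    then show ?case
      by (simp add: cform_def)
  next
    case (Cons \<nu> ns)
    have 1: "cform z (shift M \<nu> w) = 0"
      using Cons by simp
    have 2: "cform (shift M \<mu> z) w = 0"
      using Cons.prems by (intro outer_IH[of _ "\<nu> # ns"]) auto
    have 3: "cform (shift M \<mu> z) (shift M \<nu> w) = 0"
      using Cons.prems by (intro outer_IH[of _ "ns"]) auto
    have "cform z w = cform (shift M \<mu> z + \<mu> *s z) (shift M \<nu> w + \<nu> *s w)"
      using iso[of z w] by (simp add: shift_def)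
    also have "\<dots> = \<mu> * \<nu> * cform z w"
      by (simp add: cform_add_left cform_add_right cform_scale_left cform_scale_right 1 2 3)
    finally have "(1 - \<mu> * \<nu>) * cform z w = 0"
      by (simp add: algebra_simps)
    then show ?case
      using Cons.prems(3)[of \<mu> \<nu>] by simp
  qed
qed

lemma form_real_root_space_eq_0:
  assumes "form_isometry A" "v \<in> real_root_space A S" "w \<in> real_root_space A S'"
    and "\<And>\<mu> \<nu>. \<mu> \<in> S \<Longrightarrow> \<nu> \<in> S' \<Longrightarrow> \<mu> * \<nu> \<noteq> 1"
  shows "form v w = 0"
proof -
  obtain ms ns where "set ms \<subseteq> S" "shifts (cmat A) ms (cvec v) = 0"
    "set ns \<subseteq> S'" "shifts (cmat A) ns (cvec w) = 0"
    using assms(2,3) by (auto simp: real_root_space_def root_space_def)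
  then have "cform (cvec v) (cvec w) = 0"
    using assms(4) by (intro cform_shifts_eq_0[OF cform_cmat[OF assms(1)]]) auto
  then show ?thesis
    by (simp add: cform_cvec)
qed

subsection \<open>Isotropic subspaces\<close>

lemma subspace_perp: "subspace (perp W)"
  by (auto simp: subspace_def perp_def form_add_left form_scaleR_left)

text \<open>\<open>perp W\<close> is the Euclidean complement of the image of \<open>W\<close> under
  \<open>I_nn\<close>.\<close>

lemma dim_perp:
  fixes W :: "'n::finite vec2n set"
  assumes "subspace W"
  shows "dim (perp W) + dim W = 2 * CARD('n)"
proof -
  let ?I = "(*v) (I_nn :: 'n mat2n)"
  have inj: "inj ?I"
    by (rule injI) (auto simp: I_nn_mult vec2n_eq_iff)
  have "perp W = {y \<in> UNIV. \<forall>x\<in>?I ` W. orthogonal x y}"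
    by (auto simp: perp_def form_def orthogonal_def inner_commute)
  moreover have "dim (?I ` W) = dim W"
    by (rule dim_image_eq[OF matrix_vector_mul_linear]) (use inj in \<open>auto intro: inj_on_subset\<close>)
  moreover have "subspace (?I ` W)"
    by (rule linear_subspace_image[OF matrix_vector_mul_linear assms])
  ultimately show ?thesis
    using dim_subspace_orthogonal_to_vectors[of "?I ` W" UNIV] by simp
qed

lemma isotropic_imp_subset_perp: "isotropic W \<Longrightarrow> W \<subseteq> perp W"
  by (auto simp: isotropic_def perp_def)

lemma isotropic_subspace: "isotropic W \<Longrightarrow> subspace W"
  by (simp add: isotropic_def)

lemma isotropic_norm:
  assumes "isotropic W" "v \<in> W"
  shows "norm (pos v) = norm (neg v)"
  using assms by (auto simp: isotropic_def form_eq norm_eq_sqrt_inner)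

text \<open>Isotropic vectors have positive and negative parts of equal norm, so either part
  vanishes only together with the other.\<close>

lemma isotropic_inj_pos:
  assumes "isotropic W"
  shows "inj_on pos W" "inj_on neg W"
proof -
  have *: "v = w" if "v \<in> W" "w \<in> W" "pos v = pos w \<or> neg v = neg w" for v w
  proof -
    have "v - w \<in> W"
      using assms that by (simp add: isotropic_def subspace_diff)
    then have "norm (pos (v - w)) = norm (neg (v - w))"
      by (rule isotropic_norm[OF assms])
    then have "pos (v - w) = 0 \<and> neg (v - w) = 0"
      using that(3) by (auto simp: pos_diff neg_diff)
    then show ?thesis
      by (metis eq_iff_diff_eq_0 join_0 join_pos_neg)
  qed
  show "inj_on pos W" "inj_on neg W"
    using * by (auto intro!: inj_onI)
qed

lemma isotropic_span: "isotropic W \<Longrightarrow> span W = W"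
  by (simp add: isotropic_def)

lemma dim_pos_isotropic:
  assumes "isotropic W"
  shows "dim (pos ` W) = dim W" "dim (neg ` W) = dim W"
  using isotropic_inj_pos[OF assms]
  by (auto intro!: dim_image_eq simp: linear_pos linear_neg isotropic_span[OF assms])

lemma isotropic_dim_le:
  fixes W :: "'n::finite vec2n set"
  assumes "isotropic W"
  shows "dim W \<le> CARD('n)"
  using dim_pos_isotropic(1)[OF assms] dim_subset_UNIV[of "pos ` W"] by simp

lemma isotropic_maximal_dim:
  fixes W :: "'n::finite vec2n set"
  assumes "isotropic W" "dim W = CARD('n)"
  shows "maximal_isotropic W"
  unfolding maximal_isotropic_def
proof (intro conjI allI impI assms(1))
  fix W' assume "isotropic W' \<and> W \<subseteq> W'"
  then show "W' = W"
    using subspace_dim_equal[of W W'] assms isotropic_dim_le[of W'] by (auto simp: isotropic_def)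
qed

lemma isotropic_image:
  assumes "form_isometry A" "isotropic W"
  shows "isotropic ((*v) A ` W)"
  using assms by (auto simp: isotropic_def form_isometryD intro: linear_subspace_image)

lemma dim_image_isometry:
  assumes "form_isometry A"
  shows "dim ((*v) A ` W) = dim W"
proof -
  have "inj ((*v) A)"
    using form_isometry_inj[OF assms] by (simp add: matrix_vector_mul_linear linear_injective_0)
  then show ?thesis
    by (intro dim_image_eq matrix_vector_mul_linear) (rule inj_on_subset, auto)
qed

subsection \<open>Maximal isotropic subspaces as graphs\<close>

definition graph :: "real^'n^'n \<Rightarrow> 'n::finite vec2n set" where
  "graph Q = range (\<lambda>x. join x (Q *v x))"

lemma mem_graph_iff: "v \<in> graph Q \<longleftrightarrow> neg v = Q *v pos v"
  unfolding graph_def by (metis (no_types, lifting) join_pos_neg neg_join pos_join rangeE rangeI)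

lemma orthogonal_matrix_inner:
  fixes Q :: "real^'n^'n"
  shows "orthogonal_matrix Q \<Longrightarrow> (Q *v x) \<bullet> (Q *v y) = x \<bullet> y"
  by (metis matrix_of_matrix_vector_mul matrix_vector_mul_linear orthogonal_transformation_def
      orthogonal_transformation_matrix)

lemma orthogonal_matrix_norm:
  fixes Q :: "real^'n^'n"
  shows "orthogonal_matrix Q \<Longrightarrow> norm (Q *v x) = norm x"
  by (simp add: norm_eq_sqrt_inner orthogonal_matrix_inner)

lemma isotropic_graph:
  assumes "orthogonal_matrix Q"
  shows "isotropic (graph Q)"
  unfolding isotropic_def
proof (intro conjI ballI)
  show "subspace (graph Q)"
    by (auto simp: subspace_def mem_graph_iff pos_add neg_add pos_scaleR neg_scaleR pos_0 neg_0
        matrix_vector_right_distrib scaleR_matrix_vector_assoc matrix_vector_mult_scaleR)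
  fix v w assume "v \<in> graph Q" "w \<in> graph Q"
  then show "form v w = 0"
    by (simp add: mem_graph_iff form_eq orthogonal_matrix_inner[OF assms])
qed

lemma dim_graph:
  fixes Q :: "real^'n^'n"
  assumes "orthogonal_matrix Q"
  shows "dim (graph Q) = CARD('n)"
proof -
  have "pos ` graph Q = UNIV"
    by (auto simp: graph_def image_image)
  then show ?thesis
    using dim_pos_isotropic(1)[OF isotropic_graph[OF assms]] by simp
qed

lemma perp_graph:
  assumes "orthogonal_matrix Q"
  shows "perp (graph Q) = graph Q"
proof -
  have "subspace (graph Q)"
    using isotropic_graph[OF assms] by (simp add: isotropic_def)
  then show ?thesis
    using subspace_dim_equal[OF _ subspace_perp isotropic_imp_subset_perp[OF isotropic_graph[OF assms]]]
      dim_perp[of "graph Q"] by (simp add: dim_graph[OF assms])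
qed

text \<open>For \<open>a\<close> = 0 the quotient is 0 and the matrix is the identity, which is what
  makes \<open>reflection_swap\<close> true for x = y.\<close>

definition reflection :: "real^'n \<Rightarrow> real^'n^'n" where
  "reflection a = mat 1 - (2 / (a \<bullet> a)) *\<^sub>R (\<chi> i j. a $ i * a $ j)"

lemma reflection_mult: "reflection a *v x = x - (2 * (a \<bullet> x) / (a \<bullet> a)) *\<^sub>R a"
proof -
  have "(\<chi> i j. a $ i * a $ j) *v x = (a \<bullet> x) *\<^sub>R a"
    by (simp add: vec_eq_iff matrix_vector_mult_def inner_vec_def sum_distrib_right sum_distrib_left mult_ac)
  then show ?thesis
    by (simp add: reflection_def matrix_vector_mult_diff_rdistrib flip: scaleR_matrix_vector_assoc)
qed

lemma reflection_fix: "a \<bullet> x = 0 \<Longrightarrow> reflection a *v x = x"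
  by (simp add: reflection_mult)

lemma reflection_swap:
  assumes "norm x = norm y"
  shows "reflection (x - y) *v x = y"
proof (cases "x = y")
  case False
  have "(x - y) \<bullet> (x - y) = 2 * ((x - y) \<bullet> x)"
    using assms by (simp add: inner_simps norm_eq inner_commute)
  moreover have "(x - y) \<bullet> (x - y) \<noteq> 0"
    using False by simp
  ultimately show ?thesis
    by (simp add: reflection_mult)
qed (simp add: reflection_mult)

lemma reflection_involution: "a \<noteq> 0 \<Longrightarrow> reflection a ** reflection a = mat 1"
  by (simp add: matrix_eq reflection_mult inner_simps flip: matrix_vector_mul_assoc)

lemma orthogonal_matrix_reflection:
  assumes "a \<noteq> 0"
  shows "orthogonal_matrix (reflection a)"
proof -
  have "transpose (reflection a) = reflection a"
    by (simp add: reflection_def transpose_def vec_eq_iff mat_def mult.commute)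
  then show ?thesis
    using reflection_involution[OF assms] by (simp add: orthogonal_matrix)
qed

text \<open>An orthogonal matrix carrying a coordinate axis to the unit normal \<open>u\<close>
  conjugates the reflection to a diagonal one.\<close>

lemma det_reflection:
  fixes a :: "real^'n"
  assumes "a \<noteq> 0"
  shows "det (reflection a) = -1"
proof -
  obtain k :: 'n where True by blast
  define u where "u = a /\<^sub>R norm a"
  have u: "norm u = 1"
    using assms by (simp add: u_def)
  obtain A where A: "orthogonal_matrix A" "A *v axis k 1 = u"
    using orthogonal_matrix_exists_basis[OF u] by metis
  have AA: "A ** transpose A = mat 1"
    using A(1) by (simp add: orthogonal_matrix_def)
  have "reflection a *v x = (A ** reflection (axis k 1) ** transpose A) *v x" for x
  proof -
    define y where "y = transpose A *v x"
    have y: "A *v y = x"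
      unfolding y_def by (metis AA matrix_vector_mul_assoc matrix_vector_mul_lid)
    have "axis k 1 \<bullet> y = u \<bullet> x"
      using orthogonal_matrix_inner[OF A(1), of "axis k 1" y] by (simp add: A(2) y)
    moreover have "(A ** reflection (axis k 1) ** transpose A) *v x = A *v (reflection (axis k 1) *v y)"
      by (simp only: y_def matrix_vector_mul_assoc matrix_mul_assoc)
    ultimately have "(A ** reflection (axis k 1) ** transpose A) *v x = x - (2 * (u \<bullet> x)) *\<^sub>R u"
      by (simp add: reflection_mult matrix_vector_mult_diff_distrib matrix_vector_mult_scaleR A(2) y
          inner_axis_axis)
    also have "\<dots> = reflection a *v x"
      using assms by (simp add: reflection_mult u_def dot_square_norm power2_eq_square field_simps)
    finally show ?thesis ..
  qed
  then have "reflection a = A ** reflection (axis k 1) ** transpose A"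
    by (simp add: matrix_eq)
  then have "det (reflection a) = det (A ** transpose A) * det (reflection (axis k 1 :: real^'n))"
    by (simp add: det_mul)
  also have "det (reflection (axis k 1 :: real^'n)) = (\<Prod>i\<in>UNIV. reflection (axis k 1 :: real^'n) $ i $ i)"
    by (rule det_diagonal) (auto simp: reflection_def mat_def axis_def)
  also have "\<dots> = (\<Prod>i\<in>UNIV. if i = k then -1 else 1)"
    by (rule prod.cong) (auto simp: reflection_def mat_def axis_def inner_axis_axis[unfolded axis_def])
  finally show ?thesis
    by (simp add: AA)
qed

text \<open>An extension theorem of Witt type, reached by reflections from any orthogonal
  \<open>Q\<close>. For \<open>w\<close> in \<open>W\<close> off the graph, reflecting in a = Q (pos
  w) - neg w brings \<open>w\<close> into the graph. For \<open>v\<close> already in the graph, the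
  vanishing of \<open>form w v\<close> says that \<open>a\<close> is orthogonal to Q (pos v), so
  \<open>v\<close> stays. The dimension of the intersection with \<open>W\<close> grows.\<close>

lemma isotropic_subset_graph:
  fixes W :: "'n::finite vec2n set"
  assumes "isotropic W"
  obtains Q where "orthogonal_matrix Q" "W \<subseteq> graph Q"
proof -
  have "\<exists>Q'. orthogonal_matrix Q' \<and> W \<subseteq> graph Q'" if "orthogonal_matrix Q" for Q :: "real^'n^'n"
    using that
  proof (induction "dim W - dim (W \<inter> graph Q)" arbitrary: Q rule: less_induct)
    case less
    show ?case
    proof (cases "W \<subseteq> graph Q")
      case False
      then obtain w where w: "w \<in> W" "w \<notin> graph Q"
        by blast
      define a where "a = Q *v pos w - neg w"
      have "a \<noteq> 0"
        using w by (simp add: a_def mem_graph_iff)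
      define Q' where "Q' = reflection a ** Q"
      have Q': "orthogonal_matrix Q'"
        unfolding Q'_def using \<open>a \<noteq> 0\<close> less by (intro orthogonal_matrix_mul orthogonal_matrix_reflection)
      have "norm (Q *v pos w) = norm (neg w)"
        using isotropic_norm[OF assms w(1)] by (simp add: orthogonal_matrix_norm less)
      then have "Q' *v pos w = neg w"
        unfolding Q'_def a_def by (simp add: reflection_swap flip: matrix_vector_mul_assoc)
      then have "w \<in> graph Q'"
        by (simp add: mem_graph_iff)
      have "W \<inter> graph Q \<subseteq> graph Q'"
      proof
        fix v assume v: "v \<in> W \<inter> graph Q"
        then have "form w v = 0"
          using assms w by (auto simp: isotropic_def)
        then have "a \<bullet> (Q *v pos v) = 0"
          using v by (simp add: a_def inner_simps form_eq mem_graph_iff orthogonal_matrix_inner less)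
        then have "Q' *v pos v = Q *v pos v"
          unfolding Q'_def by (simp add: reflection_fix flip: matrix_vector_mul_assoc)
        then show "v \<in> graph Q'"
          using v by (simp add: mem_graph_iff)
      qed
      then have "W \<inter> graph Q \<subset> W \<inter> graph Q'"
        using w \<open>w \<in> graph Q'\<close> by blast
      moreover have sub: "subspace (W \<inter> graph R)" if "orthogonal_matrix R" for R
        using assms isotropic_graph[OF that] by (simp add: isotropic_def subspace_inter)
      ultimately have "dim (W \<inter> graph Q) < dim (W \<inter> graph Q')"
        using dim_psubset sub[OF Q'] sub[OF less.prems] by (metis span_eq_iff)
      moreover have "dim (W \<inter> graph Q') \<le> dim W"
        by (simp add: dim_subset)
      ultimately show ?thesis
        using less(1)[of Q'] Q' by simp
    qed (use less in blast)
  qed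
  then show thesis
    using that orthogonal_matrix_id by blast
qed

text \<open>Below the maximal dimension \<open>pos\<close> followed by \<open>W\<close> leaves a
  free normal direction; composing \<open>Q\<close> with the reflection in it changes the sign of
  the determinant without moving \<open>W\<close>.\<close>

lemma isotropic_subset_rotation_graph:
  fixes W :: "'n::finite vec2n set"
  assumes "isotropic W" "dim W < CARD('n)"
  obtains Q where "orthogonal_matrix Q" "det Q = 1" "W \<subseteq> graph Q"
proof -
  obtain Q where Q: "orthogonal_matrix Q" "W \<subseteq> graph Q"
    using isotropic_subset_graph[OF assms(1)] .
  show thesis
  proof (cases "det Q = 1")
    case True
    then show ?thesis
      using that Q by blast
  next
    case False
    then have "det Q = -1"
      using det_orthogonal_matrix[OF Q(1)] by auto
    have "dim (pos ` W) < DIM(real^'n)"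
      using dim_pos_isotropic(1)[OF assms(1)] assms(2) by simp
    then obtain a where a: "a \<noteq> 0" "\<And>x. x \<in> span (pos ` W) \<Longrightarrow> orthogonal a x"
      using orthogonal_to_subspace_exists by blast
    show ?thesis
    proof (rule that)
      show "orthogonal_matrix (Q ** reflection a)"
        using Q a by (intro orthogonal_matrix_mul orthogonal_matrix_reflection)
      show "det (Q ** reflection a) = 1"
        using a by (simp add: det_mul det_reflection \<open>det Q = -1\<close>)
      show "W \<subseteq> graph (Q ** reflection a)"
      proof
        fix w assume "w \<in> W"
        then have "a \<bullet> pos w = 0"
          using a(2)[of "pos w"] by (simp add: span_base orthogonal_def)
        then show "w \<in> graph (Q ** reflection a)"
          using Q \<open>w \<in> W\<close> by (auto simp: mem_graph_iff reflection_fix simp flip: matrix_vector_mul_assoc)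
      qed
    qed
  qed
qed

lemma subspace_fixed: "subspace {x. P *v x = (x :: real^'n)}"
  by (auto simp: subspace_def matrix_vector_right_distrib matrix_vector_mult_scaleR)

text \<open>The rotation P = Q^T Q' fixes the positive parts of \<open>W\<close>, a space of
  codimension at most 1. If it moved \<open>x\<close>, the reflection returning P x to
  \<open>x\<close> would also fix those parts, so its product with \<open>P\<close> would be the
  identity and det P would be -1.\<close>

lemma rotation_graph_unique:
  fixes W :: "'n::finite vec2n set"
  assumes "isotropic W" "CARD('n) \<le> Suc (dim W)"
    and "orthogonal_matrix Q" "det Q = 1" "W \<subseteq> graph Q"
    and "orthogonal_matrix Q'" "det Q' = 1" "W \<subseteq> graph Q'"
  shows "Q = Q'"
proof -
  define P where "P = transpose Q ** Q'"
  have P: "orthogonal_matrix P" "det P = 1"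
    using assms by (auto simp: P_def det_mul intro: orthogonal_matrix_mul simp: orthogonal_matrix_transpose)
  have QQ: "Q ** transpose Q = mat 1" "transpose Q ** Q = mat 1"
    using assms by (auto simp: orthogonal_matrix_def)
  have fix_W: "P *v x = x" if "x \<in> pos ` W" for x
  proof -
    have "Q *v x = Q' *v x"
      using that assms(5,8) by (auto simp: mem_graph_iff subset_iff)
    then have "P *v x = (transpose Q ** Q) *v x"
      by (simp add: P_def flip: matrix_vector_mul_assoc)
    then show ?thesis
      by (simp add: QQ)
  qed
  have "P *v x = x" for x
  proof (rule ccontr)
    assume x: "P *v x \<noteq> x"
    define a where "a = P *v x - x"
    have "a \<noteq> 0"
      using x by (simp add: a_def)
    have ax: "reflection a *v (P *v x) = x"
      unfolding a_def by (rule reflection_swap) (simp add: orthogonal_matrix_norm P)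
    have aW: "reflection a *v (P *v y) = y" if "y \<in> pos ` W" for y
    proof -
      have "a \<bullet> y = 0"
        using fix_W[OF that] orthogonal_matrix_inner[OF P(1), of x y] by (simp add: a_def inner_simps)
      then show ?thesis
        by (simp add: fix_W[OF that] reflection_fix)
    qed
    have "span (insert x (pos ` W)) \<subseteq> {y. (reflection a ** P) *v y = y}"
      by (rule span_minimal[OF _ subspace_fixed]) (use ax aW in \<open>auto simp flip: matrix_vector_mul_assoc\<close>)
    moreover have "dim (insert x (pos ` W)) = CARD('n)"
    proof -
      have "span (pos ` W) = pos ` W"
        using linear_subspace_image[OF linear_pos isotropic_subspace[OF assms(1)]] by simp
      then have "x \<notin> span (pos ` W)"
        using x fix_W by metis
      then have "dim (insert x (pos ` W)) = Suc (dim W)"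
        by (simp add: dim_insert dim_pos_isotropic[OF assms(1)])
      then show ?thesis
        using assms(2) dim_subset_UNIV[of "insert x (pos ` W)"] by simp
    qed
    then have "span (insert x (pos ` W)) = UNIV"
      by (simp add: dim_eq_full[symmetric])
    ultimately have "reflection a ** P = mat 1"
      by (auto simp: matrix_eq)
    then have "det (reflection a) * det P = 1"
      by (metis det_I det_mul)
    then show False
      by (simp add: det_reflection \<open>a \<noteq> 0\<close> P)
  qed
  then have "P = mat 1"
    by (simp add: matrix_eq)
  then have "Q ** P = Q"
    by simp
  then show ?thesis
    by (simp add: P_def matrix_mul_assoc QQ)
qed

subsection \<open>The compact part of the identity component\<close>

text \<open>Only the positive part is rotated. The vector e_{2n} stays fixed, so such a matrix is in
  \<open>G0\<close> once it is in \<open>SO0_nn\<close>.\<close>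

definition pos_block :: "real^'n^'n \<Rightarrow> 'n::finite mat2n" where
  "pos_block Q = (\<chi> i j. case i of
     Inl i' \<Rightarrow> (case j of Inl j' \<Rightarrow> Q $ i' $ j' | Inr _ \<Rightarrow> 0)
   | Inr i' \<Rightarrow> (if i = j then 1 else 0))"

lemma pos_block_mult: "pos_block Q *v v = join (Q *v pos v) (neg v)"
proof -
  have "(\<Sum>j'\<in>UNIV. (if Inr j = Inr j' then 1 else 0) * v $ Inr j') = v $ Inr j" for j :: 'a
    using sum.delta[of UNIV j "\<lambda>j'. v $ Inr j'"] by (simp add: if_distrib[of "\<lambda>c. c * _"] eq_commute cong: if_cong)
  then show ?thesis
    by (simp add: vec2n_eq_iff matrix_vector_mult_def sum_vec2n pos_block_def)
qed

lemma pos_block_mul: "pos_block (P ** Q) = pos_block P ** pos_block Q"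
  by (simp add: matrix_eq pos_block_mult flip: matrix_vector_mul_assoc)

lemma pos_block_1: "pos_block (mat 1) = mat 1"
  by (simp add: matrix_eq pos_block_mult)

lemma form_isometry_pos_block: "orthogonal_matrix Q \<Longrightarrow> form_isometry (pos_block Q)"
  by (simp add: form_isometry_iff pos_block_mult form_eq orthogonal_matrix_inner)

text \<open>Moving \<open>a\<close> along the segment to \<open>b\<close> joins the product to the
  square of one reflection, which is 1. The segment avoids 0 when the inner product of
  \<open>a\<close> and \<open>b\<close> is nonnegative; otherwise - a, which defines the same
  reflection, replaces \<open>a\<close>.\<close>

lemma pos_block_reflections:
  fixes a b :: "real^'n"
  assumes "a \<noteq> 0" "b \<noteq> 0"
  shows "pos_block (reflection a ** reflection b) \<in> SO0_nn"
proof -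
  have *: "pos_block (reflection a ** reflection b) \<in> SO0_nn" if ab: "a \<noteq> 0" "b \<noteq> 0" "0 \<le> a \<bullet> b" for a b :: "real^'n"
  proof -
    define c where "c s = (1 - s) *\<^sub>R a + s *\<^sub>R b" for s :: real
    have c: "c s \<noteq> 0" if "s \<in> {0..1}" for s
    proof
      assume "c s = 0"
      then have "0 = c s \<bullet> a" "0 = c s \<bullet> b"
        by simp_all
      then have "0 = (1 - s) * (a \<bullet> a) + s * (a \<bullet> b)" "0 = (1 - s) * (a \<bullet> b) + s * (b \<bullet> b)"
        by (simp_all add: c_def inner_simps inner_commute)
      then have "(1 - s) * (a \<bullet> a) = 0" "s * (b \<bullet> b) = 0"
        using that ab(3)
        by (smt (verit, ccfv_threshold) atLeastAtMost_iff inner_ge_zero mult_nonneg_nonneg)+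
      then show False
        using ab by auto
    qed
    let ?f = "\<lambda>s. pos_block (reflection (c s) ** reflection b)"
    have cont_reflection: "continuous_on {0..1} (\<lambda>s. reflection (c s))"
      unfolding reflection_def using c
      by (intro continuous_intros continuous_on_vec_lambda) (auto simp: c_def intro!: continuous_intros)
    have "continuous_on {0..1} (\<lambda>s. ?f s $ i $ j)" for i j
      using cont_reflection unfolding pos_block_def matrix_matrix_mult_def
      by (cases i; cases j) (auto intro!: continuous_intros)
    then have "continuous_on {0..1} (\<lambda>s. \<chi> i j. ?f s $ i $ j)"
      by (intro continuous_on_vec_lambda)
    then have "continuous_on {0..1} ?f"
      by simp
    then have "connected (?f ` {0..1})"
      by (rule connected_continuous_image) simp
    moreover have "form_isometry (?f s)" if "s \<in> {0..1}" for s
      using c[OF that] ab by (intro form_isometry_pos_block orthogonal_matrix_mul orthogonal_matrix_reflection)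
    moreover have "c 1 = b" "c 0 = a"
      by (auto simp: c_def)
    then have "?f 1 = mat 1"
      using reflection_involution[OF ab(2)] by (simp add: pos_block_1)
    then have "mat 1 \<in> ?f ` {0..1}"
      by (intro image_eqI[of _ _ 1]) auto
    ultimately have "?f ` {0..1} \<subseteq> SO0_nn"
      by (intro connected_isometries_subset_SO0) auto
    then show ?thesis
      using \<open>c 0 = a\<close> by (auto simp: image_subset_iff dest!: bspec[of _ _ 0])
  qed
  have "reflection (- a) = reflection a"
    by (simp add: reflection_def)
  then show ?thesis
    using *[of a b] *[of "- a" b] assms by (cases "0 \<le> a \<bullet> b") auto
qed

text \<open>Cartan-Dieudonne by induction on the codimension of the fixed space, two reflections at
  a time. After one reflection the determinant is -1, so the product is not yet the identity and a
  second enlarging reflection exists.\<close>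

lemma pos_block_rotation:
  assumes "orthogonal_matrix Q" "det Q = 1"
  shows "pos_block Q \<in> SO0_nn"
  using assms
proof (induction "DIM(real^'a) - dim {x. Q *v x = x}" arbitrary: Q rule: less_induct)
  case less
  have step: "\<exists>a\<noteq>0. {x. Q *v x = x} \<subset> {x. (reflection a ** Q) *v x = x}"
    if orth: "orthogonal_matrix Q" and ne: "Q \<noteq> mat 1" for Q :: "real^'a^'a"
  proof -
    obtain x where x: "Q *v x \<noteq> x"
      using ne by (auto simp: matrix_eq)
    let ?a = "Q *v x - x"
    have "reflection ?a *v (Q *v x) = x"
      by (rule reflection_swap) (simp add: orthogonal_matrix_norm orth)
    moreover have "reflection ?a *v (Q *v y) = y" if "Q *v y = y" for y
    proof -
      have "?a \<bullet> y = 0"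
        using orthogonal_matrix_inner[OF orth, of x y] that by (simp add: inner_simps)
      then show ?thesis
        by (simp add: reflection_fix that)
    qed
    ultimately show ?thesis
      using x by (intro exI[of _ ?a]) (auto simp flip: matrix_vector_mul_assoc)
  qed
  show ?case
  proof (cases "Q = mat 1")
    case True
    then show ?thesis
      by (simp add: pos_block_1 SO0_nn_1)
  next
    case False
    obtain a where a: "a \<noteq> 0" "{x. Q *v x = x} \<subset> {x. (reflection a ** Q) *v x = x}"
      using step[OF less.prems(1) False] by blast
    have orth: "orthogonal_matrix (reflection a ** Q)"
      using a less by (intro orthogonal_matrix_mul orthogonal_matrix_reflection)
    have "det (reflection a ** Q) = -1"
      using a less by (simp add: det_mul det_reflection)
    then have "reflection a ** Q \<noteq> mat 1"
      by (metis det_I one_neq_neg_one)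
    then obtain b where b: "b \<noteq> 0"
      "{x. (reflection a ** Q) *v x = x} \<subset> {x. (reflection b ** (reflection a ** Q)) *v x = x}"
      using step[OF orth] by blast
    let ?R = "reflection b ** (reflection a ** Q)"
    have R: "orthogonal_matrix ?R" "det ?R = 1"
      using orth b \<open>det (reflection a ** Q) = -1\<close>
      by (auto simp: det_mul[of "reflection b"] det_reflection intro!: orthogonal_matrix_mul orthogonal_matrix_reflection)
    have "dim {x. Q *v x = x} < dim {x. ?R *v x = x}"
      using a(2) b(2) by (intro dim_psubset) (simp add: span_eq_iff[THEN iffD2] subspace_fixed)
    moreover have "dim {x. ?R *v x = x} \<le> DIM(real^'a)"
      by (rule dim_subset_UNIV)
    ultimately have "pos_block ?R \<in> SO0_nn"
      using R by (intro less(1)) auto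
    moreover have "pos_block (reflection a ** reflection b) \<in> SO0_nn"
      using a b by (intro pos_block_reflections)
    ultimately have "pos_block (reflection a ** reflection b) ** pos_block ?R \<in> SO0_nn"
      by (intro SO0_nn_mult)
    moreover have "reflection a ** reflection b ** ?R = reflection a ** (reflection b ** reflection b) ** reflection a ** Q"
      by (simp add: matrix_mul_assoc)
    then have "reflection a ** reflection b ** ?R = Q"
      using reflection_involution[OF a(1)] reflection_involution[OF b(1)] by simp
    ultimately show ?thesis
      by (simp flip: pos_block_mul)
  qed
qed

section \<open>The orbit of the standard maximal isotropic subspace\<close>

lemma std_Vplus_eq: "(std_Vplus :: 'n::finite vec2n set) = graph (mat 1)"
proof
  show "std_Vplus \<subseteq> (graph (mat 1) :: 'n vec2n set)"
    unfolding std_Vplus_def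
  proof (rule span_minimal)
    show "subspace (graph (mat 1) :: 'n vec2n set)"
      by (intro isotropic_subspace isotropic_graph orthogonal_matrix_id)
    have "e_pos j + e_neg j \<in> graph (mat 1)" for j :: 'n
      by (simp add: mem_graph_iff) (simp add: vec_eq_iff e_pos_def e_neg_def axis_def)
    then show "{e_pos j + e_neg j |j. True} \<subseteq> (graph (mat 1) :: 'n vec2n set)"
      by blast
  qed
next
  show "(graph (mat 1) :: 'n vec2n set) \<subseteq> std_Vplus"
  proof
    fix v :: "'n vec2n" assume v: "v \<in> graph (mat 1)"
    then have "neg v = pos v"
      by (simp add: mem_graph_iff)
    then have nth: "v $ Inr j = v $ Inl j" for j
      by (metis neg_nth pos_nth)
    have "v = (\<Sum>j\<in>UNIV. v $ Inl j *\<^sub>R (e_pos j + e_neg j))"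
      by (simp add: vec2n_eq_iff e_pos_def e_neg_def axis_def nth if_distrib[of "\<lambda>c. _ * c"] cong: if_cong)
    also have "\<dots> \<in> std_Vplus"
      unfolding std_Vplus_def by (intro span_sum span_scale span_base) auto
    finally show "v \<in> std_Vplus" .
  qed
qed

text \<open>The block keeps the negative part, so the diagonal point (y, y) has to go to the graph
  point with second entry y. Its first entry is Q^T y, whence the transpose.\<close>

lemma graph_eq_image:
  assumes "orthogonal_matrix Q"
  shows "graph Q = (*v) (pos_block (transpose Q)) ` std_Vplus"
proof -
  have QQ: "Q ** transpose Q = mat 1" "transpose Q ** Q = mat 1"
    using assms by (auto simp: orthogonal_matrix_def)
  have "pos_block (transpose Q) *v join y y = join (transpose Q *v y) (Q *v (transpose Q *v y))" for y
    unfolding pos_block_mult pos_join neg_join by (metis QQ(1) matrix_vector_mul_assoc matrix_vector_mul_lid)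
  then have "(*v) (pos_block (transpose Q)) ` std_Vplus
      = (\<lambda>x. join x (Q *v x)) ` range ((*v) (transpose Q))"
    by (simp add: std_Vplus_eq graph_def image_image)
  also have "range ((*v) (transpose Q)) = UNIV"
    by (metis QQ(2) matrix_vector_mul_assoc matrix_vector_mul_lid surjI)
  finally show ?thesis
    by (simp add: graph_def)
qed

text \<open>\<open>P k\<close> and \<open>N k\<close> are the two parts of \<open>k\<close> on the
  diagonal. Isotropy makes both invertible for every isometry, so the sign of det (P k) det (N k) is
  constant on the connected group and is read off at the identity. As Q P = N, it is the sign of det
  Q.\<close>

lemma SO0_std_Vplus_det_eq_1:
  fixes Q :: "real^'n^'n"
  assumes k: "k \<in> SO0_nn" and Q: "orthogonal_matrix Q" and sub: "(*v) k ` std_Vplus \<subseteq> graph Q"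
  shows "det Q = 1"
proof -
  define P :: "'n mat2n \<Rightarrow> real^'n^'n" where "P k = (\<chi> i j. k $ Inl i $ Inl j + k $ Inl i $ Inr j)" for k
  define N :: "'n mat2n \<Rightarrow> real^'n^'n" where "N k = (\<chi> i j. k $ Inr i $ Inl j + k $ Inr i $ Inr j)" for k
  have mult: "k *v join x x = join (P k *v x) (N k *v x)" for k x
    by (simp add: vec2n_eq_iff matrix_vector_mult_def sum_vec2n P_def N_def distrib_right sum.distrib)
  have nz: "det (P k) \<noteq> 0 \<and> det (N k) \<noteq> 0" if "form_isometry k" for k
  proof -
    have "norm (P k *v x) = norm (N k *v x)" for x
    proof -
      have "form (k *v join x x) (k *v join x x) = 0"
        unfolding form_isometryD[OF that] by (simp add: form_eq)
      then show ?thesis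
        by (simp add: mult form_eq norm_eq_sqrt_inner)
    qed
    then have "P k *v x = 0 \<longleftrightarrow> N k *v x = 0" for x
      by (metis norm_eq_zero)
    moreover have "x = 0" if "P k *v x = 0" "N k *v x = 0" for x
    proof -
      have "k *v join x x = 0"
        by (simp add: mult that)
      then have "join x x = join 0 0"
        using form_isometry_inj[OF \<open>form_isometry k\<close>] by simp
      then show ?thesis
        by (simp only: join_eq_iff)
    qed
    ultimately have "inj ((*v) (P k))" "inj ((*v) (N k))"
      by (auto simp: linear_injective_0 matrix_vector_mul_linear)
    then show ?thesis
      by (metis invertible_det_nz invertible_left_inverse matrix_left_invertible_injective)
  qed
  have "0 < det (P k) * det (N k)"
  proof (rule connected_nonzero_pos[OF connected_SO0_nn _ _ SO0_nn_1 _ k])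
    show "continuous_on SO0_nn (\<lambda>k. det (P k) * det (N k))"
      unfolding P_def N_def
      by (intro continuous_on_mult continuous_on_det continuous_on_vec_lambda continuous_intros)
    show "det (P k) * det (N k) \<noteq> 0" if "k \<in> SO0_nn" for k
      using nz SO0_nn_isometry[OF that] by simp
    have "P (mat 1) = mat 1" "N (mat 1) = mat 1"
      by (auto simp: P_def N_def vec_eq_iff mat_def)
    then show "0 < det (P (mat 1)) * det (N (mat 1))"
      by simp
  qed
  moreover have "Q ** P k = N k"
  proof -
    have "N k *v x = Q *v (P k *v x)" for x
    proof -
      have "k *v join x x \<in> graph Q"
        using sub by (auto simp: std_Vplus_eq graph_def)
      then show ?thesis
        by (simp add: mult mem_graph_iff)
    qed
    then show ?thesis
      by (simp add: matrix_eq flip: matrix_vector_mul_assoc)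
  qed
  then have "det (N k) = det Q * det (P k)"
    by (metis det_mul)
  ultimately have "0 < det Q * (det (P k))\<^sup>2"
    by (simp add: power2_eq_square mult_ac)
  then have "0 < det Q"
    by (simp add: zero_less_mult_iff)
  then show ?thesis
    using det_orthogonal_matrix[OF Q] by auto
qed

lemma SO0_orbit_std_Vplus:
  assumes "k \<in> SO0_nn"
  obtains Q where "orthogonal_matrix Q" "det Q = 1" "(*v) k ` std_Vplus = graph Q"
proof -
  have "isotropic ((*v) k ` std_Vplus)"
    by (intro isotropic_image SO0_nn_isometry assms) (simp add: std_Vplus_eq isotropic_graph orthogonal_matrix_id)
  then obtain Q where Q: "orthogonal_matrix Q" "(*v) k ` std_Vplus \<subseteq> graph Q"
    by (rule isotropic_subset_graph)
  have "subspace ((*v) k ` std_Vplus)" "subspace (graph Q)"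
    using \<open>isotropic ((*v) k ` std_Vplus)\<close> isotropic_graph[OF Q(1)] by (auto simp: isotropic_def)
  moreover have "dim ((*v) k ` std_Vplus) = dim (graph Q)"
    by (simp add: dim_image_isometry[OF SO0_nn_isometry[OF assms]] std_Vplus_eq dim_graph Q orthogonal_matrix_id)
  ultimately have "(*v) k ` std_Vplus = graph Q"
    using Q(2) by (intro subspace_dim_equal) auto
  then show thesis
    using that Q(1) SO0_std_Vplus_det_eq_1[OF assms Q] by blast
qed

text \<open>A graph of an orthogonal matrix is its own \<open>perp\<close>, so lying in the
  \<open>perp\<close> of \<open>top_W A\<close> means containing \<open>top_W A\<close>, and
  \<open>rotation_graph_unique\<close> settles the definite description.\<close>

lemma top_V_eq:
  fixes A :: "'n::finite mat2n"
  assumes W: "isotropic (top_W A)" "dim (top_W A) = CARD('n) - 1"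
    and Q: "orthogonal_matrix Q" "det Q = 1" "top_W A \<subseteq> graph Q"
  shows "top_V A = graph Q"
  unfolding top_V_def
proof (rule the_equality)
  have "graph Q \<subseteq> perp (top_W A)"
    using Q(3) perp_graph[OF Q(1)] by (auto simp: perp_def)
  moreover have "pos_block (transpose Q) \<in> SO0_nn"
    using Q by (intro pos_block_rotation) (auto simp: orthogonal_matrix_transpose)
  ultimately show "maximal_isotropic (graph Q) \<and> graph Q \<subseteq> perp (top_W A)
      \<and> (\<exists>k\<in>SO0_nn. graph Q = (*v) k ` std_Vplus)"
    using isotropic_maximal_dim[OF isotropic_graph[OF Q(1)] dim_graph[OF Q(1)]] graph_eq_image[OF Q(1)]
    by blast
next
  fix V assume V: "maximal_isotropic V \<and> V \<subseteq> perp (top_W A) \<and> (\<exists>k\<in>SO0_nn. V = (*v) k ` std_Vplus)"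
  then obtain Q' where Q': "orthogonal_matrix Q'" "det Q' = 1" "V = graph Q'"
    by (metis SO0_orbit_std_Vplus)
  have "top_W A \<subseteq> perp V"
    using V by (auto simp: perp_def form_commute)
  then have "top_W A \<subseteq> graph Q'"
    by (simp add: Q' perp_graph)
  then show "V = graph Q"
    using rotation_graph_unique[OF W(1) _ Q] Q' W(2) by simp
qed

subsection \<open>Transitivity on transverse isotropic pairs\<close>

lemma pos_e_pos [simp]: "pos (e_pos j) = axis j 1"
  and neg_e_pos [simp]: "neg (e_pos j) = 0"
  and pos_e_neg [simp]: "pos (e_neg j) = 0"
  and neg_e_neg [simp]: "neg (e_neg j) = axis j 1"
  by (auto simp: vec_eq_iff e_pos_def e_neg_def axis_def)

lemma join_e_neg: "join 0 (axis j 1) = e_neg j"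
  by (metis join_pos_neg neg_e_neg pos_e_neg)

lemma less_last_ix_iff: "j < last_ix \<longleftrightarrow> j \<noteq> last_ix" for j :: "'n::{finite,linorder}"
  by (metis Max_ge UNIV_I finite le_neq_trans order_less_irrefl)

lemma mem_R_odd_iff: "v \<in> R_odd \<longleftrightarrow> v $ Inr last_ix = 0" for v :: "'n::{finite,linorder} vec2n"
proof
  assume v: "v \<in> R_odd"
  have "subspace {v :: 'n vec2n. v $ Inr last_ix = 0}"
    by (auto simp: subspace_def)
  then have "R_odd \<subseteq> {v :: 'n vec2n. v $ Inr last_ix = 0}"
    unfolding R_odd_def by (intro span_minimal) (auto simp: axis_def)
  then show "v $ Inr last_ix = 0"
    using v by auto
next
  assume v: "v $ Inr last_ix = 0"
  have "v = (\<Sum>i\<in>UNIV. v $ i *s axis i 1)"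
    by (simp add: basis_expansion)
  also have "\<dots> \<in> R_odd"
    unfolding R_odd_def
  proof (rule span_sum)
    fix i
    show "v $ i *s axis i 1 \<in> span {axis i 1 |i. i \<noteq> Inr last_ix}"
      using v by (cases "i = Inr last_ix") (auto simp: scalar_mult_eq_scaleR span_zero intro!: span_scale[OF span_base])
  qed
  finally show "v \<in> R_odd" .
qed

lemma subspace_R_odd: "subspace R_odd"
  by (simp add: R_odd_def)

lemma form_e_pos: "form v (e_pos j) = v $ Inl j"
  and form_e_neg: "form v (e_neg j) = - v $ Inr j"
  by (simp_all add: form_eq inner_axis)

lemma R_odd_eq_perp: "R_odd = perp {e_neg last_ix}"
  by (auto simp: mem_R_odd_iff perp_def form_e_neg)

lemma std_Wplus_iff:
  "v \<in> std_Wplus \<longleftrightarrow> neg v = pos v \<and> v $ Inl last_ix = 0" for v :: "'n::{finite,linorder} vec2n"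
proof
  assume v: "v \<in> std_Wplus"
  have "subspace {v :: 'n vec2n. neg v = pos v \<and> v $ Inl last_ix = 0}"
    by (auto simp: subspace_def neg_add pos_add neg_scaleR pos_scaleR neg_0 pos_0)
  moreover have "e_pos j + e_neg j \<in> {v :: 'n vec2n. neg v = pos v \<and> v $ Inl last_ix = 0}"
    if "j < last_ix" for j
    using that by (simp add: pos_add neg_add) (simp add: e_pos_def e_neg_def axis_def)
  ultimately have "std_Wplus \<subseteq> {v :: 'n vec2n. neg v = pos v \<and> v $ Inl last_ix = 0}"
    unfolding std_Wplus_def by (intro span_minimal) auto
  then show "neg v = pos v \<and> v $ Inl last_ix = 0"
    using v by auto
next
  assume v: "neg v = pos v \<and> v $ Inl last_ix = 0"
  then have nth: "v $ Inr j = v $ Inl j" for j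
    by (metis neg_nth pos_nth)
  have "v = (\<Sum>j\<in>UNIV. v $ Inl j *\<^sub>R (e_pos j + e_neg j))"
    by (simp add: vec2n_eq_iff e_pos_def e_neg_def axis_def nth if_distrib[of "\<lambda>c. _ * c"] cong: if_cong)
  also have "\<dots> \<in> std_Wplus"
    unfolding std_Wplus_def
  proof (rule span_sum)
    fix j
    show "v $ Inl j *\<^sub>R (e_pos j + e_neg j) \<in> span {e_pos j + e_neg j |j. j < last_ix}"
      using v by (cases "j = last_ix") (auto simp: less_last_ix_iff span_zero intro!: span_scale[OF span_base])
  qed
  finally show "v \<in> std_Wplus" .
qed

lemma std_Wminus_iff:
  "v \<in> std_Wminus \<longleftrightarrow> neg v = - pos v \<and> v $ Inl last_ix = 0" for v :: "'n::{finite,linorder} vec2n"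
proof
  assume v: "v \<in> std_Wminus"
  have "subspace {v :: 'n vec2n. neg v = - pos v \<and> v $ Inl last_ix = 0}"
    by (auto simp: subspace_def neg_add pos_add neg_scaleR pos_scaleR neg_0 pos_0)
  moreover have "e_pos j - e_neg j \<in> {v :: 'n vec2n. neg v = - pos v \<and> v $ Inl last_ix = 0}"
    if "j < last_ix" for j
    using that by (simp add: pos_diff neg_diff) (simp add: e_pos_def e_neg_def axis_def)
  ultimately have "std_Wminus \<subseteq> {v :: 'n vec2n. neg v = - pos v \<and> v $ Inl last_ix = 0}"
    unfolding std_Wminus_def by (intro span_minimal) auto
  then show "neg v = - pos v \<and> v $ Inl last_ix = 0"
    using v by auto
next
  assume v: "neg v = - pos v \<and> v $ Inl last_ix = 0"
  then have nth: "v $ Inr j = - v $ Inl j" for j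
    by (metis neg_nth pos_nth vector_uminus_component)
  have "v = (\<Sum>j\<in>UNIV. v $ Inl j *\<^sub>R (e_pos j - e_neg j))"
    by (simp add: vec2n_eq_iff e_pos_def e_neg_def axis_def nth sum_negf if_distrib[of "\<lambda>c. _ * c"] cong: if_cong)
  also have "\<dots> \<in> std_Wminus"
    unfolding std_Wminus_def
  proof (rule span_sum)
    fix j
    show "v $ Inl j *\<^sub>R (e_pos j - e_neg j) \<in> span {e_pos j - e_neg j |j. j < last_ix}"
      using v by (cases "j = last_ix") (auto simp: less_last_ix_iff span_zero intro!: span_scale[OF span_base])
  qed
  finally show "v \<in> std_Wminus" .
qed

lemma join_std_Wplus: "x $ last_ix = 0 \<Longrightarrow> join x x \<in> std_Wplus"
  and join_std_Wminus: "x $ last_ix = 0 \<Longrightarrow> join x (- x) \<in> std_Wminus"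
  by (simp_all add: std_Wplus_iff std_Wminus_iff)

lemma isotropic_std_Wplus: "isotropic std_Wplus"
  unfolding isotropic_def
proof (intro conjI ballI)
  show "subspace std_Wplus"
    by (simp add: std_Wplus_def)
qed (simp add: std_Wplus_iff form_eq)

lemma isotropic_std_Wminus: "isotropic std_Wminus"
  unfolding isotropic_def
proof (intro conjI ballI)
  show "subspace std_Wminus"
    by (simp add: std_Wminus_def)
qed (simp add: std_Wminus_iff form_eq)

lemma dim_coordinate_zero: "dim {x :: real^'n. x $ k = 0} = CARD('n) - 1"
proof -
  have "{x :: real^'n. x $ k = 0} = {x. axis k 1 \<bullet> x = 0}"
    by (simp add: inner_axis')
  then show ?thesis
    using dim_hyperplane[of "axis k 1 :: real^'n"] by (simp add: axis_eq_0_iff)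
qed

lemma dim_std_Wplus: "dim (std_Wplus :: 'n::{finite,linorder} vec2n set) = CARD('n) - 1"
proof -
  have "pos ` std_Wplus = {x :: (real, 'n) vec. x $ last_ix = 0}"
    by (auto simp: std_Wplus_iff intro!: image_eqI[of _ pos "join _ _"] join_std_Wplus)
  then show ?thesis
    by (metis dim_pos_isotropic(1)[OF isotropic_std_Wplus] dim_coordinate_zero)
qed

lemma dim_std_Wminus: "dim (std_Wminus :: 'n::{finite,linorder} vec2n set) = CARD('n) - 1"
proof -
  have "pos ` std_Wminus = {x :: (real, 'n) vec. x $ last_ix = 0}"
    by (auto simp: std_Wminus_iff intro!: image_eqI[of _ pos "join _ _"] join_std_Wminus)
  then show ?thesis
    by (metis dim_pos_isotropic(1)[OF isotropic_std_Wminus] dim_coordinate_zero)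
qed

text \<open>On \<open>R_odd\<close> only n - 1 negative coordinates remain, and \<open>neg\<close>
  is injective on \<open>W\<close>.\<close>

lemma isotropic_R_odd_dim_le:
  fixes W :: "'n::{finite,linorder} vec2n set"
  assumes "isotropic W" "W \<subseteq> R_odd"
  shows "dim W \<le> CARD('n) - 1"
proof -
  have "neg ` W \<subseteq> {x :: (real, 'n) vec. x $ last_ix = 0}"
    using assms(2) by (auto simp: mem_R_odd_iff subset_iff)
  then have "dim (neg ` W) \<le> CARD('n) - 1"
    using dim_subset dim_coordinate_zero by metis
  then show ?thesis
    using dim_pos_isotropic(2)[OF assms(1)] by simp
qed

lemma form_isometry_quadratic:
  assumes "\<And>v. form (A *v v) (A *v v) = form v v"
  shows "form_isometry A"
  unfolding form_isometry_iff
proof (intro allI)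
  fix v w
  have "form (A *v v) (A *v w) = (form (A *v (v + w)) (A *v (v + w)) - form (A *v v) (A *v v) - form (A *v w) (A *v w)) / 2"
    by (simp add: matrix_vector_right_distrib form_add_left form_add_right form_commute[of "A *v w" "A *v v"])
  also have "\<dots> = form v w"
    unfolding assms by (simp add: form_add_left form_add_right form_commute[of w v])
  finally show "form (A *v v) (A *v w) = form v w" .
qed

text \<open>The isometry moving \<open>std_Wminus\<close> is unipotent and fixes \<open>std_Wplus\<close>; conjugating it by the
  dilation acting by \<open>s\<close> on \<open>std_Wplus\<close> and by \<open>1/s\<close> on \<open>std_Wminus\<close> gives the path
  \<open>1 + s N\<^sub>1 + s\<^sup>2 N\<^sub>2\<close> to the identity.\<close>

lemma std_Wminus_transitive:
  fixes Wm :: "'n::{finite,linorder} vec2n set"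
  assumes iso: "isotropic Wm" and odd: "Wm \<subseteq> R_odd" and dim: "dim Wm = CARD('n) - 1"
    and trans: "Wm \<inter> perp std_Wplus \<subseteq> {0}"
  obtains u where "u \<in> G0" "(*v) u ` std_Wplus = std_Wplus" "(*v) u ` std_Wminus = Wm"
proof -
  define L :: 'n where "L = last_ix"
  define P0 :: "(real, 'n) vec \<Rightarrow> (real, 'n) vec" where "P0 x = x - x $ L *\<^sub>R axis L 1" for x
  have linear_P0: "linear P0"
    by (auto simp: linear_iff P0_def vec_eq_iff algebra_simps)
  have P0_L [simp]: "P0 x $ L = 0" for x
    by (simp add: P0_def)
  have P0_nth: "j \<noteq> L \<Longrightarrow> P0 x $ j = x $ j" for x j
    by (simp add: P0_def axis_def)
  have P0_id: "x $ L = 0 \<Longrightarrow> P0 x = x" for x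
    by (simp add: P0_def)
  have P0_axis [simp]: "P0 (axis L 1) = 0"
    by (simp add: P0_def)
  have inner_P0: "x \<bullet> y = P0 x \<bullet> y" if "y $ L = 0" for x y
    using that by (simp add: P0_def inner_simps inner_axis')
  \<comment> \<open>The coordinate of \<open>w\<close> along \<open>std_Wminus\<close>. Pairing with
    \<open>std_Wplus\<close> sees nothing else, so transversality makes \<phi> injective on
    \<open>Wm\<close>.\<close>
  define \<phi> :: "'n vec2n \<Rightarrow> (real, 'n) vec" where "\<phi> w = P0 ((1/2) *\<^sub>R (pos w - neg w))" for w
  have linear_\<phi>: "linear \<phi>"
    unfolding \<phi>_def
    by (intro linear_compose[OF _ linear_P0, unfolded o_def] linear_compose_scale_right linear_compose_sub
        linear_pos linear_neg)
  have "w = 0" if "w \<in> Wm" "\<phi> w = 0" for w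
  proof -
    have "form w v = 0" if "v \<in> std_Wplus" for v
    proof -
      have v: "neg v = pos v" "pos v $ L = 0"
        using that by (auto simp: std_Wplus_iff L_def)
      have "form w v = 2 * (((1/2) *\<^sub>R (pos w - neg w)) \<bullet> pos v)"
        by (simp add: form_eq v inner_simps)
      also have "\<dots> = 2 * (\<phi> w \<bullet> pos v)"
        unfolding \<phi>_def using inner_P0[OF v(2)] by simp
      finally show ?thesis
        using \<open>\<phi> w = 0\<close> by simp
    qed
    then show ?thesis
      using trans \<open>w \<in> Wm\<close> by (auto simp: perp_def)
  qed
  then have inj: "inj_on \<phi> Wm"
    using linear_injective_on_subspace_0[OF linear_\<phi> isotropic_subspace[OF iso]] by blast
  then obtain g where g: "g ` UNIV \<subseteq> Wm" "linear g" "\<And>w. w \<in> Wm \<Longrightarrow> g (\<phi> w) = w"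
    using linear_exists_left_inverse_on[OF linear_\<phi> isotropic_subspace[OF iso]] by blast
  have "\<phi> ` Wm = {x. x $ L = 0}"
  proof (rule subspace_dim_equal)
    show "subspace (\<phi> ` Wm)"
      by (rule linear_subspace_image[OF linear_\<phi> isotropic_subspace[OF iso]])
    show "subspace {x :: (real, 'n) vec. x $ L = 0}"
      by (auto simp: subspace_def)
    show "\<phi> ` Wm \<subseteq> {x. x $ L = 0}"
      by (auto simp: \<phi>_def)
    have "dim (\<phi> ` Wm) = dim Wm"
      using inj by (intro dim_image_eq[OF linear_\<phi>]) (simp add: isotropic_span[OF iso])
    then show "dim {x :: (real, 'n) vec. x $ L = 0} \<le> dim (\<phi> ` Wm)"
      by (simp add: dim_coordinate_zero dim)
  qed
  then have \<phi>g: "\<phi> (g x) = x" if "x $ L = 0" for x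
    using g(3) that by (metis (mono_tags, lifting) imageE mem_Collect_eq)
  \<comment> \<open>\<open>Wm\<close> is a graph over \<open>std_Wminus\<close>: \<tau> x is its
    point over join (P0 x) (- P0 x), and \<open>a\<close> and \<open>b\<close> below are the
    remaining coordinates along e_n and \<open>std_Wplus\<close>.\<close>
  define \<tau> where "\<tau> x = g (P0 x)" for x
  have linear_\<tau>: "linear \<tau>"
    unfolding \<tau>_def by (rule linear_compose[OF linear_P0 g(2), unfolded o_def])
  have \<tau>_mem: "\<tau> x \<in> Wm" for x
    using g(1) by (auto simp: \<tau>_def)
  define a where "a x = \<tau> x $ Inl L" for x
  define b where "b x = P0 ((1/2) *\<^sub>R (pos (\<tau> x) + neg (\<tau> x)))" for x
  have linear_a: "linear a"
    using linear_\<tau> by (auto simp: a_def linear_iff)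
  have linear_b: "linear b"
    unfolding b_def
    by (intro linear_compose[OF _ linear_P0, unfolded o_def] linear_compose_scale_right linear_compose_add
        linear_compose[OF linear_\<tau> linear_pos, unfolded o_def] linear_compose[OF linear_\<tau> linear_neg, unfolded o_def])
  define \<alpha> where "\<alpha> = adjoint a 1"
  have a_eq: "a x = x \<bullet> \<alpha>" for x
    using adjoint_works[OF linear_a, of x 1] by (simp add: \<alpha>_def)
  have "\<alpha> $ L = a (axis L 1)"
    by (simp add: a_eq inner_axis')
  then have \<alpha>_L: "\<alpha> $ L = 0"
    using linear_0[OF g(2)] by (simp add: a_def \<tau>_def)
  have b_L [simp]: "b x $ L = 0" for x
    by (simp add: b_def)
  have \<tau>_eq: "\<tau> x = join (P0 x) (- P0 x) + a x *\<^sub>R e_pos L + join (b x) (b x)" for x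
  proof -
    have \<phi>: "\<phi> (\<tau> x) = P0 x"
      by (simp add: \<tau>_def \<phi>g)
    have "\<tau> x $ Inl j = P0 x $ j + b x $ j \<and> \<tau> x $ Inr j = - P0 x $ j + b x $ j" if "j \<noteq> L" for j
      unfolding \<phi>[symmetric] \<phi>_def b_def P0_nth[OF that] by (simp add: field_simps)
    moreover have "\<tau> x $ Inr L = 0"
      using subsetD[OF odd \<tau>_mem] by (simp add: mem_R_odd_iff L_def)
    moreover have "e_pos L $ Inl j = (if j = L then 1 else 0)" "e_pos L $ Inr j = (0::real)" for j
      by (auto simp: e_pos_def axis_def)
    ultimately have "\<tau> x $ Inl j = P0 x $ j + a x * e_pos L $ Inl j + b x $ j \<and>
        \<tau> x $ Inr j = - P0 x $ j + a x * e_pos L $ Inr j + b x $ j" for j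
      by (cases "j = L") (simp_all add: a_def)
    then show ?thesis
      unfolding vec2n_eq_iff by simp
  qed
  \<comment> \<open>Isotropy of \<open>Wm\<close> is exactly the identity that makes u s an isometry
    for every s: it cancels the coefficient of s^2.\<close>
  have quad: "(a x)\<^sup>2 + 4 * (x \<bullet> b x) = 0" for x
  proof -
    have "form (\<tau> x) (\<tau> x) = 0"
      using iso \<tau>_mem[of x] unfolding isotropic_def by blast
    moreover have "form (\<tau> x) (\<tau> x) = (a x)\<^sup>2 + 4 * (P0 x \<bullet> b x)"
      unfolding \<tau>_eq
      by (simp add: form_eq pos_add neg_add pos_scaleR neg_scaleR inner_simps inner_axis inner_axis'
          power2_eq_square inner_commute)
    ultimately show ?thesis
      by (simp add: inner_P0[of "b x" x])
  qed
  define m :: "'n vec2n \<Rightarrow> (real, 'n) vec" where "m v = (1/2) *\<^sub>R (pos v - neg v)" for v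
  have linear_m: "linear m"
    unfolding m_def by (intro linear_compose_scale_right linear_compose_sub linear_pos linear_neg)
  \<comment> \<open>\<open>f1\<close> moves one step along the chain \<open>std_Wminus\<close>, line
    of e_n, \<open>std_Wplus\<close>; its \<alpha> term is what makes it skew for the form.
    \<open>f2\<close> goes from \<open>std_Wminus\<close> to \<open>std_Wplus\<close> at once. Hence
    the weights s and s^2.\<close>
  define f1 :: "'n vec2n \<Rightarrow> 'n vec2n"
    where "f1 v = a (m v) *\<^sub>R e_pos L - (v $ Inl L / 2) *\<^sub>R join \<alpha> \<alpha>" for v
  define f2 :: "'n vec2n \<Rightarrow> 'n vec2n" where "f2 v = join (b (m v)) (b (m v))" for v
  have linear_f1: "linear f1"
    by (auto simp: linear_iff f1_def linear_add[OF linear_m] linear_scale[OF linear_m]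
        linear_add[OF linear_a] linear_scale[OF linear_a] algebra_simps add_divide_distrib)
  have linear_f2: "linear f2"
    by (auto simp: linear_iff f2_def linear_add[OF linear_m] linear_scale[OF linear_m]
        linear_add[OF linear_b] linear_scale[OF linear_b] join_add join_scaleR)
  define u where "u s = mat 1 + s *\<^sub>R matrix f1 + s\<^sup>2 *\<^sub>R matrix f2" for s :: real
  have u: "u s *v v = v + s *\<^sub>R f1 v + s\<^sup>2 *\<^sub>R f2 v" for s v
    by (simp add: u_def matrix_vector_mult_add_rdistrib matrix_works linear_f1 linear_f2
        flip: scaleR_matrix_vector_assoc)
  have form_join: "form v (join y y) = 2 * (m v \<bullet> y)" for v y
    by (simp add: form_eq m_def inner_simps)
  have f1: "form v (f1 v) = 0" "form (f1 v) (f1 v) = (a (m v))\<^sup>2" for v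
  proof -
    have "form v (e_pos L) = v $ Inl L" "form v (join \<alpha> \<alpha>) = 2 * a (m v)"
      by (simp_all add: form_e_pos form_join a_eq)
    then show "form v (f1 v) = 0"
      by (simp add: f1_def form_diff_right form_scaleR_right)
    have "form (e_pos L) (e_pos L) = 1" "form (e_pos L) (join \<alpha> \<alpha>) = 0"
      "form (join \<alpha> \<alpha>) (e_pos L) = 0" "form (join \<alpha> \<alpha>) (join \<alpha> \<alpha>) = 0"
      by (simp_all add: form_eq inner_axis inner_axis' \<alpha>_L)
    then show "form (f1 v) (f1 v) = (a (m v))\<^sup>2"
      by (simp add: f1_def form_diff_left form_diff_right form_scaleR_left form_scaleR_right power2_eq_square)
  qed
  have f2: "form v (f2 v) = 2 * (m v \<bullet> b (m v))" "form (f2 v) (f2 v) = 0" "form (f1 v) (f2 v) = 0" for v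
  proof -
    show "form v (f2 v) = 2 * (m v \<bullet> b (m v))"
      by (simp add: f2_def form_join)
    show "form (f2 v) (f2 v) = 0"
      by (simp add: f2_def form_eq)
    show "form (f1 v) (f2 v) = 0"
      by (simp add: f1_def f2_def form_diff_left form_scaleR_left)
        (simp add: form_eq inner_axis')
  qed
  have "form (u s *v v) (u s *v v) = form v v" for s v
  proof -
    have "form (u s *v v) (u s *v v) = form v v + s\<^sup>2 * ((a (m v))\<^sup>2 + 4 * (m v \<bullet> b (m v)))"
      unfolding u
      by (simp add: form_add_left form_add_right form_scaleR_left form_scaleR_right f1 f2
          form_commute[of "f1 v" v] form_commute[of "f2 v" v] form_commute[of "f2 v" "f1 v"]
          power2_eq_square algebra_simps)
    then show ?thesis
      by (simp add: quad)
  qed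
  then have iso_u: "form_isometry (u s)" for s
    by (rule form_isometry_quadratic)
  have "u 1 \<in> SO0_nn"
  proof -
    have "continuous_on {0..1} u"
      unfolding u_def by (intro continuous_intros)
    then have "connected (u ` {0..1})"
      by (rule connected_continuous_image) simp
    moreover have "mat 1 \<in> u ` {0..1}"
      by (rule image_eqI[of _ _ 0]) (auto simp: u_def)
    ultimately have "u ` {0..1} \<subseteq> SO0_nn"
      using iso_u by (intro connected_isometries_subset_SO0) auto
    then show ?thesis
      by auto
  qed
  \<comment> \<open>\<open>m\<close> does not kill this vector, but gives a multiple of the last
    axis, which \<open>P0\<close> removes inside \<tau>.\<close>
  moreover have "u 1 *v e_neg last_ix = e_neg last_ix"
  proof -
    have "m (e_neg L) = (- 1/2) *\<^sub>R axis L 1"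
      by (simp add: m_def)
    then have "P0 (m (e_neg L)) = 0"
      by (simp only: linear_scale[OF linear_P0] P0_axis scaleR_zero_right)
    then have "a (m (e_neg L)) = 0" "b (m (e_neg L)) = 0"
      using linear_0[OF g(2)] linear_0[OF linear_P0] by (simp_all add: a_def b_def \<tau>_def pos_0 neg_0)
    then show ?thesis
      by (simp add: u f1_def f2_def flip: L_def) (simp add: e_neg_def axis_def)
  qed
  ultimately have "u 1 \<in> G0"
    by (simp add: G0_def)
  moreover have "u 1 *v v = v" if "v \<in> std_Wplus" for v
  proof -
    have "m v = 0" "v $ Inl L = 0"
      using that by (auto simp: std_Wplus_iff m_def L_def)
    then show ?thesis
      by (simp add: u f1_def f2_def linear_0[OF linear_a] linear_0[OF linear_b])
  qed
  then have "(*v) (u 1) ` std_Wplus = std_Wplus"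
    by auto
  moreover have "(*v) (u 1) ` std_Wminus = Wm"
  proof (rule subspace_dim_equal)
    show "subspace ((*v) (u 1) ` std_Wminus)"
      by (intro isotropic_subspace isotropic_image iso_u isotropic_std_Wminus)
    show "subspace Wm"
      by (rule isotropic_subspace[OF iso])
    show "dim Wm \<le> dim ((*v) (u 1) ` std_Wminus)"
      by (simp add: dim_image_isometry[OF iso_u] dim_std_Wminus dim)
    show "(*v) (u 1) ` std_Wminus \<subseteq> Wm"
    proof safe
      fix v :: "'n vec2n" assume "v \<in> std_Wminus"
      then have v: "neg v = - pos v" "pos v $ L = 0"
        by (auto simp: std_Wminus_iff L_def)
      then have "m v = pos v"
        by (simp add: m_def scaleR_2[symmetric])
      have "u 1 *v v = v + a (pos v) *\<^sub>R e_pos L + join (b (pos v)) (b (pos v))"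
        using v by (simp add: u f1_def f2_def \<open>m v = pos v\<close>)
      also have "\<dots> = \<tau> (pos v)"
        unfolding \<tau>_eq P0_id[OF v(2)] using join_pos_neg[of v] by (simp add: v(1))
      finally show "u 1 *v v \<in> Wm"
        using \<tau>_mem by simp
    qed
  qed
  ultimately show thesis
    by (rule that)
qed

lemma G0_isometry: "k \<in> G0 \<Longrightarrow> form_isometry k"
  by (auto simp: G0_def SO0_nn_isometry)

lemma G0_mult: "k \<in> G0 \<Longrightarrow> l \<in> G0 \<Longrightarrow> k ** l \<in> G0"
  by (auto simp: G0_def SO0_nn_mult simp flip: matrix_vector_mul_assoc)

lemma G0_R_odd_iff:
  assumes "k \<in> G0"
  shows "k *v v \<in> R_odd \<longleftrightarrow> v \<in> R_odd"
proof -
  have "form (k *v v) (e_neg last_ix) = form v (e_neg last_ix)"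
    using assms form_isometryD[OF G0_isometry[OF assms], of v "e_neg last_ix"] by (simp add: G0_def)
  then show ?thesis
    by (simp add: R_odd_eq_perp perp_def)
qed

text \<open>A rotation of the positive part carries \<open>std_Wplus\<close> to \<open>Wp\<close>;
  the dimension n - 1 leaves room to choose its determinant 1. After pulling \<open>Wm\<close> back,
  the unipotent isometry moves \<open>std_Wminus\<close> without disturbing
  \<open>std_Wplus\<close>.\<close>

lemma G0_transitive:
  fixes Wp Wm :: "'n::{finite,linorder} vec2n set"
  assumes p: "isotropic Wp" "Wp \<subseteq> R_odd" "dim Wp = CARD('n) - 1"
    and m: "isotropic Wm" "Wm \<subseteq> R_odd" "dim Wm = CARD('n) - 1"
    and trans: "Wm \<inter> perp Wp \<subseteq> {0}"
  obtains k where "k \<in> G0" "(*v) k ` std_Wplus = Wp" "(*v) k ` std_Wminus = Wm"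
proof -
  have "dim Wp < CARD('n)"
    using p(3) by (simp add: card_gt_0_iff)
  then obtain Q where Q: "orthogonal_matrix Q" "det Q = 1" "Wp \<subseteq> graph Q"
    by (rule isotropic_subset_rotation_graph[OF p(1)])
  define c c' where "c = pos_block (transpose Q)" and "c' = pos_block Q"
  have QQ: "Q ** transpose Q = mat 1" "transpose Q ** Q = mat 1"
    using Q by (auto simp: orthogonal_matrix_def)
  have cc': "c ** c' = mat 1" "c' ** c = mat 1"
    by (simp_all add: c_def c'_def QQ pos_block_1 flip: pos_block_mul)
  have c: "c \<in> G0" "c' \<in> G0"
    using pos_block_rotation[OF Q(1,2)] pos_block_rotation[of "transpose Q"] Q
    by (auto simp: G0_def c_def c'_def orthogonal_matrix_transpose pos_block_mult join_e_neg)
  note iso_c = G0_isometry[OF c(1)] and iso_c' = G0_isometry[OF c(2)]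
  have cc'_apply: "c *v (c' *v v) = v" "c' *v (c *v v) = v" for v
    by (simp_all add: matrix_vector_mul_assoc cc')
  have Wp: "(*v) c ` std_Wplus = Wp"
  proof -
    have "Wp \<subseteq> (*v) c ` std_Wplus"
    proof
      fix w assume w: "w \<in> Wp"
      then have "neg w = Q *v pos w" "neg w $ last_ix = 0"
        using Q(3) p(2) by (auto simp: mem_graph_iff mem_R_odd_iff)
      then have "c *v join (neg w) (neg w) = w"
        unfolding c_def pos_block_mult pos_join neg_join
        by (metis QQ(2) join_pos_neg matrix_vector_mul_assoc matrix_vector_mul_lid)
      moreover have "join (neg w) (neg w) \<in> std_Wplus"
        using \<open>neg w $ last_ix = 0\<close> by (rule join_std_Wplus)
      ultimately show "w \<in> (*v) c ` std_Wplus"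
        by (metis imageI)
    qed
    then have "Wp = (*v) c ` std_Wplus"
      by (intro subspace_dim_equal isotropic_subspace p(1) isotropic_image iso_c isotropic_std_Wplus)
        (simp_all add: dim_image_isometry[OF iso_c] dim_std_Wplus p(3))
    then show ?thesis ..
  qed
  define Wm' where "Wm' = (*v) c' ` Wm"
  have "Wm' \<inter> perp std_Wplus \<subseteq> {0}"
  proof safe
    fix v assume v: "v \<in> Wm'" "v \<in> perp std_Wplus"
    have "c *v v \<in> Wm"
      using v(1) by (auto simp: Wm'_def cc'_apply)
    moreover have "c *v v \<in> perp Wp"
      using v(2) by (auto simp: Wp[symmetric] perp_def form_isometryD[OF iso_c])
    ultimately have "c *v v = 0"
      using trans by auto
    then show "v = 0"
      by (rule form_isometry_inj[OF iso_c])
  qed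
  moreover have "isotropic Wm'" "dim Wm' = CARD('n) - 1" "Wm' \<subseteq> R_odd"
    unfolding Wm'_def using m c(2)
    by (auto simp: isotropic_image[OF iso_c'] dim_image_isometry[OF iso_c'] G0_R_odd_iff)
  ultimately obtain u where u: "u \<in> G0" "(*v) u ` std_Wplus = std_Wplus" "(*v) u ` std_Wminus = Wm'"
    using std_Wminus_transitive by metis
  have im: "(*v) (c ** u) ` X = (*v) c ` ((*v) u ` X)" for X
    by (auto simp: image_image matrix_vector_mul_assoc)
  have "(*v) c ` Wm' = Wm"
    by (simp add: Wm'_def image_image cc'_apply)
  then show thesis
    using that[of "c ** u"] c(1) u by (simp add: im Wp G0_mult)
qed

text \<open>The images of e_n + e_{2n} lie in the same rotation graph, and e_{2n} is fixed, so the
  difference \<open>d\<close> lies in the image of \<open>std_Vplus\<close> and in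
  \<open>R_odd\<close>, that is, in the image of \<open>std_Wplus\<close>. It is also orthogonal to
  the image of \<open>std_Wminus\<close>, which pairs nondegenerately with that of
  \<open>std_Wplus\<close>.\<close>

lemma neutral_vec_unique:
  fixes k k' :: "'n::{finite,linorder} mat2n"
  assumes k: "k \<in> G0" and k': "k' \<in> G0"
    and p: "(*v) k ` std_Wplus = (*v) k' ` std_Wplus"
    and m: "(*v) k ` std_Wminus = (*v) k' ` std_Wminus"
  shows "k *v e_pos last_ix = k' *v e_pos last_ix"
proof -
  let ?e = "e_neg last_ix :: 'n vec2n"
  have SO0: "k \<in> SO0_nn" "k' \<in> SO0_nn" and fix_e: "k *v ?e = ?e" "k' *v ?e = ?e"
    using k k' by (auto simp: G0_def)
  note iso = G0_isometry[OF k] and iso' = G0_isometry[OF k']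
  obtain Q where Q: "orthogonal_matrix Q" "det Q = 1" "(*v) k ` std_Vplus = graph Q"
    using SO0_orbit_std_Vplus[OF SO0(1)] .
  obtain Q' where Q': "orthogonal_matrix Q'" "det Q' = 1" "(*v) k' ` std_Vplus = graph Q'"
    using SO0_orbit_std_Vplus[OF SO0(2)] .
  have WV: "std_Wplus \<subseteq> (std_Vplus :: 'n vec2n set)"
    by (auto simp: std_Vplus_eq mem_graph_iff std_Wplus_iff)
  have "Q = Q'"
  proof (rule rotation_graph_unique[OF _ _ Q(1,2) _ Q'(1,2)])
    show "isotropic ((*v) k ` std_Wplus)"
      by (intro isotropic_image iso isotropic_std_Wplus)
    show "CARD('n) \<le> Suc (dim ((*v) k ` std_Wplus))"
      by (simp add: dim_image_isometry[OF iso] dim_std_Wplus)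
    show "(*v) k ` std_Wplus \<subseteq> graph Q"
      using WV Q(3) by blast
    show "(*v) k ` std_Wplus \<subseteq> graph Q'"
      unfolding p using WV Q'(3) by blast
  qed
  define d where "d = k *v e_pos last_ix - k' *v e_pos last_ix"
  have ee: "e_pos last_ix + ?e \<in> std_Vplus"
    by (simp add: std_Vplus_eq mem_graph_iff pos_add neg_add)
  then have "k *v (e_pos last_ix + ?e) \<in> graph Q" "k' *v (e_pos last_ix + ?e) \<in> graph Q"
    using Q Q' \<open>Q = Q'\<close> by auto
  then have "k *v (e_pos last_ix + ?e) - k' *v (e_pos last_ix + ?e) \<in> graph Q"
    by (intro subspace_diff isotropic_subspace isotropic_graph Q)
  then have "d \<in> (*v) k ` std_Vplus"
    by (simp add: d_def Q(3) matrix_vector_right_distrib fix_e)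
  then obtain x where x: "x \<in> std_Vplus" "d = k *v x"
    by blast
  have odd: "e_pos last_ix \<in> (R_odd :: 'n vec2n set)"
    by (simp add: mem_R_odd_iff e_pos_def axis_def)
  then have "d \<in> R_odd"
    unfolding d_def using k k' by (intro subspace_diff subspace_R_odd) (auto simp: G0_R_odd_iff)
  then have "x \<in> R_odd"
    using G0_R_odd_iff[OF k] x by simp
  define q where "q = pos x"
  have x_eq: "x = join q q"
    using x(1) join_pos_neg[of x] by (simp add: std_Vplus_eq mem_graph_iff q_def)
  then have q_last: "q $ last_ix = 0"
    using \<open>x \<in> R_odd\<close> by (simp add: mem_R_odd_iff)
  have e_m: "form (e_pos last_ix) w = 0" if "w \<in> std_Wminus" for w :: "'n vec2n"
    using that by (simp add: form_commute[of "e_pos last_ix"] form_e_pos std_Wminus_iff)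
  have "join q (- q) \<in> std_Wminus"
    using q_last by (rule join_std_Wminus)
  then obtain w' where w': "w' \<in> std_Wminus" "k *v join q (- q) = k' *v w'"
    using m by blast
  have "form d (k *v join q (- q)) = form (e_pos last_ix) (join q (- q)) - form (e_pos last_ix) w'"
    by (simp add: d_def form_diff_left form_isometryD[OF iso]) (simp add: w'(2) form_isometryD[OF iso'])
  then have "form d (k *v join q (- q)) = 0"
    using e_m w'(1) \<open>join q (- q) \<in> std_Wminus\<close> by simp
  then have "form (join q q) (join q (- q)) = 0"
    by (simp add: x x_eq form_isometryD[OF iso])
  then have "q = 0"
    by (simp add: form_eq)
  then have "d = 0"
    by (simp add: x x_eq)
  then show ?thesis
    by (simp add: d_def)
qed

lemma neutral_vec_eq:
  assumes "k \<in> G0" "(*v) k ` std_Wplus = hyp_Wplus h" "(*v) k ` std_Wminus = hyp_Wminus h"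
  shows "neutral_vec h = k *v e_pos last_ix"
  unfolding neutral_vec_def
proof (rule the_equality)
  show "\<exists>k'\<in>G0. (*v) k' ` std_Wplus = hyp_Wplus h \<and> (*v) k' ` std_Wminus = hyp_Wminus h
      \<and> k *v e_pos last_ix = k' *v e_pos last_ix"
    using assms by blast
qed (use assms neutral_vec_unique in metis)

subsection \<open>Structure of pseudo-hyperbolic isometries\<close>

text \<open>Off 0, \<open>S'\<close> is the complement of the inverses of \<open>S\<close>. Then no
  product of roots is 1, which gives one inclusion; for the other, the component of \<open>v\<close>
  with roots outside \<open>S'\<close> turns out to be orthogonal to both halves of the
  space.\<close>

lemma perp_real_root_space:
  assumes A: "form_isometry A" and cnj: "cnj ` S \<subseteq> S" "cnj ` S' \<subseteq> S'"
    and inv: "\<And>\<mu> \<nu>. \<mu> * \<nu> = 1 \<Longrightarrow> \<mu> \<in> S \<longleftrightarrow> \<nu> \<notin> S'"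
  shows "perp (real_root_space A S) = real_root_space A S'"
proof
  let ?E = "real_root_space A"
  have inv': "\<nu> \<in> S \<longleftrightarrow> \<mu> \<notin> S'" if "\<mu> * \<nu> = 1" for \<mu> \<nu>
    using inv that by (metis mult.commute)
  show "?E S' \<subseteq> perp (?E S)"
  proof
    fix v assume v: "v \<in> ?E S'"
    have "form v w = 0" if w: "w \<in> ?E S" for w
      by (rule form_real_root_space_eq_0[OF A v w]) (use inv' in auto)
    then show "v \<in> perp (?E S)"
      by (simp add: perp_def)
  qed
  show "perp (?E S) \<subseteq> ?E S'"
  proof
    fix v assume v: "v \<in> perp (?E S)"
    have cnj_compl: "cnj ` (- C) \<subseteq> - C" if "cnj ` C \<subseteq> C" for C
      using that by (auto simp: image_subset_iff)
    have UNIV: "w \<in> ?E (C \<union> - C)" for w C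
      by (simp add: real_root_space_UNIV)
    obtain x y where xy: "x \<in> ?E S'" "y \<in> ?E (- S')" "v = x + y"
      using real_root_space_Un[OF UNIV cnj(2) cnj_compl[OF cnj(2)]] .
    have "form y w = 0" for w
    proof -
      obtain p q where pq: "p \<in> ?E S" "q \<in> ?E (- S)" "w = p + q"
        using real_root_space_Un[OF UNIV cnj(1) cnj_compl[OF cnj(1)]] .
      have "form x p = 0"
        by (rule form_real_root_space_eq_0[OF A xy(1) pq(1)]) (use inv' in auto)
      moreover have "form v p = 0"
        using v pq by (auto simp: perp_def)
      moreover have "form y q = 0"
        by (rule form_real_root_space_eq_0[OF A xy(2) pq(2)]) (use inv' in auto)
      ultimately show ?thesis
        using xy pq by (simp add: form_add_left form_add_right)
    qed
    then have "y = 0"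
      by (rule form_nondegenerate)
    then show "v \<in> ?E S'"
      using xy by simp
  qed
qed

lemma mult_eq_1_norm: "\<mu> * \<nu> = 1 \<Longrightarrow> cmod \<nu> = inverse (cmod \<mu>)" for \<mu> \<nu> :: complex
  by (metis inverse_unique norm_inverse)

lemma perp_root_space_gt:
  assumes "form_isometry A" "0 < r"
  shows "perp (real_root_space A {\<mu>. r < cmod \<mu>}) = real_root_space A {\<mu>. inverse r \<le> cmod \<mu>}"
proof (rule perp_real_root_space[OF assms(1)])
  show "\<mu> \<in> {\<mu>. r < cmod \<mu>} \<longleftrightarrow> \<nu> \<notin> {\<mu>. inverse r \<le> cmod \<mu>}" if "\<mu> * \<nu> = 1" for \<mu> \<nu>
  proof -
    have "0 < cmod \<mu>"
      using that by auto
    then show ?thesis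
      using mult_eq_1_norm[OF that] assms(2) by (simp add: not_le inverse_less_iff_less)
  qed
qed auto

lemma perp_root_space_lt:
  assumes "form_isometry A" "0 < r"
  shows "perp (real_root_space A {\<mu>. cmod \<mu> < inverse r}) = real_root_space A {\<mu>. cmod \<mu> \<le> r}"
proof (rule perp_real_root_space[OF assms(1)])
  show "\<mu> \<in> {\<mu>. cmod \<mu> < inverse r} \<longleftrightarrow> \<nu> \<notin> {\<mu>. cmod \<mu> \<le> r}" if "\<mu> * \<nu> = 1" for \<mu> \<nu>
  proof -
    have "0 < cmod \<nu>" "\<nu> * \<mu> = 1"
      using that by (auto simp: mult.commute)
    then show ?thesis
      using mult_eq_1_norm[of \<nu> \<mu>] assms(2) by (simp add: not_le inverse_less_iff_less)
  qed
qed auto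

lemma isotropic_root_space_gt:
  assumes "form_isometry A" "1 \<le> r"
  shows "isotropic (real_root_space A {\<mu>. r < cmod \<mu>})"
proof -
  have "inverse r \<le> r"
    using assms(2) by (meson inverse_le_1_iff order_trans)
  then have "real_root_space A {\<mu>. r < cmod \<mu>} \<subseteq> perp (real_root_space A {\<mu>. r < cmod \<mu>})"
    using assms(2) by (subst perp_root_space_gt[OF assms(1)]) (auto intro: real_root_space_mono[THEN subsetD, rotated])
  then show ?thesis
    by (auto simp: isotropic_def perp_def subspace_real_root_space)
qed

lemma isotropic_root_space_lt:
  assumes "form_isometry A" "1 \<le> r"
  shows "isotropic (real_root_space A {\<mu>. cmod \<mu> < inverse r})"
proof -
  have "inverse r \<le> r"
    using assms(2) by (meson inverse_le_1_iff order_trans)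
  then have "real_root_space A {\<mu>. cmod \<mu> < inverse r} \<subseteq> perp (real_root_space A {\<mu>. cmod \<mu> < inverse r})"
    using assms(2) by (subst perp_root_space_lt[OF assms(1)]) (auto intro: real_root_space_mono[THEN subsetD, rotated])
  then show ?thesis
    by (auto simp: isotropic_def perp_def subspace_real_root_space)
qed

lemma dim_root_space_split:
  fixes A :: "real^'i^'i"
  assumes "1 \<le> r"
  shows "dim (real_root_space A {\<mu>. r < cmod \<mu>}) + dim (real_root_space A {\<mu>. inverse r \<le> cmod \<mu> \<and> cmod \<mu> \<le> r})
    + dim (real_root_space A {\<mu>. cmod \<mu> < inverse r}) = CARD('i)"
proof -
  let ?S1 = "{\<mu>. r < cmod \<mu>}" and ?S2 = "{\<mu>. inverse r \<le> cmod \<mu> \<and> cmod \<mu> \<le> r}"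
    and ?S3 = "{\<mu>. cmod \<mu> < inverse r}"
  have "inverse r \<le> r"
    using assms by (meson inverse_le_1_iff order_trans)
  then have "(?S1 \<union> ?S2) \<union> ?S3 = UNIV" "?S1 \<inter> ?S2 = {}" "(?S1 \<union> ?S2) \<inter> ?S3 = {}"
    by auto
  moreover have cnj: "cnj ` ?S1 \<subseteq> ?S1" "cnj ` ?S2 \<subseteq> ?S2" "cnj ` ?S3 \<subseteq> ?S3" "cnj ` (?S1 \<union> ?S2) \<subseteq> ?S1 \<union> ?S2"
    by auto
  ultimately have "dim (real_root_space A (?S1 \<union> ?S2)) + dim (real_root_space A ?S3) = CARD('i)"
    using dim_real_root_space_Un[of "?S1 \<union> ?S2" ?S3 A] by (simp only: real_root_space_UNIV dim_UNIV) simp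
  then show ?thesis
    using dim_real_root_space_Un[OF \<open>?S1 \<inter> ?S2 = {}\<close> cnj(1,2), of A] by simp
qed

lemma hyp_Wminus_eq: "hyp_Wminus h = R_odd \<inter> real_root_space h {\<mu>. cmod \<mu> < 1}"
  by (auto simp: hyp_Wminus_def real_root_space_lt_1_iff)

lemma hyp_Wplus_eq:
  assumes "form_isometry h"
  shows "hyp_Wplus h = R_odd \<inter> real_root_space h {\<mu>. 1 < cmod \<mu>}"
  unfolding real_root_space_inverse[OF form_isometry_matrix_inv[OF assms], symmetric]
  by (auto simp: hyp_Wplus_def real_root_space_lt_1_iff)

lemma dim_R_odd: "dim (R_odd :: 'n::{finite,linorder} vec2n set) = 2 * CARD('n) - 1"
proof -
  have "R_odd = {v :: 'n vec2n. axis (Inr last_ix) 1 \<bullet> v = 0}"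
    by (auto simp: mem_R_odd_iff inner_axis')
  then show ?thesis
    using dim_hyperplane[of "axis (Inr last_ix) 1 :: 'n vec2n"] by (simp add: axis_eq_0_iff)
qed

text \<open>A dimension count: \<open>E2\<close> meets the hyperplane \<open>R_odd\<close> in a
  line, so has dimension at most 2, while \<open>E1\<close> and \<open>E3\<close> are isotropic in
  \<open>R_odd\<close>, so have dimension at most n - 1. The total 2n forces equality
  throughout.\<close>

lemma pseudo_hyperbolic_structure:
  fixes g :: "'n::{finite,linorder} mat2n"
  assumes g: "pseudo_hyperbolic g"
  defines "E1 \<equiv> real_root_space g {\<mu>. 1 < cmod \<mu>}" and "E3 \<equiv> real_root_space g {\<mu>. cmod \<mu> < 1}"
    and "E2 \<equiv> real_root_space g {\<mu>. cmod \<mu> = 1}" and "e \<equiv> e_neg last_ix"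
  obtains k where "k \<in> G0" "(*v) k ` std_Wplus = E1" "(*v) k ` std_Wminus = E3"
    "neutral_vec g = k *v e_pos last_ix" "g *v neutral_vec g = neutral_vec g"
    "\<And>x. x \<in> E2 \<Longrightarrow> \<exists>a b. x = a *\<^sub>R neutral_vec g + b *\<^sub>R e"
    "dim E1 = CARD('n) - 1" "dim E2 = 2" "dim E3 = CARD('n) - 1"
proof -
  have G0: "g \<in> G0" and dim1: "dim (spectral_sum g R_odd {\<mu>. cmod \<mu> = 1}) = 1"
    and no_minus: "\<And>v. v \<in> R_odd \<Longrightarrow> v \<noteq> 0 \<Longrightarrow> g *v v \<noteq> - v"
    using g by (auto simp: pseudo_hyperbolic_def)
  note iso = G0_isometry[OF G0]
  have ge: "g *v e = e"
    using G0 by (simp add: G0_def e_def)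
  then have e_E2: "e \<in> E2"
    unfolding E2_def by (intro real_root_space_eigenvector[of _ _ 1]) auto
  have odd: "g *v x \<in> R_odd" if "x \<in> R_odd" for x
    using G0_R_odd_iff[OF G0] that by simp
  have D: "dim (R_odd \<inter> E2) = 1"
    using dim1 spectral_sum_eq[OF subspace_R_odd odd] by (simp add: E2_def)
  have perp1: "perp E1 = real_root_space g {\<mu>. 1 \<le> cmod \<mu>}"
    using perp_root_space_gt[OF iso, of 1] by (simp add: E1_def)
  have perp3: "perp E3 = real_root_space g {\<mu>. cmod \<mu> \<le> 1}"
    using perp_root_space_lt[OF iso, of 1] by (simp add: E3_def)
  have "{\<mu>. 1 \<le> cmod \<mu>} \<inter> {\<mu>. cmod \<mu> \<le> 1} = {\<mu>. cmod \<mu> = 1}"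
    by auto
  then have E2_eq: "perp E1 \<inter> perp E3 = E2"
    by (simp add: perp1 perp3 E2_def real_root_space_Int)
  have iso1: "isotropic E1" and iso3: "isotropic E3"
    using isotropic_root_space_gt[OF iso, of 1] isotropic_root_space_lt[OF iso, of 1]
    by (auto simp: E1_def E3_def)
  \<comment> \<open>e_{2n} lies in \<open>E2\<close>, which is orthogonal to \<open>E1\<close> and
    \<open>E3\<close>, and \<open>R_odd\<close> is its \<open>perp\<close>.\<close>
  have in_odd: "E1 \<subseteq> R_odd" "E3 \<subseteq> R_odd"
    using e_E2 E2_eq by (auto simp: R_odd_eq_perp perp_def form_commute e_def)
  have sub2: "subspace E2"
    by (simp add: E2_def subspace_real_root_space)
  have sum: "dim E1 + dim E2 + dim E3 = 2 * CARD('n)"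
  proof -
    have "{\<mu>. inverse 1 \<le> cmod \<mu> \<and> cmod \<mu> \<le> 1} = {\<mu>. cmod \<mu> = 1}"
      by auto
    then show ?thesis
      using dim_root_space_split[of 1 g] by (simp add: E1_def E2_def E3_def)
  qed
  have "dim E2 \<le> 2"
    using dim_sums_Int[OF subspace_R_odd sub2] D dim_R_odd[where 'n = 'n]
      dim_subset_UNIV[of "{x + y |x y. x \<in> (R_odd :: 'n vec2n set) \<and> y \<in> E2}"] by simp
  moreover have "dim E1 \<le> CARD('n) - 1" "dim E3 \<le> CARD('n) - 1"
    by (intro isotropic_R_odd_dim_le iso1 iso3 in_odd)+
  ultimately have dims: "dim E1 = CARD('n) - 1" "dim E3 = CARD('n) - 1" "dim E2 = 2"
    using sum zero_less_card_finite[where 'a = 'n] by linarith+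
  have "E3 \<inter> perp E1 \<subseteq> {0}"
  proof -
    have "{\<mu>. cmod \<mu> < 1} \<inter> {\<mu>. 1 \<le> cmod \<mu>} = {}"
      by auto
    then show ?thesis
      unfolding perp1 E3_def real_root_space_Int by (simp add: real_root_space_empty)
  qed
  then obtain k where k: "k \<in> G0" "(*v) k ` std_Wplus = E1" "(*v) k ` std_Wminus = E3"
    using G0_transitive[OF iso1 in_odd(1) dims(1) iso3 in_odd(2) dims(2)] by blast
  define v0 where "v0 = k *v e_pos last_ix"
  note iso_k = G0_isometry[OF k(1)]
  have neutral: "neutral_vec g = v0"
    unfolding v0_def using k in_odd hyp_Wplus_eq[OF iso] hyp_Wminus_eq[of g]
    by (intro neutral_vec_eq) (auto simp: E1_def E3_def)
  have v0_odd: "v0 \<in> R_odd"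
    unfolding v0_def G0_R_odd_iff[OF k(1)] by (simp add: mem_R_odd_iff e_pos_def axis_def)
  have "v0 \<in> perp E1" "v0 \<in> perp E3"
    by (auto simp: perp_def v0_def form_isometryD[OF iso_k] std_Wplus_iff std_Wminus_iff
        form_commute[of "e_pos _"] form_e_pos simp flip: k(2,3))
  then have v0_E2: "v0 \<in> E2"
    using E2_eq by auto
  have v0_form: "form v0 v0 = 1"
    by (simp add: v0_def form_isometryD[OF iso_k] form_e_pos) (simp add: e_pos_def)
  then have "v0 \<noteq> 0"
    by auto
  have sub: "subspace (R_odd \<inter> E2)"
    by (intro subspace_inter subspace_R_odd sub2)
  have "R_odd \<inter> E2 = span {v0}"
    using subspace_dim_equal[of "span {v0}" "R_odd \<inter> E2"] span_minimal[OF _ sub, of "{v0}"] sub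
      v0_odd v0_E2 D \<open>v0 \<noteq> 0\<close> by simp
  then have D_eq: "\<exists>c. x = c *\<^sub>R v0" if "x \<in> R_odd" "x \<in> E2" for x
    using that by (auto simp: span_singleton)
  obtain c where c: "g *v v0 = c *\<^sub>R v0"
    using D_eq[of "g *v v0"] odd[OF v0_odd] real_root_space_mult[of v0 g] v0_E2 by (auto simp: E2_def)
  then have "c * c = 1"
    using form_isometryD[OF iso, of v0 v0] by (simp add: v0_form form_scaleR_left form_scaleR_right)
  \<comment> \<open>Invariance of the form leaves the eigenvalues 1 and -1 on the neutral line; -1
    is excluded by pseudo-hyperbolicity.\<close>
  moreover have "c \<noteq> -1"
    using no_minus[OF v0_odd \<open>v0 \<noteq> 0\<close>] c by auto
  ultimately have "g *v v0 = v0"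
    using c by (simp add: square_eq_1_iff)
  moreover have "\<exists>a b. x = a *\<^sub>R v0 + b *\<^sub>R e" if "x \<in> E2" for x
  proof -
    define b where "b = x $ Inr last_ix"
    have "x - b *\<^sub>R e \<in> R_odd"
      by (simp add: mem_R_odd_iff b_def e_def e_neg_def)
    moreover have "x - b *\<^sub>R e \<in> E2"
      using that e_E2 sub2 by (intro subspace_diff subspace_scale)
    ultimately obtain a where "x - b *\<^sub>R e = a *\<^sub>R v0"
      using D_eq by blast
    then have "x = a *\<^sub>R v0 + b *\<^sub>R e"
      by (simp add: algebra_simps)
    then show ?thesis by blast
  qed
  ultimately show thesis
    using that[OF k] dims neutral v0_def by metis
qed

subsection \<open>Isometries close to a pseudo-hyperbolic one\<close>

lemma real_root_space_nested_eq:
  assumes "S \<inter> eigvals A \<subseteq> S' \<or> S' \<inter> eigvals A \<subseteq> S"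
    and "dim (real_root_space A S) = dim (real_root_space A S')"
  shows "real_root_space A S = real_root_space A S'"
proof -
  have "real_root_space A S \<subseteq> real_root_space A S' \<or> real_root_space A S' \<subseteq> real_root_space A S"
    using assms(1) real_root_space_mono[of _ _ A] by (metis real_root_space_Int_eigvals)
  then show ?thesis
    using subspace_dim_equal[OF subspace_real_root_space subspace_real_root_space] assms(2)
    by (metis order_refl)
qed

text \<open>Sets of eigenvalues cut off from below in modulus are nested. So the dimension n - 1
  determines the root space, although it need not determine a cutting radius, and the definite
  description has one solution.\<close>

lemma top_W_eq:
  fixes A :: "'n::finite mat2n"
  assumes A: "form_isometry A" and r: "1 \<le> r"
    and dim: "dim (real_root_space A {\<mu>. r < cmod \<mu>}) = CARD('n) - 1"
  shows "top_W A = real_root_space A {\<mu>. r < cmod \<mu>}"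
proof -
  let ?E = "real_root_space A" and ?S = "eigvals A \<inter> {\<mu>. r < cmod \<mu>}"
  have E: "?E {\<mu>. r < cmod \<mu>} = spectral_sum A UNIV ?S"
    using real_root_space_Int_eigvals[of A "{\<mu>. r < cmod \<mu>}"] by (simp add: spectral_sum_UNIV Int_commute)
  show ?thesis
    unfolding top_W_def
  proof (rule the_equality)
    have "\<forall>\<mu>\<in>?S. \<forall>\<nu>\<in>eigvals A - ?S. cmod \<nu> < cmod \<mu>"
      by auto
    then show "isotropic (?E {\<mu>. r < cmod \<mu>}) \<and> dim (?E {\<mu>. r < cmod \<mu>}) = CARD('n) - 1
        \<and> (*v) A ` ?E {\<mu>. r < cmod \<mu>} \<subseteq> ?E {\<mu>. r < cmod \<mu>}
        \<and> (\<exists>S\<subseteq>eigvals A. (\<forall>\<mu>\<in>S. \<forall>\<nu>\<in>eigvals A - S. cmod \<nu> < cmod \<mu>)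
            \<and> ?E {\<mu>. r < cmod \<mu>} = spectral_sum A UNIV S)"
      using isotropic_root_space_gt[OF A r] dim E real_root_space_mult[of _ A "{\<mu>. r < cmod \<mu>}"]
      by (intro conjI exI[of _ ?S]) (auto simp only:)
  next
    fix W assume W: "isotropic W \<and> dim W = CARD('n) - 1 \<and> (*v) A ` W \<subseteq> W
        \<and> (\<exists>S\<subseteq>eigvals A. (\<forall>\<mu>\<in>S. \<forall>\<nu>\<in>eigvals A - S. cmod \<nu> < cmod \<mu>) \<and> W = spectral_sum A UNIV S)"
    then obtain S where S: "S \<subseteq> eigvals A" "W = ?E S"
      and less: "\<forall>\<mu>\<in>S. \<forall>\<nu>\<in>eigvals A - S. cmod \<nu> < cmod \<mu>"
      unfolding spectral_sum_UNIV by (elim conjE exE)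
    have "S \<inter> eigvals A \<subseteq> {\<mu>. r < cmod \<mu>} \<or> {\<mu>. r < cmod \<mu>} \<inter> eigvals A \<subseteq> S"
    proof (rule ccontr)
      assume "\<not> ?thesis"
      then obtain \<mu> \<nu> where \<mu>\<nu>: "\<mu> \<in> S" "\<mu> \<notin> ?S" "\<nu> \<in> ?S" "\<nu> \<notin> S"
        by blast
      show False
        using bspec[OF bspec[OF less \<mu>\<nu>(1)], of \<nu>] S(1) \<mu>\<nu> by force
    qed
    then show "W = ?E {\<mu>. r < cmod \<mu>}"
      using W dim unfolding S(2) by (intro real_root_space_nested_eq) auto
  qed
qed

lemma bottom_W_eq:
  fixes A :: "'n::finite mat2n"
  assumes A: "form_isometry A" and r: "1 \<le> r"
    and dim: "dim (real_root_space A {\<mu>. cmod \<mu> < inverse r}) = CARD('n) - 1"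
  shows "bottom_W A = real_root_space A {\<mu>. cmod \<mu> < inverse r}"
proof -
  let ?E = "real_root_space A" and ?S = "eigvals A \<inter> {\<mu>. cmod \<mu> < inverse r}"
  have E: "?E {\<mu>. cmod \<mu> < inverse r} = spectral_sum A UNIV ?S"
    using real_root_space_Int_eigvals[of A "{\<mu>. cmod \<mu> < inverse r}"]
    by (simp add: spectral_sum_UNIV Int_commute)
  show ?thesis
    unfolding bottom_W_def
  proof (rule the_equality)
    have "\<forall>\<mu>\<in>?S. \<forall>\<nu>\<in>eigvals A - ?S. cmod \<mu> < cmod \<nu>"
      by auto
    then show "isotropic (?E {\<mu>. cmod \<mu> < inverse r}) \<and> dim (?E {\<mu>. cmod \<mu> < inverse r}) = CARD('n) - 1
        \<and> (*v) A ` ?E {\<mu>. cmod \<mu> < inverse r} \<subseteq> ?E {\<mu>. cmod \<mu> < inverse r}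
        \<and> (\<exists>S\<subseteq>eigvals A. (\<forall>\<mu>\<in>S. \<forall>\<nu>\<in>eigvals A - S. cmod \<mu> < cmod \<nu>)
            \<and> ?E {\<mu>. cmod \<mu> < inverse r} = spectral_sum A UNIV S)"
      using isotropic_root_space_lt[OF A r] dim E real_root_space_mult[of _ A "{\<mu>. cmod \<mu> < inverse r}"]
      by (intro conjI exI[of _ ?S]) (auto simp only:)
  next
    fix W assume W: "isotropic W \<and> dim W = CARD('n) - 1 \<and> (*v) A ` W \<subseteq> W
        \<and> (\<exists>S\<subseteq>eigvals A. (\<forall>\<mu>\<in>S. \<forall>\<nu>\<in>eigvals A - S. cmod \<mu> < cmod \<nu>) \<and> W = spectral_sum A UNIV S)"
    then obtain S where S: "S \<subseteq> eigvals A" "W = ?E S"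
      and less: "\<forall>\<mu>\<in>S. \<forall>\<nu>\<in>eigvals A - S. cmod \<mu> < cmod \<nu>"
      unfolding spectral_sum_UNIV by (elim conjE exE)
    have "S \<inter> eigvals A \<subseteq> {\<mu>. cmod \<mu> < inverse r} \<or> {\<mu>. cmod \<mu> < inverse r} \<inter> eigvals A \<subseteq> S"
    proof (rule ccontr)
      assume "\<not> ?thesis"
      then obtain \<mu> \<nu> where \<mu>\<nu>: "\<mu> \<in> S" "\<mu> \<notin> ?S" "\<nu> \<in> ?S" "\<nu> \<notin> S"
        by blast
      show False
        using bspec[OF bspec[OF less \<mu>\<nu>(1)], of \<nu>] S(1) \<mu>\<nu> by force
    qed
    then show "W = ?E {\<mu>. cmod \<mu> < inverse r}"
      using W dim unfolding S(2) by (intro real_root_space_nested_eq) auto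
  qed
qed

text \<open>The line is found by dimension: n + 1 and n in a space of dimension 2n meet at least in
  a line, and the intersection lies in the plane \<open>E2\<close>. A one-dimensional intersection
  makes the description of \<open>line_eigenvalue\<close> well defined.\<close>

lemma line_eigenvalue_vector:
  fixes A :: "'n::finite mat2n"
  assumes A: "A \<in> SO0_nn" and r: "1 \<le> r"
    and dim1: "dim (real_root_space A {\<mu>. r < cmod \<mu>}) = CARD('n) - 1"
    and dim3: "dim (real_root_space A {\<mu>. cmod \<mu> < inverse r}) = CARD('n) - 1"
  obtains Q x where "orthogonal_matrix Q" "det Q = 1"
    "graph Q \<subseteq> real_root_space A {\<mu>. inverse r \<le> cmod \<mu>}"
    "x \<in> graph Q" "x \<in> real_root_space A {\<mu>. inverse r \<le> cmod \<mu> \<and> cmod \<mu> \<le> r}"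
    "norm x = 1" "A *v x = line_eigenvalue A *\<^sub>R x"
proof -
  define E1 where "E1 = real_root_space A {\<mu>. r < cmod \<mu>}"
  define E2 where "E2 = real_root_space A {\<mu>. inverse r \<le> cmod \<mu> \<and> cmod \<mu> \<le> r}"
  define E3 where "E3 = real_root_space A {\<mu>. cmod \<mu> < inverse r}"
  have "0 < r"
    using r by simp
  note iso = SO0_nn_isometry[OF A]
  have top: "top_W A = E1" and bot: "bottom_W A = E3"
    using top_W_eq[OF iso r dim1] bottom_W_eq[OF iso r dim3] by (auto simp: E1_def E3_def)
  have iso1: "isotropic E1"
    using isotropic_root_space_gt[OF iso r] by (simp add: E1_def)
  have "0 < CARD('n)"
    by simp
  have "dim E1 < CARD('n)"
    using dim1 \<open>0 < CARD('n)\<close> unfolding E1_def by linarith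
  then obtain Q where Q: "orthogonal_matrix Q" "det Q = 1" "E1 \<subseteq> graph Q"
    by (rule isotropic_subset_rotation_graph[OF iso1])
  have topV: "top_V A = graph Q"
    using iso1 dim1 Q by (intro top_V_eq) (auto simp: top E1_def)
  have perp1: "perp E1 = real_root_space A {\<mu>. inverse r \<le> cmod \<mu>}"
    using perp_root_space_gt[OF iso \<open>0 < r\<close>] by (simp add: E1_def)
  have perp3: "perp E3 = real_root_space A {\<mu>. cmod \<mu> \<le> r}"
    using perp_root_space_lt[OF iso \<open>0 < r\<close>] by (simp add: E3_def)
  have E2_eq: "perp E1 \<inter> perp E3 = E2"
    by (simp add: perp1 perp3 E2_def real_root_space_Int Collect_conj_eq)
  have sub_perp1: "graph Q \<subseteq> perp E1"
    using Q(3) perp_graph[OF Q(1)] by (auto simp: perp_def)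
  have "(*v) A ` E1 = E1"
  proof (rule subspace_dim_equal)
    show "subspace ((*v) A ` E1)" "subspace E1"
      using iso1 by (auto intro!: isotropic_subspace isotropic_image iso)
    show "(*v) A ` E1 \<subseteq> E1"
      by (auto simp: E1_def real_root_space_mult)
    show "dim E1 \<le> dim ((*v) A ` E1)"
      by (simp add: dim_image_isometry[OF iso])
  qed
  define k where "k = pos_block (transpose Q)"
  have k: "k \<in> SO0_nn" "graph Q = (*v) k ` std_Vplus"
    using Q graph_eq_image[OF Q(1)] by (auto simp: k_def orthogonal_matrix_transpose intro!: pos_block_rotation)
  \<comment> \<open>\<open>A\<close> sends the graph to another rotation graph through
    \<open>E1\<close>, which must be the same one.\<close>
  obtain Q' where Q': "orthogonal_matrix Q'" "det Q' = 1" "(*v) (A ** k) ` std_Vplus = graph Q'"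
    using SO0_orbit_std_Vplus[OF SO0_nn_mult[OF A k(1)]] .
  have AQ: "(*v) A ` graph Q = graph Q'"
    unfolding Q'(3)[symmetric] k(2) by (simp add: image_image matrix_vector_mul_assoc)
  have "E1 \<subseteq> graph Q'"
    unfolding AQ[symmetric] using Q(3) \<open>(*v) A ` E1 = E1\<close> by blast
  then have "Q = Q'"
    using iso1 Q Q' dim1 by (intro rotation_graph_unique[of E1]) (auto simp: E1_def)
  define L where "L = perp (bottom_W A) \<inter> top_V A"
  have L: "L = perp E3 \<inter> graph Q"
    by (simp add: L_def bot topV)
  have sub3: "subspace E3"
    by (simp add: E3_def subspace_real_root_space)
  have subQ: "subspace (graph Q)"
    by (intro isotropic_subspace isotropic_graph Q)
  have sub_L: "subspace L"
    unfolding L by (intro subspace_inter subspace_perp subQ)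
  have "dim (perp E3) = CARD('n) + 1"
    using dim_perp[OF sub3] dim3 \<open>0 < CARD('n)\<close> unfolding E3_def by linarith
  moreover have "dim {x + y |x y. x \<in> perp E3 \<and> y \<in> graph Q} \<le> 2 * CARD('n)"
    using dim_subset_UNIV[of "{x + y |x y. x \<in> perp E3 \<and> y \<in> graph Q}"] by simp
  ultimately have "1 \<le> dim L"
    using dim_sums_Int[OF subspace_perp[of E3] subQ] dim_graph[OF Q(1)] unfolding L by linarith
  have L_E2: "L \<subseteq> E2"
    using E2_eq sub_perp1 by (auto simp: L)
  have "dim E2 = 2"
    using dim_root_space_split[OF r, of A] dim1 dim3 \<open>0 < CARD('n)\<close>
    unfolding E2_def by (simp only: card_UNIV_sum card_Plus UNIV_Plus_UNIV[symmetric] finite)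
  \<comment> \<open>Otherwise \<open>E2\<close> would be isotropic and therefore orthogonal to
    \<open>E1\<close>, \<open>E2\<close> and \<open>E3\<close>, which span the whole space.\<close>
  have "dim L \<noteq> 2"
  proof
    assume "dim L = 2"
    then have "L = E2"
      using L_E2 sub_L \<open>dim E2 = 2\<close> by (intro subspace_dim_equal) (auto simp: E2_def subspace_real_root_space)
    have "isotropic L"
      using isotropic_graph[OF Q(1)] sub_L by (auto simp: isotropic_def L)
    then have "E2 \<subseteq> perp E1 \<inter> perp E2 \<inter> perp E3"
      using isotropic_imp_subset_perp \<open>L = E2\<close> E2_eq by blast
    moreover have "x = 0" if "x \<in> perp E1 \<inter> perp E2 \<inter> perp E3" for x
    proof (rule form_nondegenerate)
      fix w
      let ?S2 = "{\<mu>. inverse r \<le> cmod \<mu> \<and> cmod \<mu> \<le> r}"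
      have "w \<in> real_root_space A ({\<mu>. r < cmod \<mu>} \<union> (?S2 \<union> {\<mu>. cmod \<mu> < inverse r}))"
      proof -
        have "{\<mu>. r < cmod \<mu>} \<union> (?S2 \<union> {\<mu>. cmod \<mu> < inverse r}) = UNIV"
          by auto
        then show ?thesis
          by (simp only: real_root_space_UNIV UNIV_I)
      qed
      then obtain p q where p: "p \<in> E1" and q: "q \<in> real_root_space A (?S2 \<union> {\<mu>. cmod \<mu> < inverse r})"
        and w: "w = p + q"
        unfolding E1_def by (rule real_root_space_Un) auto
      from q obtain y z where yz: "y \<in> E2" "z \<in> E3" "q = y + z"
        unfolding E2_def E3_def by (rule real_root_space_Un) auto
      show "form x w = 0"
        using that p yz by (simp add: w perp_def form_add_right)
    qed
    ultimately have "E2 \<subseteq> {0}"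
      by blast
    then have "dim E2 = 0"
      by simp
    then show False
      using \<open>dim E2 = 2\<close> by simp
  qed
  moreover have "dim L \<le> 2"
    using dim_subset[OF L_E2] \<open>dim E2 = 2\<close> by simp
  ultimately have "dim L = 1"
    using \<open>1 \<le> dim L\<close> by linarith
  then have "\<not> L \<subseteq> {0}"
    by (metis dim_eq_0 zero_neq_one)
  then obtain y where y: "y \<in> L" "y \<noteq> 0"
    by blast
  define x where "x = y /\<^sub>R norm y"
  have x: "x \<in> L" "norm x = 1"
    using y sub_L by (auto simp: x_def intro: subspace_scale)
  have "span {x} = L"
    using x sub_L \<open>dim L = 1\<close> span_minimal[OF _ sub_L, of "{x}"]
    by (intro subspace_dim_equal) auto
  then have L_x: "\<exists>c. z = c *\<^sub>R x" if "z \<in> L" for z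
    using that by (auto simp: span_singleton)
  have "A *v x \<in> L"
    using x(1) AQ \<open>Q = Q'\<close> by (auto simp: L perp3 real_root_space_mult)
  then obtain c where c: "A *v x = c *\<^sub>R x"
    using L_x by blast
  have "line_eigenvalue A = c"
    unfolding line_eigenvalue_def L_def[symmetric]
  proof (rule the_equality)
    show "\<forall>z\<in>L. A *v z = c *\<^sub>R z"
    proof
      fix z assume "z \<in> L"
      then obtain d where "z = d *\<^sub>R x"
        using L_x by blast
      then show "A *v z = c *\<^sub>R z"
        by (simp add: matrix_vector_mult_scaleR c)
    qed
  next
    fix c' assume "\<forall>z\<in>L. A *v z = c' *\<^sub>R z"
    then have "c' *\<^sub>R x = c *\<^sub>R x"
      using x(1) c by simp
    then show "c' = c"
      using x(2) by auto
  qed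
  then show thesis
    using that[OF Q(1,2) _ _ _ x(2)] sub_perp1 x(1) L_E2 c by (auto simp: perp1 L E2_def)
qed

text \<open>There are finitely many eigenvalues, so \<open>r\<close> close enough to 1 leaves only
  those of modulus 1 in the annulus.\<close>

lemma spectral_gap:
  fixes g :: "real^'i^'i"
  obtains r where "1 < r" "\<And>\<mu>. \<mu> \<in> eigvals g \<Longrightarrow> inverse r \<le> cmod \<mu> \<Longrightarrow> 1 \<le> cmod \<mu>"
    "\<And>\<mu>. \<mu> \<in> eigvals g \<Longrightarrow> cmod \<mu> \<le> r \<Longrightarrow> cmod \<mu> \<le> 1"
proof -
  have fin: "finite (eigvals g)"
    using finite_eigenvalues[of "cmat g"] by (simp add: eigvals_def eigenvalues_def)
  let ?P = "\<lambda>r \<mu>. (inverse r \<le> cmod \<mu> \<longrightarrow> 1 \<le> cmod \<mu>) \<and> (cmod \<mu> \<le> r \<longrightarrow> cmod \<mu> \<le> 1)"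
  have "\<forall>\<^sub>F r in at_right 1. ?P r \<mu>" for \<mu>
  proof (rule eventually_conj)
    have inv: "((\<lambda>r. inverse r) \<longlongrightarrow> inverse (1::real)) (at_right 1)"
      by (intro tendsto_inverse tendsto_ident_at) auto
    show "\<forall>\<^sub>F r in at_right 1. inverse r \<le> cmod \<mu> \<longrightarrow> 1 \<le> cmod \<mu>"
    proof (cases "1 \<le> cmod \<mu>")
      case False
      then have "\<forall>\<^sub>F r in at_right 1. cmod \<mu> < inverse r"
        using order_tendstoD(1)[OF inv, of "cmod \<mu>"] by simp
      then show ?thesis
        by eventually_elim auto
    qed auto
    show "\<forall>\<^sub>F r in at_right 1. cmod \<mu> \<le> r \<longrightarrow> cmod \<mu> \<le> 1"
    proof (cases "cmod \<mu> \<le> 1")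
      case False
      then have "\<forall>\<^sub>F r in at_right 1. r \<in> {1<..<cmod \<mu>}"
        by (intro eventually_at_right_real) auto
      then show ?thesis
        by eventually_elim auto
    qed auto
  qed
  then have "\<forall>\<^sub>F r in at_right 1. \<forall>\<mu>\<in>eigvals g. ?P r \<mu>"
    using fin by (intro eventually_ball_finite) auto
  moreover have "\<forall>\<^sub>F r in at_right 1. r \<in> {1<..<(2::real)}"
    by (intro eventually_at_right_real) auto
  ultimately have "\<forall>\<^sub>F r in at_right 1. 1 < r \<and> (\<forall>\<mu>\<in>eigvals g. ?P r \<mu>)"
    by eventually_elim auto
  then obtain r where "1 < r \<and> (\<forall>\<mu>\<in>eigvals g. ?P r \<mu>)"
    by (metis (mono_tags, lifting) eventually_happens trivial_limit_at_right_real)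
  then show thesis
    using that[of r] by blast
qed

subsection \<open>Convergence of eigenvectors\<close>

lemma bounded_orthogonal_matrices: "bounded {Q :: real^'n^'n. orthogonal_matrix Q}"
proof (rule boundedI)
  fix Q :: "real^'n^'n" assume "Q \<in> {Q. orthogonal_matrix Q}"
  then have "orthogonal_matrix (transpose Q)"
    by (simp add: orthogonal_matrix_transpose)
  have "norm (Q $ i) = 1" for i
  proof -
    have "transpose Q *v axis i 1 = Q $ i"
      by (simp add: matrix_vector_mult_basis column_transpose row_def vec_lambda_eta)
    then show ?thesis
      using orthogonal_matrix_norm[OF \<open>orthogonal_matrix (transpose Q)\<close>, of "axis i 1"] by simp
  qed
  then show "norm Q \<le> CARD('n)"
    using L2_set_le_sum[of UNIV "\<lambda>i. norm (Q $ i)"] by (simp add: norm_vec_def)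
qed

lemma orthogonal_matrix_limit:
  fixes Q :: "nat \<Rightarrow> real^'n^'n"
  assumes "Q \<longlonglongrightarrow> Q0" "\<And>k. orthogonal_matrix (Q k)"
  shows "orthogonal_matrix Q0"
proof -
  have "norm (Q0 *v x) = norm x" for x
  proof -
    have "(\<lambda>k. norm (Q k *v x)) \<longlonglongrightarrow> norm (Q0 *v x)"
      by (intro tendsto_norm tendsto_matrix_vector_mult assms tendsto_const)
    then show ?thesis
      by (simp add: orthogonal_matrix_norm[OF assms(2)] LIMSEQ_const_iff)
  qed
  then have "orthogonal_transformation ((*v) Q0)"
    by (simp add: orthogonal_transformation matrix_vector_mul_linear)
  then show ?thesis
    by (simp add: orthogonal_transformation_matrix)
qed

lemma tendsto_pos: "(f \<longlongrightarrow> v) F \<Longrightarrow> ((\<lambda>x. pos (f x)) \<longlongrightarrow> pos v) F"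
  and tendsto_neg: "(f \<longlongrightarrow> v) F \<Longrightarrow> ((\<lambda>x. neg (f x)) \<longlongrightarrow> neg v) F"
  unfolding pos_def neg_def by (intro tendsto_vec_lambda tendsto_vec_nth; assumption)+

lemma tendsto_join:
  assumes "(f \<longlongrightarrow> x) F" "(g \<longlongrightarrow> y) F"
  shows "((\<lambda>t. join (f t) (g t)) \<longlongrightarrow> join x y) F"
proof (rule vec_tendstoI)
  fix i
  show "((\<lambda>t. join (f t) (g t) $ i) \<longlongrightarrow> join x y $ i) F"
    using assms by (cases i) (auto intro: tendsto_vec_nth)
qed

text \<open>The cutting radii lie in gaps of the spectrum of \<open>g\<close>, so the closures
  demanded by semicontinuity pick up no further eigenvalue of \<open>g\<close>, and the bounds n -
  1, 2 and n - 1 survive.\<close>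

lemma pseudo_hyperbolic_near:
  fixes g :: "'n::{finite,linorder} mat2n"
  assumes g: "pseudo_hyperbolic g"
  obtains r \<delta> where "1 < r" "0 < \<delta>"
    "real_root_space g {\<mu>. inverse r \<le> cmod \<mu>} \<subseteq> perp (real_root_space g {\<mu>. 1 < cmod \<mu>})"
    "real_root_space g {\<mu>. inverse r \<le> cmod \<mu> \<and> cmod \<mu> \<le> r} \<subseteq> real_root_space g {\<mu>. cmod \<mu> = 1}"
    "\<And>A. dist A g < \<delta> \<Longrightarrow> dim (real_root_space A {\<mu>. r < cmod \<mu>}) = CARD('n) - 1
      \<and> dim (real_root_space A {\<mu>. cmod \<mu> < inverse r}) = CARD('n) - 1"
proof -
  let ?E = "real_root_space g"
  have iso: "form_isometry g"
    using g by (auto simp: pseudo_hyperbolic_def G0_isometry)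
  have dims: "dim (?E {\<mu>. 1 < cmod \<mu>}) = CARD('n) - 1" "dim (?E {\<mu>. cmod \<mu> = 1}) = 2"
    "dim (?E {\<mu>. cmod \<mu> < 1}) = CARD('n) - 1"
    by (rule pseudo_hyperbolic_structure[OF g]; assumption)+
  obtain r where r: "1 < r" "\<And>\<mu>. \<mu> \<in> eigvals g \<Longrightarrow> inverse r \<le> cmod \<mu> \<Longrightarrow> 1 \<le> cmod \<mu>"
    "\<And>\<mu>. \<mu> \<in> eigvals g \<Longrightarrow> cmod \<mu> \<le> r \<Longrightarrow> cmod \<mu> \<le> 1"
    by (rule spectral_gap[of g]) (rule that, assumption, blast, blast)
  have E_mono: "?E S \<subseteq> ?E S'" if "S \<inter> eigvals g \<subseteq> S'" for S S'
    using real_root_space_mono[OF that, of g] real_root_space_Int_eigvals[of g S] by simp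
  let ?S1 = "{\<mu>. r < cmod \<mu>}" and ?S2 = "{\<mu>. inverse r \<le> cmod \<mu> \<and> cmod \<mu> \<le> r}"
    and ?S3 = "{\<mu>. cmod \<mu> < inverse r}"
  have E12: "?E {\<mu>. inverse r \<le> cmod \<mu>} \<subseteq> perp (?E {\<mu>. 1 < cmod \<mu>})"
  proof -
    have "perp (?E {\<mu>. 1 < cmod \<mu>}) = ?E {\<mu>. 1 \<le> cmod \<mu>}"
      using perp_root_space_gt[OF iso, of 1] by simp
    moreover have "?E {\<mu>. inverse r \<le> cmod \<mu>} \<subseteq> ?E {\<mu>. 1 \<le> cmod \<mu>}"
      using r(2) by (intro E_mono) blast
    ultimately show ?thesis
      by simp
  qed
  have E2: "?E ?S2 \<subseteq> ?E {\<mu>. cmod \<mu> = 1}"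
    using r(2,3) by (intro E_mono) force
  have "closure ?S1 \<subseteq> {\<mu>. r \<le> cmod \<mu>}"
    by (rule closure_minimal) (auto intro: closed_Collect_le continuous_intros)
  then have "dim (?E (closure ?S1)) \<le> CARD('n) - 1"
    unfolding dims(1)[symmetric] using r(1) by (intro dim_subset E_mono) auto
  moreover obtain \<delta>1 where \<delta>1: "\<delta>1 > 0" "\<And>A. dist A g < \<delta>1 \<Longrightarrow> dim (real_root_space A ?S1) \<le> dim (?E (closure ?S1))"
    using dim_real_root_space_upper_semicontinuous[of g ?S1] by blast
  have "closed ?S2"
    by (intro closed_Collect_conj closed_Collect_le continuous_intros)
  then have "dim (?E (closure ?S2)) \<le> 2"
    unfolding dims(2)[symmetric] using E2 by (simp add: dim_subset)
  moreover obtain \<delta>2 where \<delta>2: "\<delta>2 > 0" "\<And>A. dist A g < \<delta>2 \<Longrightarrow> dim (real_root_space A ?S2) \<le> dim (?E (closure ?S2))"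
    using dim_real_root_space_upper_semicontinuous[of g ?S2] by blast
  have "closure ?S3 \<subseteq> {\<mu>. cmod \<mu> \<le> inverse r}"
    by (rule closure_minimal) (auto intro: closed_Collect_le continuous_intros)
  moreover have "inverse r < 1"
    using r(1) by (simp add: inverse_less_1_iff)
  ultimately have "dim (?E (closure ?S3)) \<le> CARD('n) - 1"
    unfolding dims(3)[symmetric] by (intro dim_subset E_mono) force
  moreover obtain \<delta>3 where \<delta>3: "\<delta>3 > 0" "\<And>A. dist A g < \<delta>3 \<Longrightarrow> dim (real_root_space A ?S3) \<le> dim (?E (closure ?S3))"
    using dim_real_root_space_upper_semicontinuous[of g ?S3] by blast
  define \<delta> where "\<delta> = min \<delta>1 (min \<delta>2 \<delta>3)"
  have "dim (real_root_space A ?S1) = CARD('n) - 1 \<and> dim (real_root_space A ?S3) = CARD('n) - 1"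
    if "dist A g < \<delta>" for A
  proof -
    have "CARD('n + 'n) = 2 * CARD('n)"
      by (simp add: card_UNIV_sum)
    moreover have "dim (real_root_space A ?S1) \<le> CARD('n) - 1" "dim (real_root_space A ?S2) \<le> 2"
      "dim (real_root_space A ?S3) \<le> CARD('n) - 1"
      using that \<delta>1(2)[of A] \<delta>2(2)[of A] \<delta>3(2)[of A] \<open>dim (?E (closure ?S1)) \<le> _\<close>
        \<open>dim (?E (closure ?S2)) \<le> _\<close> \<open>dim (?E (closure ?S3)) \<le> _\<close> by (auto simp: \<delta>_def)
    ultimately show ?thesis
      using dim_root_space_split[of r A] r(1) zero_less_card_finite[where 'a = 'n] by linarith
  qed
  then show thesis
    using that[OF r(1) _ E12 E2, of \<delta>] \<delta>1(1) \<delta>2(1) \<delta>3(1) by (simp add: \<delta>_def)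
qed

text \<open>The spectral condition alone only places a limit of eigenvectors in the plane of v_0 and
  e_{2n}. Therefore a subsequence is taken of pairs of graph and vector: the limit graph is the
  rotation graph through the expanding space, hence the image of \<open>std_Vplus\<close>, and it
  cuts the plane in the right line.\<close>

lemma line_eigenvector_convergence:
  fixes g :: "'n::{finite,linorder} mat2n"
  assumes g: "pseudo_hyperbolic g" and A: "\<And>k. A k \<in> SO0_nn" "A \<longlonglongrightarrow> g"
  obtains s x a where "strict_mono s" "a \<noteq> 0" "x \<longlonglongrightarrow> a *\<^sub>R (neutral_vec g + e_neg last_ix)"
    "\<And>k. A (s k) *v x k = line_eigenvalue (A (s k)) *\<^sub>R x k"
proof -
  let ?E = "real_root_space g" and ?e = "e_neg last_ix :: 'n vec2n"
  obtain k where k: "k \<in> G0" "(*v) k ` std_Wplus = ?E {\<mu>. 1 < cmod \<mu>}"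
    "neutral_vec g = k *v e_pos last_ix"
    "\<And>x. x \<in> ?E {\<mu>. cmod \<mu> = 1} \<Longrightarrow> \<exists>a b. x = a *\<^sub>R neutral_vec g + b *\<^sub>R ?e"
    "dim (?E {\<mu>. 1 < cmod \<mu>}) = CARD('n) - 1"
    by (rule pseudo_hyperbolic_structure[OF g]) (rule that; blast)
  note iso_k = G0_isometry[OF k(1)]
  obtain r \<delta> where r: "1 < r" "0 < \<delta>"
    "?E {\<mu>. inverse r \<le> cmod \<mu>} \<subseteq> perp (?E {\<mu>. 1 < cmod \<mu>})"
    "?E {\<mu>. inverse r \<le> cmod \<mu> \<and> cmod \<mu> \<le> r} \<subseteq> ?E {\<mu>. cmod \<mu> = 1}"
    "\<And>A. dist A g < \<delta> \<Longrightarrow> dim (real_root_space A {\<mu>. r < cmod \<mu>}) = CARD('n) - 1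
      \<and> dim (real_root_space A {\<mu>. cmod \<mu> < inverse r}) = CARD('n) - 1"
    by (rule pseudo_hyperbolic_near[OF g]) (rule that; blast)
  obtain N where N: "\<And>k. k \<ge> N \<Longrightarrow> dist (A k) g < \<delta>"
    using A(2) r(2) unfolding lim_sequentially by blast
  let ?P = "\<lambda>k Q x. orthogonal_matrix Q \<and> det Q = 1
    \<and> graph Q \<subseteq> real_root_space (A (k + N)) {\<mu>. inverse r \<le> cmod \<mu>}
    \<and> x \<in> graph Q \<and> x \<in> real_root_space (A (k + N)) {\<mu>. inverse r \<le> cmod \<mu> \<and> cmod \<mu> \<le> r}
    \<and> norm x = 1 \<and> A (k + N) *v x = line_eigenvalue (A (k + N)) *\<^sub>R x"
  have "\<exists>Qx. ?P k (fst Qx) (snd Qx)" for k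
  proof -
    obtain Q x where "?P k Q x"
    proof (rule line_eigenvalue_vector[OF A(1)[of "k + N"], of r])
      show "1 \<le> r"
        using r(1) by simp
      show "dim (real_root_space (A (k + N)) {\<mu>. r < cmod \<mu>}) = CARD('n) - 1"
        "dim (real_root_space (A (k + N)) {\<mu>. cmod \<mu> < inverse r}) = CARD('n) - 1"
        using r(5)[OF N[of "k + N"]] by simp_all
    qed (rule that, blast)
    then show ?thesis
      by (intro exI[of _ "(Q, x)"]) simp
  qed
  then have "\<exists>Qx. \<forall>k. ?P k (fst (Qx k)) (snd (Qx k))"
    by (intro choice allI)
  then obtain Qx where Qx: "\<And>k. ?P k (fst (Qx k)) (snd (Qx k))"
    by blast
  define Q x where "Q k = fst (Qx k)" and "x k = snd (Qx k)" for k
  have Q: "\<And>k. orthogonal_matrix (Q k)" "\<And>k. det (Q k) = 1"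
      "\<And>k. graph (Q k) \<subseteq> real_root_space (A (k + N)) {\<mu>. inverse r \<le> cmod \<mu>}"
    and x: "\<And>k. x k \<in> graph (Q k)"
      "\<And>k. x k \<in> real_root_space (A (k + N)) {\<mu>. inverse r \<le> cmod \<mu> \<and> cmod \<mu> \<le> r}"
      "\<And>k. norm (x k) = 1" "\<And>k. A (k + N) *v x k = line_eigenvalue (A (k + N)) *\<^sub>R x k"
    using Qx unfolding Q_def x_def by blast+
  have "bounded (range (\<lambda>k. (Q k, x k)))"
  proof (rule bounded_subset)
    show "bounded ({Q :: ((real, 'n) vec, 'n) vec. orthogonal_matrix Q} \<times> sphere (0 :: 'n vec2n) 1)"
      by (intro bounded_Times bounded_orthogonal_matrices) simp
      show "range (\<lambda>k. (Q k, x k)) \<subseteq> {Q. orthogonal_matrix Q} \<times> sphere 0 1"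
      using Q(1) x(3) by (simp add: image_subset_iff)
  qed
  then obtain l s where s: "strict_mono s" "((\<lambda>k. (Q k, x k)) \<circ> s) \<longlonglongrightarrow> l"
    using bounded_imp_convergent_subsequence by blast
  define Q0 x0 where "Q0 = fst l" and "x0 = snd l"
  have Q_lim: "(\<lambda>k. Q (s k)) \<longlonglongrightarrow> Q0" and x_lim: "(\<lambda>k. x (s k)) \<longlonglongrightarrow> x0"
    using tendsto_fst[OF s(2)] tendsto_snd[OF s(2)] by (simp_all add: o_def Q0_def x0_def)
  define s' where "s' k = s k + N" for k
  have s': "strict_mono s'"
    using s(1) by (simp add: strict_mono_def s'_def)
  have A_lim: "(\<lambda>k. A (s' k)) \<longlonglongrightarrow> g"
    using LIMSEQ_subseq_LIMSEQ[OF A(2) s'] by (simp add: o_def)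
  have Q0: "orthogonal_matrix Q0"
    using orthogonal_matrix_limit[OF Q_lim] Q(1) by simp
  have "det Q0 = 1"
    using tendsto_det[OF Q_lim] by (simp add: Q(2) LIMSEQ_const_iff)
  have "x0 \<in> graph Q0"
  proof -
    have "(\<lambda>k. Q (s k) *v pos (x (s k))) \<longlonglongrightarrow> Q0 *v pos x0"
      by (intro tendsto_matrix_vector_mult Q_lim tendsto_pos x_lim)
    moreover have "Q (s k) *v pos (x (s k)) = neg (x (s k))" for k
      using x(1)[of "s k"] by (simp add: mem_graph_iff)
    ultimately show ?thesis
      using LIMSEQ_unique[OF tendsto_neg[OF x_lim]] by (simp add: mem_graph_iff)
  qed
  have "graph Q0 \<subseteq> perp (?E {\<mu>. 1 < cmod \<mu>})"
  proof
    fix v assume "v \<in> graph Q0"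
    then have v: "v = join (pos v) (Q0 *v pos v)"
      by (metis join_pos_neg mem_graph_iff)
    have "(\<lambda>k. join (pos v) (Q (s k) *v pos v)) \<longlonglongrightarrow> v"
      by (subst (2) v) (intro tendsto_join tendsto_matrix_vector_mult Q_lim tendsto_const)
    moreover have "join (pos v) (Q (s k) *v pos v) \<in> real_root_space (A (s' k)) {\<mu>. inverse r \<le> cmod \<mu>}" for k
      using Q(3)[of "s k"] by (auto simp: graph_def s'_def)
    ultimately have "v \<in> ?E (closure {\<mu>. inverse r \<le> cmod \<mu>})"
      using real_root_space_limit[OF A_lim] by blast
    moreover have "closed {\<mu>. inverse r \<le> cmod \<mu>}"
      by (intro closed_Collect_le continuous_intros)
    ultimately show "v \<in> perp (?E {\<mu>. 1 < cmod \<mu>})"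
      using r(3) by auto
  qed
  then have "\<forall>w\<in>graph Q0. \<forall>v\<in>?E {\<mu>. 1 < cmod \<mu>}. form w v = 0"
    by (auto simp: perp_def)
  then have "?E {\<mu>. 1 < cmod \<mu>} \<subseteq> perp (graph Q0)"
    unfolding perp_def by (intro subsetI CollectI ballI) (subst form_commute, blast)
  then have E1_Q0: "?E {\<mu>. 1 < cmod \<mu>} \<subseteq> graph Q0"
    by (simp add: perp_graph Q0)
  obtain Q1 where Q1: "orthogonal_matrix Q1" "det Q1 = 1" "(*v) k ` std_Vplus = graph Q1"
    using SO0_orbit_std_Vplus[of k] k(1) by (auto simp: G0_def)
  have "std_Wplus \<subseteq> (std_Vplus :: 'n vec2n set)"
    by (auto simp: std_Vplus_eq mem_graph_iff std_Wplus_iff)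
  then have E1_Q1: "?E {\<mu>. 1 < cmod \<mu>} \<subseteq> graph Q1"
    unfolding k(2)[symmetric] Q1(3)[symmetric] by blast
  have "isotropic (?E {\<mu>. 1 < cmod \<mu>})"
    unfolding k(2)[symmetric] by (intro isotropic_image iso_k isotropic_std_Wplus)
  then have "Q0 = Q1"
    using k(5) by (intro rotation_graph_unique[OF _ _ Q0 \<open>det Q0 = 1\<close> E1_Q0 Q1(1,2) E1_Q1]) simp_all
  then obtain y where y: "y \<in> std_Vplus" "x0 = k *v y"
    using \<open>x0 \<in> graph Q0\<close> Q1(3) by blast
  have "x0 \<in> ?E (closure {\<mu>. inverse r \<le> cmod \<mu> \<and> cmod \<mu> \<le> r})"
    using real_root_space_limit[OF A_lim x_lim] x(2) by (simp add: s'_def)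
  moreover have "closed {\<mu>. inverse r \<le> cmod \<mu> \<and> cmod \<mu> \<le> r}"
    by (intro closed_Collect_conj closed_Collect_le continuous_intros)
  ultimately have "x0 \<in> ?E {\<mu>. cmod \<mu> = 1}"
    using r(4) by auto
  then obtain a b where ab: "x0 = a *\<^sub>R neutral_vec g + b *\<^sub>R ?e"
    using k(4) by blast
  \<comment> \<open>Pulled back by \<open>k\<close>, the vector lies in \<open>std_Vplus\<close>,
    where the coefficients of e_n and e_{2n} agree.\<close>
  have "k *v (a *\<^sub>R e_pos last_ix + b *\<^sub>R ?e - y) = 0"
    using k(1) ab y(2)
    by (simp add: G0_def k(3) matrix_vector_mult_diff_distrib matrix_vector_right_distrib matrix_vector_mult_scaleR)
  then have "y = a *\<^sub>R e_pos last_ix + b *\<^sub>R ?e"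
    using form_isometry_inj[OF iso_k] by (metis eq_iff_diff_eq_0)
  then have "b *\<^sub>R axis last_ix (1::real) = a *\<^sub>R axis last_ix 1"
    using y(1) by (simp add: std_Vplus_eq mem_graph_iff pos_add neg_add pos_scaleR neg_scaleR)
  then have "b = a"
    by (simp add: axis_eq_0_iff)
  have "norm x0 = 1"
    using tendsto_norm[OF x_lim] by (simp add: x(3) LIMSEQ_const_iff)
  then have "a \<noteq> 0"
    using ab \<open>b = a\<close> by auto
  then show thesis
    using that[OF s' \<open>a \<noteq> 0\<close>, of "\<lambda>k. x (s k)"] x_lim x(4) by (simp add: ab \<open>b = a\<close> scaleR_add_right s'_def)
qed

subsection \<open>The derivative\<close>

lemma has_vector_derivative_imp_quotient_tendsto:
  assumes "(f has_vector_derivative D) (at 0)"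
  shows "((\<lambda>t. (f t - f 0) /\<^sub>R t) \<longlongrightarrow> D) (at 0)"
proof -
  have "((\<lambda>t. norm (f t - f 0 - t *\<^sub>R D) / \<bar>t\<bar>) \<longlongrightarrow> 0) (at 0)"
    using assms by (simp add: has_vector_derivative_def has_derivative_at)
  moreover have "norm (f t - f 0 - t *\<^sub>R D) / \<bar>t\<bar> = norm ((f t - f 0) /\<^sub>R t - D)" if "t \<noteq> 0" for t
  proof -
    have "(f t - f 0) /\<^sub>R t - D = (f t - f 0 - t *\<^sub>R D) /\<^sub>R t"
      using that by (simp add: scaleR_diff_right)
    then show ?thesis
      by (simp add: divide_inverse mult.commute)
  qed
  then have "\<forall>\<^sub>F t in at 0. norm (f t - f 0 - t *\<^sub>R D) / \<bar>t\<bar> = norm ((f t - f 0) /\<^sub>R t - D)"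
    unfolding eventually_at_filter by (intro always_eventually allI impI)
  ultimately have "((\<lambda>t. norm ((f t - f 0) /\<^sub>R t - D)) \<longlongrightarrow> 0) (at 0)"
    by (rule Lim_transform_eventually)
  then show ?thesis
    by (metis LIM_zero_cancel tendsto_norm_zero_iff)
qed

text \<open>Expanding the invariance at 1 + s C and dividing by s leaves the skew expression plus s
  times a bounded term; a single null sequence suffices.\<close>

lemma form_isometry_path_derivative:
  fixes B :: "real \<Rightarrow> 'n::finite mat2n"
  assumes iso: "\<And>t. t \<in> T \<Longrightarrow> form_isometry (B t)" and T: "open T" "0 \<in> T"
    and B0: "B 0 = mat 1" and D: "(B has_vector_derivative X) (at 0)"
  shows "form (X *v u) w + form u (X *v w) = 0"
proof -
  define s where "s k = inverse (real (Suc k))" for k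
  have s_lim: "s \<longlonglongrightarrow> 0"
    unfolding s_def by (rule LIMSEQ_inverse_real_of_nat)
  have s_pos: "s k \<noteq> 0" for k
    by (simp add: s_def)
  define C where "C k = (B (s k) - mat 1) /\<^sub>R s k" for k
  have "filterlim s (at 0) sequentially"
    using s_lim s_pos by (simp add: filterlim_at)
  then have C_lim: "C \<longlonglongrightarrow> X"
    using filterlim_compose[OF has_vector_derivative_imp_quotient_tendsto[OF D]]
    by (simp add: C_def[abs_def] B0)
  have BC: "B (s k) *v x = x + s k *\<^sub>R (C k *v x)" for k x
  proof -
    have "B (s k) = mat 1 + s k *\<^sub>R C k"
      using s_pos by (simp add: C_def)
    then show ?thesis
      by (simp add: matrix_vector_mult_add_rdistrib flip: scaleR_matrix_vector_assoc)
  qed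
  have "\<forall>\<^sub>F k in sequentially. s k \<in> T"
    using T s_lim topological_tendstoD by blast
  then have "\<forall>\<^sub>F k in sequentially. form (C k *v u) w + form u (C k *v w) + s k * form (C k *v u) (C k *v w) = 0"
  proof eventually_elim
    case (elim k)
    have "form (u + s k *\<^sub>R (C k *v u)) (w + s k *\<^sub>R (C k *v w)) = form u w"
      using form_isometryD[OF iso[OF elim], of u w] by (simp add: BC)
    then have "s k * (form (C k *v u) w + form u (C k *v w) + s k * form (C k *v u) (C k *v w)) = 0"
      by (simp add: form_add_left form_add_right form_scaleR_left form_scaleR_right algebra_simps)
    then show ?case
      using s_pos by simp
  qed
  moreover have "(\<lambda>k. form (C k *v u) w + form u (C k *v w) + s k * form (C k *v u) (C k *v w))
      \<longlonglongrightarrow> form (X *v u) w + form u (X *v w) + 0 * form (X *v u) (X *v w)"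
    by (intro tendsto_add tendsto_mult tendsto_form tendsto_matrix_vector_mult C_lim s_lim tendsto_const)
  ultimately have "(\<lambda>k. 0) \<longlonglongrightarrow> form (X *v u) w + form u (X *v w) + 0 * form (X *v u) (X *v w)"
    by (rule Lim_transform_eventually[rotated])
  then show ?thesis
    by (simp add: LIMSEQ_const_iff)
qed

text \<open>For the constant sequence \<open>g\<close> the eigenvalue is the same all along, while
  the limit of the eigenvectors is a nonzero vector fixed by \<open>g\<close>.\<close>

lemma line_eigenvalue_pseudo_hyperbolic:
  fixes g :: "'n::{finite,linorder} mat2n"
  assumes g: "pseudo_hyperbolic g"
  shows "line_eigenvalue g = 1"
proof -
  have gv: "g *v neutral_vec g = neutral_vec g"
    by (rule pseudo_hyperbolic_structure[OF g])
  have "g \<in> SO0_nn" and ge: "g *v e_neg last_ix = e_neg last_ix"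
    using g by (auto simp: pseudo_hyperbolic_def G0_def)
  obtain x a where x: "a \<noteq> 0" "x \<longlonglongrightarrow> a *\<^sub>R (neutral_vec g + e_neg last_ix)"
    "\<And>k. g *v x k = line_eigenvalue g *\<^sub>R x k"
    by (rule line_eigenvector_convergence[OF g \<open>g \<in> SO0_nn\<close> tendsto_const])
      (rule that, assumption, assumption, blast)
  let ?y = "a *\<^sub>R (neutral_vec g + e_neg last_ix)"
  have "(\<lambda>k. g *v x k) \<longlonglongrightarrow> g *v ?y"
    by (intro tendsto_matrix_vector_mult x tendsto_const)
  moreover have "(\<lambda>k. g *v x k) \<longlonglongrightarrow> line_eigenvalue g *\<^sub>R ?y"
    unfolding x(3) by (intro tendsto_scaleR x tendsto_const)
  ultimately have "line_eigenvalue g *\<^sub>R ?y = ?y"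
    using LIMSEQ_unique by (fastforce simp: matrix_vector_mult_scaleR matrix_vector_right_distrib gv ge)
  moreover have "?y \<noteq> 0"
  proof
    assume "?y = 0"
    then have "neutral_vec g + e_neg last_ix = 0"
      using x(1) by simp
    moreover have "neutral_vec g \<in> R_odd"
    proof (rule pseudo_hyperbolic_structure[OF g])
      fix k assume "k \<in> G0" "neutral_vec g = k *v e_pos last_ix"
      then show ?thesis
        by (simp add: G0_R_odd_iff) (simp add: mem_R_odd_iff e_pos_def axis_def)
    qed
    ultimately have "(e_neg last_ix :: 'n vec2n) $ Inr last_ix = 0"
      by (metis add_0 mem_R_odd_iff vector_add_component zero_index)
    then show False
      by (simp add: e_neg_def)
  qed
  ultimately show ?thesis
    by (metis scaleR_cancel_right scaleR_one)
qed

lemma tendsto_matrix_mult_const: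
  fixes M :: "'a \<Rightarrow> real^'i^'j"
  assumes "(M \<longlongrightarrow> M0) F"
  shows "((\<lambda>t. M t ** N) \<longlongrightarrow> M0 ** N) F"
  unfolding matrix_matrix_mult_def
  by (intro tendsto_vec_lambda tendsto_sum tendsto_mult tendsto_vec_nth assms tendsto_const)

text \<open>The sequential form of the derivative. Passing to a subsequence does no harm, since the
  theorem is proved by contradiction from a sequence of bad parameters.\<close>

lemma line_eigenvalue_quotient_tendsto:
  fixes g :: "'n::{finite,linorder} mat2n"
  assumes g: "pseudo_hyperbolic g" and A: "\<And>k. A k \<in> SO0_nn"
    and s: "s \<longlonglongrightarrow> 0" "\<And>k. s k \<noteq> 0"
    and C: "C \<longlonglongrightarrow> X" "\<And>k. A k = (mat 1 + s k *\<^sub>R C k) ** g"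
    and skew: "\<And>u w. form (X *v u) w + form u (X *v w) = 0"
  obtains l where "strict_mono l"
    "(\<lambda>k. (line_eigenvalue (A (l k)) - 1) / s (l k)) \<longlonglongrightarrow> margulis g (X *v e_neg last_ix)"
proof -
  let ?e = "e_neg last_ix :: 'n vec2n" and ?v = "neutral_vec g"
  have G0: "g \<in> G0"
    using g unfolding pseudo_hyperbolic_def by blast
  note iso = G0_isometry[OF G0]
  have ge: "g *v ?e = ?e"
    using G0 by (simp add: G0_def)
  have gv: "g *v ?v = ?v"
    by (rule pseudo_hyperbolic_structure[OF g])
  obtain k where k: "k \<in> G0" "?v = k *v e_pos last_ix"
    by (rule pseudo_hyperbolic_structure[OF g])
  have form_vv: "form ?v ?v = 1"
    unfolding k(2) form_isometryD[OF G0_isometry[OF k(1)]] by (simp add: form_eq inner_axis_axis)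
  have "form ?v (k *v ?e) = 0"
    unfolding k(2) form_isometryD[OF G0_isometry[OF k(1)]] by (simp add: form_eq)
  then have form_ve: "form ?v ?e = 0" "form ?e ?v = 0"
    using k(1) by (simp_all add: G0_def form_commute)
  have form_ee: "form ?e ?e = -1"
    by (simp add: form_eq inner_axis_axis)
  have "(\<lambda>k. (mat 1 + s k *\<^sub>R C k) ** g) \<longlonglongrightarrow> (mat 1 + 0 *\<^sub>R X) ** g"
  proof -
    have "(\<lambda>k. mat 1 + s k *\<^sub>R C k) \<longlonglongrightarrow> mat 1 + 0 *\<^sub>R X"
      by (intro tendsto_intros s C)
    then show ?thesis
      by (rule tendsto_matrix_mult_const)
  qed
  moreover have "A = (\<lambda>k. (mat 1 + s k *\<^sub>R C k) ** g)"
    by (rule ext) (rule C(2))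
  ultimately have "A \<longlonglongrightarrow> g"
    by simp
  then obtain l x a where l: "strict_mono l" and x: "a \<noteq> 0" "x \<longlonglongrightarrow> a *\<^sub>R (?v + ?e)"
    "\<And>k. A (l k) *v x k = line_eigenvalue (A (l k)) *\<^sub>R x k"
    by (rule line_eigenvector_convergence[where A = A, OF g A]) (rule that, assumption, assumption, assumption, blast)
  define y where "y = ?v - ?e"
  have gy: "g *v y = y"
    by (simp add: y_def matrix_vector_mult_diff_distrib gv ge)
  have key: "(line_eigenvalue (A (l k)) - 1) * form (x k) y = s (l k) * form (C (l k) *v (g *v x k)) y" for k
  proof -
    have "A (l k) *v x k = g *v x k + s (l k) *\<^sub>R (C (l k) *v (g *v x k))"
      by (simp add: C(2) matrix_vector_mult_add_rdistrib flip: matrix_vector_mul_assoc scaleR_matrix_vector_assoc)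
    then have "line_eigenvalue (A (l k)) * form (x k) y
        = form (g *v x k) y + s (l k) * form (C (l k) *v (g *v x k)) y"
      by (metis x(3) form_add_left form_scaleR_left)
    moreover have "form (g *v x k) y = form (x k) y"
      using form_isometryD[OF iso, of "x k" y] by (simp add: gy)
    ultimately show ?thesis
      by (simp add: algebra_simps)
  qed
  have Cl: "(\<lambda>k. C (l k)) \<longlonglongrightarrow> X"
    using LIMSEQ_subseq_LIMSEQ[OF C(1) l] by (simp add: o_def)
  have den: "(\<lambda>k. form (x k) y) \<longlonglongrightarrow> form (a *\<^sub>R (?v + ?e)) y"
    by (intro tendsto_form x tendsto_const)
  \<comment> \<open>The pairing of v_0 + e_{2n} with v_0 - e_{2n} is 1 - (-1).\<close>
  have den_eq: "form (a *\<^sub>R (?v + ?e)) y = 2 * a"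
    by (simp add: y_def form_scaleR_left form_add_left form_diff_right form_vv form_ve form_ee)
  have num: "(\<lambda>k. form (C (l k) *v (g *v x k)) y) \<longlonglongrightarrow> form (X *v (g *v (a *\<^sub>R (?v + ?e)))) y"
    by (intro tendsto_form tendsto_matrix_vector_mult Cl x tendsto_const)
  \<comment> \<open>Skewness kills the two diagonal terms and makes the two mixed terms equal, which
    produces the factor 2 that cancels against the denominator.\<close>
  have num_eq: "form (X *v (g *v (a *\<^sub>R (?v + ?e)))) y = 2 * a * margulis g (X *v ?e)"
  proof -
    have "form (X *v ?v) ?v = 0" "form (X *v ?e) ?e = 0" "form (X *v ?v) ?e = - form (X *v ?e) ?v"
      using skew[of ?v ?v] skew[of ?e ?e] skew[of ?v ?e] by (simp_all add: form_commute)
    then show ?thesis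
      by (simp add: y_def margulis_def matrix_vector_mult_scaleR matrix_vector_right_distrib gv ge
          form_scaleR_left form_add_left form_diff_right algebra_simps)
  qed
  have "(\<lambda>k. form (C (l k) *v (g *v x k)) y / form (x k) y) \<longlonglongrightarrow> margulis g (X *v ?e)"
    using tendsto_divide[OF num den] x(1) by (simp add: den_eq num_eq)
  moreover have "\<forall>\<^sub>F k in sequentially. form (x k) y \<noteq> 0"
    by (intro tendsto_imp_eventually_ne[OF den]) (simp add: den_eq x(1))
  then have "\<forall>\<^sub>F k in sequentially. form (C (l k) *v (g *v x k)) y / form (x k) y
      = (line_eigenvalue (A (l k)) - 1) / s (l k)"
  proof eventually_elim
    case (elim k)
    then show ?case
      using key[of k] s(2)[of "l k"] by (simp add: field_simps)
  qed
  ultimately have "(\<lambda>k. (line_eigenvalue (A (l k)) - 1) / s (l k)) \<longlonglongrightarrow> margulis g (X *v ?e)"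
    by (rule Lim_transform_eventually)
  then show thesis
    using that l by blast
qed

theorem lemma1p1:
  fixes g :: "'n::{finite,linorder} mat2n"
    and gt :: "real \<Rightarrow> 'n mat2n"
    and X :: "'n mat2n"
    and v :: "'n vec2n"
    and T :: "real set"
  assumes "pseudo_hyperbolic g"
    and "open T" and "is_interval T" and "0 \<in> T"
    and "\<forall>t\<in>T. gt t \<in> SO0_nn"
    and "real_analytic_on gt T"
    and "gt 0 = g"
    and "((\<lambda>t. gt t ** matrix_inv g) has_vector_derivative X) (at 0)"
    and "X *v e_neg last_ix = v"
  shows "((\<lambda>t. line_eigenvalue (gt t)) has_real_derivative margulis g v) (at 0)"
proof -
  have G0: "g \<in> G0"
    using assms(1) unfolding pseudo_hyperbolic_def by blast
  note inv = form_isometry_matrix_inv[OF G0_isometry[OF G0]]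
  \<comment> \<open>Translating the path to the identity makes its derivative the tangent direction
    \<open>X\<close> and lets the skewness lemma apply.\<close>
  define B where "B t = gt t ** matrix_inv g" for t
  have B0: "B 0 = mat 1"
    by (simp add: B_def assms(7) inv)
  have gt_B: "gt t = B t ** g" for t
    by (simp add: B_def inv flip: matrix_mul_assoc)
  have D: "(B has_vector_derivative X) (at 0)"
    using assms(8) by (simp add: B_def[abs_def])
  have "form_isometry (matrix_inv g)"
    unfolding form_isometry_iff
  proof (intro allI)
    fix u w
    have "form (g *v (matrix_inv g *v u)) (g *v (matrix_inv g *v w))
        = form (matrix_inv g *v u) (matrix_inv g *v w)"
      by (rule form_isometryD[OF G0_isometry[OF G0]])
    then show "form (matrix_inv g *v u) (matrix_inv g *v w) = form u w"
      by (simp add: matrix_vector_mul_assoc inv)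
  qed
  then have iso_B: "form_isometry (B t)" if "t \<in> T" for t
    using assms(5) that by (auto simp: B_def intro: form_isometry_mult SO0_nn_isometry)
  note skew = form_isometry_path_derivative[OF iso_B assms(2,4) B0 D]
  let ?F = "\<lambda>t. line_eigenvalue (gt t)" and ?D = "margulis g v"
  have F0: "?F 0 = 1"
    by (simp add: assms(1,7) line_eigenvalue_pseudo_hyperbolic)
  obtain \<epsilon> where \<epsilon>: "\<epsilon> > 0" "ball 0 \<epsilon> \<subseteq> T"
    using assms(2,4) open_contains_ball by blast
  have "((\<lambda>t. (?F t - 1) / t) \<longlongrightarrow> ?D) (at 0)"
  proof (rule ccontr)
    assume "\<not> ?thesis"
    then obtain d where d: "d > 0"
      "\<And>b. b > 0 \<Longrightarrow> \<exists>t. t \<noteq> 0 \<and> norm (t - 0) < b \<and> \<not> norm ((?F t - 1) / t - ?D) < d"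
      unfolding LIM_eq by blast
    \<comment> \<open>The bound \<epsilon> keeps the bad parameters inside \<open>T\<close>, and the
      second bound sends them to 0.\<close>
    have "\<exists>t. t \<noteq> 0 \<and> norm (t - 0) < min \<epsilon> (inverse (real (Suc k))) \<and> \<not> norm ((?F t - 1) / t - ?D) < d" for k
      by (rule d(2)) (use \<epsilon>(1) in simp)
    then obtain s where s: "\<And>k. s k \<noteq> 0 \<and> norm (s k - 0) < min \<epsilon> (inverse (real (Suc k)))
        \<and> \<not> norm ((?F (s k) - 1) / s k - ?D) < d"
      by metis
    have sT: "s k \<in> T" for k
      using s[of k] \<epsilon>(2) by (auto simp: subset_iff)
    have s_lim: "s \<longlonglongrightarrow> 0"
    proof (rule Lim_null_comparison[OF _ LIMSEQ_inverse_real_of_nat])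
      show "\<forall>\<^sub>F k in sequentially. norm (s k) \<le> inverse (real (Suc k))"
        using s by (auto intro!: always_eventually less_imp_le)
    qed
    define C where "C k = (B (s k) - mat 1) /\<^sub>R s k" for k
    have "filterlim s (at 0) sequentially"
      using s_lim s by (simp add: filterlim_at)
    then have C_lim: "C \<longlonglongrightarrow> X"
      using filterlim_compose[OF has_vector_derivative_imp_quotient_tendsto[OF D]]
      by (simp add: C_def[abs_def] B0)
    obtain l where l: "strict_mono l" "(\<lambda>k. (?F (s (l k)) - 1) / s (l k)) \<longlonglongrightarrow> ?D"
    proof (rule line_eigenvalue_quotient_tendsto[where A = "\<lambda>k. gt (s k)", OF assms(1) _ s_lim _ C_lim _ skew])
      show "gt (s k) = (mat 1 + s k *\<^sub>R C k) ** g" for k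
        using s[of k] by (simp add: gt_B C_def)
      show "gt (s k) \<in> SO0_nn" for k
        using assms(5) sT by blast
      show "s k \<noteq> 0" for k
        using s by blast
      fix l assume "strict_mono l"
        "(\<lambda>k. (?F (s (l k)) - 1) / s (l k)) \<longlonglongrightarrow> margulis g (X *v e_neg last_ix)"
      then show thesis
        unfolding assms(9) by (rule that)
    qed
    then obtain k where "norm ((?F (s (l k)) - 1) / s (l k) - ?D) < d"
      using LIMSEQ_D[OF l(2) d(1)] by blast
    then show False
      using s by blast
  qed
  then show ?thesis
    by (simp add: DERIV_def F0)
qed

end
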